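(* Let $k^{-m}<p\le 1$. For $Q$-almost all $(\eta,\omega)\in I^{\mathbb N}\times\Omega$ the following holds: for all $\alpha\in(0,1)\setminus D$, the $\alpha$-mean porosities $\kappa(K_\omega,x(\eta),\alpha)$ and $\kappa(\nu_\omega,x(\eta),\alpha)$ exist and $$\kappa(K_\omega,x(\eta),\alpha)=\kappa(\nu_\omega,x(\eta),\alpha).$$
   Context: Mandelbrot percolation. $\mathbb N=\{1,2,\dots\}$. Fix integers $m\ge 1$, $k\ge 2$ and a probability $p$. Let $I=\{1,\dots,k^m\}$ and $I^*=\bigcup_{i\ge 0}I^i$ (finite words, $I^0$ consisting of the empty word $\emptyset$), let $|\sigma|$ be the length of a word, $\eta|_i$ the prefix of length $i$ of $\eta\in I^*\cup I^{\mathbb N}$, $\sigma*\tau$ concatenation, and write $\sigma\prec\tau$ (or $\tau\succ\sigma$) if $\tau$ starts with $\sigma$. Let $J_\emptyset=[0,1]^m$; each closed cube $J_\sigma$ of side length $k^{-|\sigma|}$ is divided into $k^m$ closed $k$-adic subcubes $J_{\sigma*1},\dots,J_{\sigma*k^m}$ of side length $k^{-|\sigma|-1}$ (in a fixed enumeration). For $\eta\in I^{\mathbb N}$, $x(\eta)$ is the unique point of $\bigcap_{i\ge0}J_{\eta|_i}$. $\Omega$ is the set of functions $\omega:I^*\to\{c,n\}$ ($c$ = chosen, $n$ = neglected) with the product topology. $P$ is the Borel probability measure on $\Omega$ such that $\omega(\emptyset)=c$ almost surely and, going from each level to the next, if $\omega(\sigma)=c$ then each $\sigma*j$, $j\in I$,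 is chosen independently with probability $p$, while if $\omega(\sigma)=n$ then $\omega(\sigma*j)=n$ for all $j$. The limit set is $K_\omega=\bigcap_{i\ge0}\bigcup_{\sigma\in I^i,\ \omega(\sigma)=c}J_\sigma$. Natural measures. Let $d=\log(k^mp)/\log k$. For $\sigma\in I^*$ let $N_{j,\sigma}=\operatorname{card}\{\tau\in I^*: |\tau|=|\sigma|+j,\ \tau\succ\sigma,\ \omega(\tau)=c\}$ and let $X_\sigma(\omega)=\lim_{j\to\infty}N_{j,\sigma}k^{-jd}$ (a $P$-almost sure finite martingale limit). For $P$-almost every $\omega$, $\mu_\omega$ is the Borel measure on $I^{\mathbb N}$ with $\mu_\omega(\{\eta:\eta|_{|\sigma|}=\sigma\})=(\operatorname{diam}J_\emptyset)^dk^{-|\sigma|d}X_\sigma(\omega)$ for all $\sigma\in I^*$; the natural measure $\nu_\omega$ on $K_\omega$ is the image of $\mu_\omega$ under $\eta\mapsto x(\eta)$. $Q$ is the Borel probability measure on $I^{\mathbb N}\times\Omega$ given by $Q(B)=(\operatorname{diam}J_\emptyset)^{-d}\int\mu_\omega(\{\eta:(\eta,\omega)\in B\})\,dP(\omega)$; $E_Q$ is expectation with respect to $Q$. Holes and mean porosity. $B_\varrho(z,r)$ is the open ball of the maximum metric $\varrho(x,y)=\max_i|x_i-y_i|$ in $\mathbb R^m$. For $j\in\mathbb N\cup\{0\}$, $Q_j^k(x)$ is the half-open $k$-adic cube $\prod_i[a_ik^{-j},(a_i+1)k^{-j})$, $a_i\in\mathbb Z$, containing $x$. A set $A\subset\mathbb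 R^m$ has an $\alpha$-hole at scale $j$ near $x$ if there is $z\in Q_j^k(x)$ with $B_\varrho(z,\tfrac12\alpha k^{-j})\subset Q_j^k(x)\setminus A$. A Radon measure $\mu$ has an $(\alpha,\varepsilon)$-hole at scale $j$ near $x$ if there is $z\in Q_j^k(x)$ with $B_\varrho(z,\tfrac12\alpha k^{-j})\subset Q_j^k(x)$ and $\mu(B_\varrho(z,\tfrac12\alpha k^{-j}))\le\varepsilon\mu(Q_j^k(x))$. Let $N_i(A,x,\alpha)$ be the number of $j\in\{1,\dots,i\}$ such that $A$ has an $\alpha$-hole at scale $j$ near $x$, and $\widetilde N_i(\mu,x,\alpha,\varepsilon)$ the number of $j\in\{1,\dots,i\}$ such that $\mu$ has an $(\alpha,\varepsilon)$-hole at scale $j$ near $x$. Set $\underline\kappa(A,x,\alpha)=\liminf_{i\to\infty}N_i(A,x,\alpha)/i$, $\overline\kappa(A,x,\alpha)=\limsup_{i\to\infty}N_i(A,x,\alpha)/i$, $\underline\kappa(\mu,x,\alpha)=\lim_{\varepsilon\to0}\liminf_{i\to\infty}\widetilde N_i(\mu,x,\alpha,\varepsilon)/i$, $\overline\kappa(\mu,x,\alpha)=\lim_{\varepsilon\to0}\limsup_{i\to\infty}\widetilde N_i(\mu,x,\alpha,\varepsilon)/i$. When lower and upper values coincide, the common value is the $\alpha$-mean porosity, denoted $\kappa(A,x,\alpha)$, respectively $\kappa(\mu,x,\alpha)$. Exceptional set. For $\alpha\in[0,1]$, $\chi_0^\alpha(\eta,\omega)=1$ if $K_\omega$ has an $\alpha$-hole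 at scale $0$ near $x(\eta)$, and $\chi_0^\alpha(\eta,\omega)=0$ otherwise. $D$ is the (countable) set of $\alpha\in(0,1)$ at which the decreasing function $\beta\mapsto E_Q[\chi_0^\beta]$ is discontinuous. *)

theory Defs
  imports "HOL-Probability.Probability" "HOL-Library.Sublist"
begin

section \<open>Words and codes\<close>

definition letters :: "nat \<Rightarrow> nat \<Rightarrow> nat set" where
  "letters m k = {1..k ^ m}"

definition words :: "nat \<Rightarrow> nat \<Rightarrow> nat list set" where
  "words m k = lists (letters m k)"

definition codes :: "nat \<Rightarrow> nat \<Rightarrow> (nat \<Rightarrow> nat) set" where
  "codes m k = (UNIV \<rightarrow>\<^sub>E letters m k)"

definition code_prefix :: "(nat \<Rightarrow> nat) \<Rightarrow> nat \<Rightarrow> nat list" where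
  "code_prefix \<eta> i = map \<eta> [0..<i]"

definition cylinder :: "nat \<Rightarrow> nat \<Rightarrow> nat list \<Rightarrow> (nat \<Rightarrow> nat) set" where
  "cylinder m k \<sigma> = {\<eta> \<in> codes m k. code_prefix \<eta> (length \<sigma>) = \<sigma>}"

text \<open>
  Both sequence spaces below are countable products of finite discrete spaces, so the product
  sigma-algebra is the Borel sigma-algebra of the product topology.
\<close>

definition code_algebra :: "nat \<Rightarrow> nat \<Rightarrow> (nat \<Rightarrow> nat) measure" where
  "code_algebra m k = (\<Pi>\<^sub>M i\<in>UNIV. count_space (letters m k))"

text \<open>
  A configuration is an extensional function on the words; \<open>True\<close> stands for chosen and
  \<open>False\<close> for neglected.
\<close>

definition config_algebra :: "nat \<Rightarrow> nat \<Rightarrow> (nat list \<Rightarrow> bool) measure" where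
  "config_algebra m k = (\<Pi>\<^sub>M \<sigma>\<in>words m k. count_space UNIV)"

section \<open>The percolation measure\<close>

text \<open>
  Every word carries an independent coin with success probability \<open>p\<close>.  The empty word is
  chosen, and \<open>\<sigma> @ [j]\<close> is chosen iff \<open>\<sigma>\<close> is chosen and the coin of \<open>\<sigma> @ [j]\<close> shows
  success, i.e. iff the coins of all its nonempty prefixes do.
\<close>

definition coin_measure :: "nat \<Rightarrow> nat \<Rightarrow> real \<Rightarrow> (nat list \<Rightarrow> bool) measure" where
  "coin_measure m k p = (\<Pi>\<^sub>M \<sigma>\<in>words m k. measure_pmf (bernoulli_pmf p))"

definition config_of_coins ::
    "nat \<Rightarrow> nat \<Rightarrow> (nat list \<Rightarrow> bool) \<Rightarrow> (nat list \<Rightarrow> bool)" where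
  "config_of_coins m k b = (\<lambda>\<sigma>\<in>words m k. \<forall>l\<in>{1..length \<sigma>}. b (take l \<sigma>))"

definition percolation :: "nat \<Rightarrow> nat \<Rightarrow> real \<Rightarrow> (nat list \<Rightarrow> bool) measure" where
  "percolation m k p = distr (coin_measure m k p) (config_algebra m k) (config_of_coins m k)"

lemma take_word: "\<sigma> \<in> words m k \<Longrightarrow> take l \<sigma> \<in> words m k"
  by (auto simp: words_def in_lists_conv_set dest: in_set_takeD)

lemma measurable_config_of_coins:
  "config_of_coins m k \<in> measurable (coin_measure m k p) (config_algebra m k)"
  unfolding config_of_coins_def config_algebra_def
proof (rule measurable_restrict)
  fix \<sigma> assume \<sigma>: "\<sigma> \<in> words m k"
  show "(\<lambda>b. \<forall>l\<in>{1..length \<sigma>}. b (take l \<sigma>)) \<in> measurable (coin_measure m k p) (count_space UNIV)"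
  proof (rule pred_intros_finite)
    fix l
    have "(\<lambda>b. b (take l \<sigma>)) \<in> measurable (coin_measure m k p) (measure_pmf (bernoulli_pmf p))"
      unfolding coin_measure_def by (rule measurable_component_singleton[OF take_word[OF \<sigma>]])
    then show "Measurable.pred (coin_measure m k p) (\<lambda>b. b (take l \<sigma>))"
      by (simp add: measurable_def)
  qed simp
qed

lemma prob_space_percolation: "prob_space (percolation m k p)"
  unfolding percolation_def
  by (intro prob_space.prob_space_distr measurable_config_of_coins)
     (auto simp: coin_measure_def intro!: prob_space_PiM prob_space_measure_pmf)

definition chosen_level :: "nat \<Rightarrow> nat \<Rightarrow> nat \<Rightarrow> (nat list \<Rightarrow> bool) \<Rightarrow> nat list set" where
  "chosen_level m k n \<omega> = {\<sigma> \<in> words m k. length \<sigma> = n \<and> \<omega> \<sigma>}"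

definition children :: "nat \<Rightarrow> nat \<Rightarrow> nat list set \<Rightarrow> nat list set" where
  "children m k S = (\<lambda>(\<sigma>, j). \<sigma> @ [j]) ` (S \<times> letters m k)"

lemma config_snoc:
  assumes "\<sigma> \<in> words m k" "j \<in> letters m k"
  shows "config_of_coins m k b (\<sigma> @ [j]) \<longleftrightarrow> config_of_coins m k b \<sigma> \<and> b (\<sigma> @ [j])"
proof -
  have "\<sigma> @ [j] \<in> words m k" using assms by (auto simp: words_def)
  moreover have "{1..Suc (length \<sigma>)} = insert (Suc (length \<sigma>)) {1..length \<sigma>}" by auto
  ultimately show ?thesis using assms by (auto simp: config_of_coins_def)
qed

lemma chosen_level_Suc:
  "chosen_level m k (Suc n) (config_of_coins m k b) =
     {\<tau> \<in> children m k (chosen_level m k n (config_of_coins m k b)). b \<tau>}" (is "?L = ?R")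
proof (intro set_eqI iffI)
  fix \<tau> assume t: "\<tau> \<in> ?L"
  then have "\<tau> \<noteq> []" by (auto simp: chosen_level_def)
  then obtain \<sigma> j where e: "\<tau> = \<sigma> @ [j]" by (metis rev_exhaust)
  with t have w: "\<sigma> \<in> words m k" "j \<in> letters m k" by (auto simp: chosen_level_def words_def)
  show "\<tau> \<in> ?R" using t w config_snoc[OF w, of b] unfolding e
    by (auto simp: chosen_level_def children_def image_iff)
next
  fix \<tau> assume t: "\<tau> \<in> ?R"
  then obtain \<sigma> j where e: "\<tau> = \<sigma> @ [j]" and w: "\<sigma> \<in> words m k" "j \<in> letters m k"
    "length \<sigma> = n" "config_of_coins m k b \<sigma>"
    by (auto simp: chosen_level_def children_def)
  then show "\<tau> \<in> ?L" using t config_snoc[OF w(1,2), of b] unfolding e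
    by (auto simp: chosen_level_def words_def)
qed

lemma finite_level: "finite {\<sigma> \<in> words m k. length \<sigma> = n}"
  using finite_lists_length_eq[of "letters m k" n]
  by (auto simp: words_def letters_def lists_eq_set)

lemma percolation_root_and_extinction:
  "AE \<omega> in percolation m k p. \<omega> [] \<and>
     (\<forall>\<sigma>\<in>words m k. \<forall>j\<in>letters m k. \<not> \<omega> \<sigma> \<longrightarrow> \<not> \<omega> (\<sigma> @ [j]))"
proof -
  let ?P = "\<lambda>\<omega>. \<omega> [] \<and>
     (\<forall>\<sigma>\<in>words m k. \<forall>j\<in>letters m k. \<not> \<omega> \<sigma> \<longrightarrow> \<not> \<omega> (\<sigma> @ [j]))"
  have c: "Measurable.pred (config_algebra m k) (\<lambda>\<omega>. \<omega> \<sigma>)" if "\<sigma> \<in> words m k" for \<sigma>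
    unfolding config_algebra_def using that by (intro measurable_component_singleton) auto
  have "Measurable.pred (config_algebra m k) ?P"
  proof (intro pred_intros_logic pred_intros_countable_bounded)
    show "Measurable.pred (config_algebra m k) (\<lambda>\<omega>. \<omega> [])"
      by (rule c) (simp add: words_def)
  qed (auto intro!: c countableI_type simp: words_def)
  moreover have root: "config_of_coins m k b []" for b
    by (simp add: config_of_coins_def words_def)
  ultimately show ?thesis
    unfolding percolation_def pred_def
    using root by (subst AE_distr_iff[OF measurable_config_of_coins]) (auto simp: config_snoc)
qed

text \<open>
  The transition law of the percolation process: given the set \<open>S\<close> of chosen words of length
  \<open>n\<close>, each of the \<open>k ^ m\<close> children of each element of \<open>S\<close> is chosen independently with
  probability \<open>p\<close>, and no other word of length \<open>n + 1\<close> is chosen.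
\<close>

lemma percolation_transition:
  assumes p: "0 \<le> p" "p \<le> 1"
    and S: "S \<subseteq> {\<sigma> \<in> words m k. length \<sigma> = n}"
    and T: "T \<subseteq> children m k S"
  shows "measure (percolation m k p)
      {\<omega> \<in> space (percolation m k p). chosen_level m k n \<omega> = S \<and> chosen_level m k (Suc n) \<omega> = T} =
    measure (percolation m k p) {\<omega> \<in> space (percolation m k p). chosen_level m k n \<omega> = S} *
      (p ^ card T * (1 - p) ^ (card S * k ^ m - card T))"
proof -
  define B where "B = measure_pmf (bernoulli_pmf p)"
  define W where "W = words m k"
  define C where "C = coin_measure m k p"
  define g where "g = config_of_coins m k"
  define L where "L = {\<sigma> \<in> W. length \<sigma> \<le> n}"
  define H where "H = children m k S"
  have C: "C = PiM W (\<lambda>_. B)" by (simp add: C_def coin_measure_def W_def B_def)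
  have sB: "sets B = UNIV" "space B = UNIV" by (auto simp: B_def)
  interpret BB: prob_space B unfolding B_def by (rule prob_space_measure_pmf)
  interpret product_prob_space "\<lambda>_. B" W by unfold_locales
  interpret C: prob_space C unfolding C by (rule prob_space_axioms)
  have gm: "g \<in> measurable C (config_algebra m k)"
    unfolding g_def C_def by (rule measurable_config_of_coins)
  have finS: "finite S" using finite_subset[OF S finite_level] .
  have finH: "finite H" using finS by (auto simp: H_def children_def letters_def)
  have HW: "H \<subseteq> W" using S by (force simp: H_def W_def children_def words_def)
  have LW: "L \<subseteq> W" by (auto simp: L_def)
  have disj: "L \<inter> H = {}" using S by (auto simp: L_def H_def children_def)
  have compm: "(\<lambda>b. b \<tau>) \<in> measurable (PiM X (\<lambda>_. B)) (count_space UNIV)" if "\<tau> \<in> X" for X \<tau>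
  proof -
    have "(\<lambda>b. b \<tau>) \<in> measurable (PiM X (\<lambda>_. B)) B"
      by (rule measurable_component_singleton[OF that])
    then show ?thesis by (simp add: measurable_def sB)
  qed
  have cardH: "card H = card S * k ^ m"
  proof -
    have "inj_on (\<lambda>(\<sigma>, j::nat). \<sigma> @ [j]) (S \<times> letters m k)" by (auto simp: inj_on_def)
    then show ?thesis by (simp add: H_def children_def card_image card_cartesian_product letters_def)
  qed
  have ind0: "C.indep_vars (\<lambda>_. B) (\<lambda>\<tau> b. b \<tau>) W"
  proof (subst C.indep_vars_iff_distr_eq_PiM')
    show "W \<noteq> {}" by (auto simp: W_def words_def)
    show "C.random_variable B (\<lambda>b. b \<tau>)" if "\<tau> \<in> W" for \<tau>
      unfolding C by (rule measurable_component_singleton[OF that])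
    have "distr C (Pi\<^sub>M W (\<lambda>_. B)) (\<lambda>b. \<lambda>\<tau>\<in>W. b \<tau>) = distr C C (\<lambda>b. b)"
      by (rule distr_cong) (auto simp: C space_PiM PiE_restrict)
    also have "\<dots> = C" by (rule distr_id)
    also have "\<dots> = (\<Pi>\<^sub>M \<tau>\<in>W. distr C B (\<lambda>b. b \<tau>))"
      unfolding C by (rule PiM_cong) (auto simp: PiM_component)
    finally show "distr C (Pi\<^sub>M W (\<lambda>_. B)) (\<lambda>b. \<lambda>\<tau>\<in>W. b \<tau>) = (\<Pi>\<^sub>M \<tau>\<in>W. distr C B (\<lambda>b. b \<tau>))" .
  qed
  have ind: "C.indep_var (PiM L (\<lambda>_. B)) (\<lambda>b. restrict b L) (PiM H (\<lambda>_. B)) (\<lambda>b. restrict b H)"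
    using C.indep_var_restrict[OF ind0 disj LW HW] by simp
  define E1 where "E1 = {b \<in> space (PiM L (\<lambda>_. B)). \<forall>\<sigma>\<in>{\<sigma>\<in>W. length \<sigma> = n}.
      (\<forall>l\<in>{1..length \<sigma>}. b (take l \<sigma>)) = (\<sigma> \<in> S)}"
  define E2 where "E2 = Pi\<^sub>E H (\<lambda>\<tau>. {\<tau> \<in> T})"
  have E1: "E1 \<in> sets (PiM L (\<lambda>_. B))"
  proof -
    have "Measurable.pred (PiM L (\<lambda>_. B)) (\<lambda>b. \<forall>\<sigma>\<in>{\<sigma>\<in>W. length \<sigma> = n}.
      (\<forall>l\<in>{1..length \<sigma>}. b (take l \<sigma>)) = (\<sigma> \<in> S))"
    proof (rule pred_intros_finite)
      show "finite {\<sigma>\<in>W. length \<sigma> = n}" unfolding W_def by (rule finite_level)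
      fix \<sigma> assume s: "\<sigma> \<in> {\<sigma>\<in>W. length \<sigma> = n}"
      have *: "Measurable.pred (PiM L (\<lambda>_. B)) (\<lambda>b. \<forall>l\<in>{1..length \<sigma>}. b (take l \<sigma>))"
      proof (rule pred_intros_finite)
        fix l assume "l \<in> {1..length \<sigma>}"
        then have "take l \<sigma> \<in> L" using s take_word[of \<sigma> m k l] by (auto simp: L_def W_def)
        then show "Measurable.pred (PiM L (\<lambda>_. B)) (\<lambda>b. b (take l \<sigma>))" by (rule compm)
      qed simp
      show "Measurable.pred (PiM L (\<lambda>_. B)) (\<lambda>b. (\<forall>l\<in>{1..length \<sigma>}. b (take l \<sigma>)) = (\<sigma> \<in> S))"
        using * by measurable
    qed
    then show ?thesis unfolding E1_def by (simp only: pred_def)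
  qed
  have E2: "E2 \<in> sets (PiM H (\<lambda>_. B))"
    unfolding E2_def by (rule sets_PiM_I_finite[OF finH]) (simp add: sB)
  have lev: "chosen_level m k n (g b) = S \<longleftrightarrow> restrict b L \<in> E1" if "b \<in> space C" for b
  proof -
    have "restrict b L \<in> space (PiM L (\<lambda>_. B))" by (auto simp: space_PiM sB)
    moreover have "(restrict b L) (take l \<sigma>) = b (take l \<sigma>)" if "\<sigma> \<in> W" "length \<sigma> = n" for l \<sigma>
      using that take_word[of \<sigma> m k l] by (auto simp: L_def W_def)
    ultimately have "restrict b L \<in> E1 \<longleftrightarrow>
        (\<forall>\<sigma>\<in>{\<sigma>\<in>W. length \<sigma> = n}. g b \<sigma> = (\<sigma> \<in> S))"
      by (simp add: E1_def g_def config_of_coins_def W_def)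
    then show ?thesis using S by (simp add: chosen_level_def W_def) blast
  qed
  have lev2: "chosen_level m k n (g b) = S \<and> chosen_level m k (Suc n) (g b) = T \<longleftrightarrow>
      restrict b L \<in> E1 \<and> restrict b H \<in> E2" if b: "b \<in> space C" for b
  proof -
    have "chosen_level m k (Suc n) (g b) = T \<longleftrightarrow> restrict b H \<in> E2"
      if "chosen_level m k n (g b) = S"
      using that T chosen_level_Suc[of m k n b]
      by (auto simp: g_def[symmetric] H_def[symmetric] E2_def PiE_iff)
    then show ?thesis using lev[OF b] by blast
  qed
  have meas: "measure (percolation m k p) {\<omega> \<in> space (percolation m k p). P \<omega>} =
      measure C {b \<in> space C. P (g b)}" if "{\<omega> \<in> space (config_algebra m k). P \<omega>} \<in> sets (config_algebra m k)" for P
  proof -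
    have "g -` {\<omega> \<in> space (config_algebra m k). P \<omega>} \<inter> space C = {b \<in> space C. P (g b)}"
      using measurable_space[OF gm] by auto
    then show ?thesis
      unfolding percolation_def C_def[symmetric] g_def[symmetric] space_distr
      using measure_distr[OF gm that] by simp
  qed
  have Plev: "Measurable.pred (config_algebra m k) (\<lambda>\<omega>. chosen_level m k q \<omega> = X)"
    if X: "X \<subseteq> {\<sigma>\<in>words m k. length \<sigma> = q}" for q X
  proof -
    have "(\<lambda>\<omega>. chosen_level m k q \<omega> = X) = (\<lambda>\<omega>. \<forall>\<sigma>\<in>{\<sigma>\<in>words m k. length \<sigma> = q}. \<omega> \<sigma> = (\<sigma> \<in> X))"
      using X by (auto simp: chosen_level_def fun_eq_iff)
    moreover have "Measurable.pred (config_algebra m k) \<dots>"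
    proof (rule pred_intros_finite[OF finite_level])
      fix \<sigma> assume s: "\<sigma> \<in> {\<sigma>\<in>words m k. length \<sigma> = q}"
      have "Measurable.pred (config_algebra m k) (\<lambda>\<omega>. \<omega> \<sigma>)"
        unfolding config_algebra_def using s by (intro measurable_component_singleton) auto
      then show "Measurable.pred (config_algebra m k) (\<lambda>\<omega>. \<omega> \<sigma> = (\<sigma> \<in> X))" by measurable
    qed
    ultimately show ?thesis by (simp only:)
  qed
  have Tl: "T \<subseteq> {\<sigma>\<in>words m k. length \<sigma> = Suc n}"
  proof
    fix \<tau> assume "\<tau> \<in> T"
    with T have "\<tau> \<in> H" by (auto simp: H_def)
    then show "\<tau> \<in> {\<sigma>\<in>words m k. length \<sigma> = Suc n}"
      using HW S by (auto simp: H_def W_def children_def)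
  qed
  have s1: "{\<omega> \<in> space (config_algebra m k). chosen_level m k n \<omega> = S} \<in> sets (config_algebra m k)"
    using Plev[OF S] unfolding pred_def .
  have s2: "{\<omega> \<in> space (config_algebra m k). chosen_level m k n \<omega> = S \<and> chosen_level m k (Suc n) \<omega> = T}
      \<in> sets (config_algebra m k)"
    using Plev[OF S] Plev[OF Tl] by (intro sets.sets_Collect_conj) (auto simp: pred_def)
  have prodH: "measure C ((\<lambda>b. restrict b H) -` E2 \<inter> space C) = (\<Prod>\<tau>\<in>H. measure B {\<tau> \<in> T})"
    using measure_PiM_emb[OF HW finH, of "\<lambda>\<tau>. {\<tau> \<in> T}"] by (simp add: E2_def C sB prod_emb_def space_PiM)
  have TH: "T \<subseteq> H" using T by (simp add: H_def)
  have "(\<Prod>\<tau>\<in>H. measure B {\<tau> \<in> T}) = (\<Prod>\<tau>\<in>H. if \<tau> \<in> T then p else 1 - p)"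
    using p by (intro prod.cong) (auto simp: B_def measure_pmf_single)
  also have "\<dots> = p ^ card T * (1 - p) ^ card (H - T)"
    using finH TH by (subst prod.If_cases) (auto simp: Int_absorb1 Diff_eq)
  also have "card (H - T) = card S * k ^ m - card T"
    using TH finH by (simp add: card_Diff_subset finite_subset cardH)
  finally have pr: "(\<Prod>\<tau>\<in>H. measure B {\<tau> \<in> T}) = p ^ card T * (1 - p) ^ (card S * k ^ m - card T)" .
  have "measure C {b \<in> space C. chosen_level m k n (g b) = S \<and> chosen_level m k (Suc n) (g b) = T} =
      measure C ((\<lambda>b. (restrict b L, restrict b H)) -` (E1 \<times> E2) \<inter> space C)"
    using lev2 by (intro arg_cong[of _ _ "measure C"]) auto
  also have "\<dots> = measure C ((\<lambda>b. restrict b L) -` E1 \<inter> space C) * measure C ((\<lambda>b. restrict b H) -` E2 \<inter> space C)"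
    by (rule C.indep_varD[OF ind E1 E2])
  also have "(\<lambda>b. restrict b L) -` E1 \<inter> space C = {b \<in> space C. chosen_level m k n (g b) = S}"
    using lev by auto
  finally show ?thesis unfolding meas[OF s1] meas[OF s2] prodH pr .
qed

section \<open>Cubes, coding map and limit set\<close>

text \<open>
  The dimension \<open>m\<close> of the ambient space is \<open>CARD('n)\<close>.  The enumeration of the subcubes is
  given by \<open>e\<close>, a bijection from the letters onto the vectors of \<open>k\<close>-adic digits: the subcube with
  number \<open>j\<close> of a cube with side length \<open>s\<close> and lower corner \<open>a\<close> has lower corner \<open>a + (s / k) e(j)\<close>.
\<close>

definition subcube_enumeration :: "nat \<Rightarrow> (nat \<Rightarrow> nat ^ 'n::finite) \<Rightarrow> bool" where
  "subcube_enumeration k e \<longleftrightarrow>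
     bij_betw e (letters CARD('n) k) {a. \<forall>i. a $ i < k}"

definition corner :: "nat \<Rightarrow> (nat \<Rightarrow> nat ^ 'n::finite) \<Rightarrow> nat list \<Rightarrow> real ^ 'n" where
  "corner k e \<sigma> = (\<chi> i. \<Sum>l<length \<sigma>. real (e (\<sigma> ! l) $ i) / real k ^ Suc l)"

definition cube :: "nat \<Rightarrow> (nat \<Rightarrow> nat ^ 'n::finite) \<Rightarrow> nat list \<Rightarrow> (real ^ 'n) set" where
  "cube k e \<sigma> = {x. \<forall>i. corner k e \<sigma> $ i \<le> x $ i \<and>
                        x $ i \<le> corner k e \<sigma> $ i + 1 / real k ^ length \<sigma>}"

definition code_point :: "nat \<Rightarrow> (nat \<Rightarrow> nat ^ 'n::finite) \<Rightarrow> (nat \<Rightarrow> nat) \<Rightarrow> real ^ 'n" where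
  "code_point k e \<eta> = (THE x. x \<in> (\<Inter>i. cube k e (code_prefix \<eta> i)))"

definition limit_set ::
    "nat \<Rightarrow> (nat \<Rightarrow> nat ^ 'n::finite) \<Rightarrow> (nat list \<Rightarrow> bool) \<Rightarrow> (real ^ 'n) set" where
  "limit_set k e \<omega> =
     (\<Inter>i. \<Union>\<sigma>\<in>{\<sigma> \<in> words CARD('n) k. length \<sigma> = i \<and> \<omega> \<sigma>}. cube k e \<sigma>)"

section \<open>Natural measures\<close>

definition perc_dim :: "nat \<Rightarrow> nat \<Rightarrow> real \<Rightarrow> real" where
  "perc_dim m k p = ln (real k ^ m * p) / ln (real k)"

definition num_chosen :: "nat \<Rightarrow> nat \<Rightarrow> (nat list \<Rightarrow> bool) \<Rightarrow> nat \<Rightarrow> nat list \<Rightarrow> nat" where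
  "num_chosen m k \<omega> j \<sigma> =
     card {\<tau> \<in> words m k. length \<tau> = length \<sigma> + j \<and> prefix \<sigma> \<tau> \<and> \<omega> \<tau>}"

definition martingale_limit ::
    "nat \<Rightarrow> nat \<Rightarrow> real \<Rightarrow> (nat list \<Rightarrow> bool) \<Rightarrow> nat list \<Rightarrow> real" where
  "martingale_limit m k p \<omega> \<sigma> =
     lim (\<lambda>j. real (num_chosen m k \<omega> j \<sigma>) * real k powr (- real j * perc_dim m k p))"

definition is_code_measure ::
    "nat \<Rightarrow> (nat \<Rightarrow> nat ^ 'n::finite) \<Rightarrow> real \<Rightarrow> (nat list \<Rightarrow> bool) \<Rightarrow> (nat \<Rightarrow> nat) measure \<Rightarrow> bool" where
  "is_code_measure k e p \<omega> M \<longleftrightarrow>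
     sets M = sets (code_algebra CARD('n) k) \<and>
     (\<forall>\<sigma>\<in>words CARD('n) k. emeasure M (cylinder CARD('n) k \<sigma>) =
        ennreal (diameter (cube k e []) powr perc_dim CARD('n) k p
                 * real k powr (- real (length \<sigma>) * perc_dim CARD('n) k p)
                 * martingale_limit CARD('n) k p \<omega> \<sigma>))"

text \<open>
  The cylinder condition determines the measure uniquely.  It is satisfiable for almost every
  configuration; the zero measure is used on the exceptional null set.
\<close>

definition code_measure ::
    "nat \<Rightarrow> (nat \<Rightarrow> nat ^ 'n::finite) \<Rightarrow> real \<Rightarrow> (nat list \<Rightarrow> bool) \<Rightarrow> (nat \<Rightarrow> nat) measure" where
  "code_measure k e p \<omega> =
     (if \<exists>M. is_code_measure k e p \<omega> M then THE M. is_code_measure k e p \<omega> M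
      else null_measure (code_algebra CARD('n) k))"

definition natural_measure ::
    "nat \<Rightarrow> (nat \<Rightarrow> nat ^ 'n::finite) \<Rightarrow> real \<Rightarrow> (nat list \<Rightarrow> bool) \<Rightarrow> (real ^ 'n) measure" where
  "natural_measure k e p \<omega> = distr (code_measure k e p \<omega>) borel (code_point k e)"

definition Q_measure ::
    "nat \<Rightarrow> (nat \<Rightarrow> nat ^ 'n::finite) \<Rightarrow> real \<Rightarrow> ((nat \<Rightarrow> nat) \<times> (nat list \<Rightarrow> bool)) measure" where
  "Q_measure k e p =
     (let S = code_algebra CARD('n) k \<Otimes>\<^sub>M config_algebra CARD('n) k in
      measure_of (space S) (sets S)
        (\<lambda>B. ennreal (diameter (cube k e []) powr (- perc_dim CARD('n) k p)) *
             (\<integral>\<^sup>+ \<omega>. emeasure (code_measure k e p \<omega>) {\<eta> \<in> codes CARD('n) k. (\<eta>, \<omega>) \<in> B}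
                \<partial>percolation CARD('n) k p)))"

section \<open>Holes and mean porosity\<close>

text \<open>\<^const>\<open>infnorm\<close> is the maximum norm on \<open>real ^ 'n\<close>.\<close>

definition max_ball :: "real ^ 'n::finite \<Rightarrow> real \<Rightarrow> (real ^ 'n) set" where
  "max_ball z r = {y. infnorm (y - z) < r}"

definition kadic_cube :: "nat \<Rightarrow> nat \<Rightarrow> real ^ 'n::finite \<Rightarrow> (real ^ 'n) set" where
  "kadic_cube k j x =
     {y. \<forall>i. of_int \<lfloor>real k ^ j * x $ i\<rfloor> / real k ^ j \<le> y $ i \<and>
             y $ i < (of_int \<lfloor>real k ^ j * x $ i\<rfloor> + 1) / real k ^ j}"

definition set_hole :: "nat \<Rightarrow> (real ^ 'n::finite) set \<Rightarrow> nat \<Rightarrow> real ^ 'n \<Rightarrow> real \<Rightarrow> bool" where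
  "set_hole k A j x \<alpha> \<longleftrightarrow>
     (\<exists>z\<in>kadic_cube k j x. max_ball z (\<alpha> / 2 / real k ^ j) \<subseteq> kadic_cube k j x - A)"

definition measure_hole ::
    "nat \<Rightarrow> (real ^ 'n::finite) measure \<Rightarrow> nat \<Rightarrow> real ^ 'n \<Rightarrow> real \<Rightarrow> real \<Rightarrow> bool" where
  "measure_hole k \<mu> j x \<alpha> \<epsilon> \<longleftrightarrow>
     (\<exists>z\<in>kadic_cube k j x. max_ball z (\<alpha> / 2 / real k ^ j) \<subseteq> kadic_cube k j x \<and>
        emeasure \<mu> (max_ball z (\<alpha> / 2 / real k ^ j)) \<le> ennreal \<epsilon> * emeasure \<mu> (kadic_cube k j x))"

definition set_hole_count ::
    "nat \<Rightarrow> (real ^ 'n::finite) set \<Rightarrow> real ^ 'n \<Rightarrow> real \<Rightarrow> nat \<Rightarrow> nat" where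
  "set_hole_count k A x \<alpha> i = card {j \<in> {1..i}. set_hole k A j x \<alpha>}"

definition measure_hole_count ::
    "nat \<Rightarrow> (real ^ 'n::finite) measure \<Rightarrow> real ^ 'n \<Rightarrow> real \<Rightarrow> real \<Rightarrow> nat \<Rightarrow> nat" where
  "measure_hole_count k \<mu> x \<alpha> \<epsilon> i = card {j \<in> {1..i}. measure_hole k \<mu> j x \<alpha> \<epsilon>}"

definition set_lower_porosity ::
    "nat \<Rightarrow> (real ^ 'n::finite) set \<Rightarrow> real ^ 'n \<Rightarrow> real \<Rightarrow> ereal" where
  "set_lower_porosity k A x \<alpha> =
     liminf (\<lambda>i. ereal (real (set_hole_count k A x \<alpha> i) / real i))"

definition set_upper_porosity ::
    "nat \<Rightarrow> (real ^ 'n::finite) set \<Rightarrow> real ^ 'n \<Rightarrow> real \<Rightarrow> ereal" where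
  "set_upper_porosity k A x \<alpha> =
     limsup (\<lambda>i. ereal (real (set_hole_count k A x \<alpha> i) / real i))"

text \<open>
  The limits as \<open>\<epsilon>\<close> decreases to 0 exist, because the hole counts are monotone in \<open>\<epsilon>\<close>.
\<close>

definition measure_lower_porosity ::
    "nat \<Rightarrow> (real ^ 'n::finite) measure \<Rightarrow> real ^ 'n \<Rightarrow> real \<Rightarrow> ereal" where
  "measure_lower_porosity k \<mu> x \<alpha> =
     Lim (at_right 0) (\<lambda>\<epsilon>. liminf (\<lambda>i. ereal (real (measure_hole_count k \<mu> x \<alpha> \<epsilon> i) / real i)))"

definition measure_upper_porosity ::
    "nat \<Rightarrow> (real ^ 'n::finite) measure \<Rightarrow> real ^ 'n \<Rightarrow> real \<Rightarrow> ereal" where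
  "measure_upper_porosity k \<mu> x \<alpha> =
     Lim (at_right 0) (\<lambda>\<epsilon>. limsup (\<lambda>i. ereal (real (measure_hole_count k \<mu> x \<alpha> \<epsilon> i) / real i)))"

definition set_has_mean_porosity ::
    "nat \<Rightarrow> (real ^ 'n::finite) set \<Rightarrow> real ^ 'n \<Rightarrow> real \<Rightarrow> real \<Rightarrow> bool" where
  "set_has_mean_porosity k A x \<alpha> c \<longleftrightarrow>
     set_lower_porosity k A x \<alpha> = ereal c \<and> set_upper_porosity k A x \<alpha> = ereal c"

definition measure_has_mean_porosity ::
    "nat \<Rightarrow> (real ^ 'n::finite) measure \<Rightarrow> real ^ 'n \<Rightarrow> real \<Rightarrow> real \<Rightarrow> bool" where
  "measure_has_mean_porosity k \<mu> x \<alpha> c \<longleftrightarrow>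
     measure_lower_porosity k \<mu> x \<alpha> = ereal c \<and> measure_upper_porosity k \<mu> x \<alpha> = ereal c"

section \<open>The exceptional set\<close>

definition hole_indicator ::
    "nat \<Rightarrow> (nat \<Rightarrow> nat ^ 'n::finite) \<Rightarrow> real \<Rightarrow> (nat \<Rightarrow> nat) \<times> (nat list \<Rightarrow> bool) \<Rightarrow> real" where
  "hole_indicator k e \<alpha> = (\<lambda>(\<eta>, \<omega>).
     if set_hole k (limit_set k e \<omega>) 0 (code_point k e \<eta>) \<alpha> then 1 else 0)"

definition exceptional_set :: "nat \<Rightarrow> (nat \<Rightarrow> nat ^ 'n::finite) \<Rightarrow> real \<Rightarrow> real set" where
  "exceptional_set k e p =
     {\<alpha> \<in> {0<..<1}. \<not> continuous (at \<alpha> within {0..1})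
        (\<lambda>\<beta>. integral\<^sup>L (Q_measure k e p) (hole_indicator k e \<beta>))}"

end

theory Submission
  imports Defs
begin

text \<open>
  Let \<open>T(\<eta>, \<omega>)\<close> drop the first letter of the code \<open>\<eta>\<close> and replace \<open>\<omega>\<close> by its subtree at that
  letter.  Percolation is self-similar, so whether the limit set has a hole at scale \<open>j\<close> near
  \<open>x(\<eta>)\<close> can be read off at scale \<open>0\<close> from \<open>T^j(\<eta>, \<omega>)\<close> (\<open>set_hole_scale\<close>).  This is correct as
  long as no coordinate of \<open>x(\<eta>)\<close> sits on an upper face of a cube of its code, which \<open>Q\<close>-almost
  surely does not happen because the letters of the code are independent and uniform under \<open>Q\<close>.
  The measure \<open>Q\<close> is invariant and ergodic under \<open>T\<close>, hence for a fixed \<open>\<alpha>\<close> Birkhoff's theorem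
  gives the frequency \<open>E_Q[\<chi>_0^\<alpha>]\<close> of scales with an \<open>\<alpha>\<close>-hole.  Almost surely this holds for all
  rational \<open>\<alpha>\<close>; frequencies decrease in \<open>\<alpha>\<close>, so it extends to every \<open>\<alpha>\<close> at which the expectation is
  continuous.

  For the natural measure one inequality is immediate: a hole of the limit set carries no mass and
  is an \<open>(\<alpha>, \<epsilon>)\<close>-hole for every \<open>\<epsilon>\<close>.  Conversely let \<open>\<alpha>' < \<alpha>\<close> and choose \<open>N\<close> such that cubes of
  level \<open>N\<close> are small against \<open>\<alpha> - \<alpha>'\<close>.  An \<open>(\<alpha>, \<epsilon>)\<close>-hole at scale \<open>j\<close> forces all cubes that
  are \<open>N\<close> levels smaller and touch some ball of relative radius \<open>\<alpha>' / 2\<close> to have relative mass at most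
  \<open>\<epsilon>\<close>.  This is an event of \<open>T^j(\<eta>, \<omega>)\<close> again (\<open>measure_hole_imp_small_hole\<close>) and has a
  frequency by Birkhoff's theorem.  As \<open>\<epsilon>\<close> tends to \<open>0\<close>, and since only finitely many families of
  cubes occur, these events shrink to the event that all the cubes touching some ball have mass
  zero.  A cube has mass zero only if its subtree is extinct (\<open>AE_extinct_if_limit_zero\<close>), so the
  limit event is an \<open>\<alpha>'\<close>-hole of the limit set (\<open>small_holes_imp_hole\<close>).  Letting \<open>\<alpha>'\<close> increase to
  \<open>\<alpha>\<close> and using continuity once more, the upper frequency of measure holes is at most
  \<open>E_Q[\<chi>_0^\<alpha>]\<close> in the limit \<open>\<epsilon> \<rightarrow> 0\<close> (\<open>typical_mean_porosity\<close>).

  The probabilistic facts behind this come from the branching property (\<open>distr_graft\<close>):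
  replacing what lies below a word by an independent copy does not change the law \<open>P\<close>.  It makes the
  errors of successive generation sizes orthogonal, which yields almost sure convergence of the
  normalised sizes to a limit \<open>X\<close> with mean \<open>1\<close> (\<open>martingale_convergence\<close>).  Resampling the
  coins below the children (\<open>prob_all_children\<close>) shows that the probabilities of extinction and of \<open>X = 0\<close> are both fixed points of \<open>s \<mapsto> (1 - p + p s)^(k^m)\<close>
  in \<open>[0, 1)\<close>, where a strictly convex function with fixed point \<open>1\<close> has at most one.
  Finally, the branching property evaluates \<open>Q\<close> on products of a cylinder at \<open>\<sigma>\<close> and an event of the first \<open>|\<sigma>|\<close> levels
  (\<open>emeasure_Q_box\<close>), and gives independence of such a box from the future under \<open>T\<close> (\<open>mixing\<close>),
  from which invariance and ergodicity follow.  The measures on codes are constructed from Lebesgue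
  measure by splitting an interval in the prescribed proportions (\<open>code_measure_exists\<close>), and
  Birkhoff's theorem is proved for functions with values in \<open>[0, 1]\<close> by covering orbits with blocks
  of large average (\<open>birkhoff_average\<close>).
\<close>

section \<open>Subtrees and grafting\<close>

lemma append_in_words: "\<sigma> @ \<tau> \<in> words m k \<longleftrightarrow> \<sigma> \<in> words m k \<and> \<tau> \<in> words m k"
  by (auto simp: words_def)

lemma drop_word: "\<tau> \<in> words m k \<Longrightarrow> drop n \<tau> \<in> words m k"
  by (auto simp: words_def in_lists_conv_set dest: in_set_dropD)

lemma Nil_word [simp]: "[] \<in> words m k"
  by (simp add: words_def)

lemma measurable_config_coordinate:
  "\<sigma> \<in> words m k \<Longrightarrow> Measurable.pred (config_algebra m k) (\<lambda>\<omega>. \<omega> \<sigma>)"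
  unfolding config_algebra_def by (intro measurable_component_singleton) auto

lemma space_config: "space (config_algebra m k) = extensional (words m k)"
  by (simp add: config_algebra_def space_PiM PiE_def)

lemma space_percolation [simp]: "space (percolation m k p) = space (config_algebra m k)"
  and sets_percolation [measurable_cong, simp]: "sets (percolation m k p) = sets (config_algebra m k)"
  by (simp_all add: percolation_def)

definition subtree :: "nat \<Rightarrow> nat \<Rightarrow> nat list \<Rightarrow> (nat list \<Rightarrow> bool) \<Rightarrow> nat list \<Rightarrow> bool" where
  "subtree m k \<sigma> \<omega> = (\<lambda>\<tau>\<in>words m k. \<omega> (\<sigma> @ \<tau>))"

text \<open>
  Grafting replaces everything strictly below \<open>\<sigma>\<close>.  The status of \<open>\<sigma>\<close> is inherited from the old
  configuration as soon as the new one has a chosen root, and a neglected \<open>\<sigma>\<close> keeps all its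
  descendants neglected; so grafting an independent copy of the percolation is a resampling.
\<close>

definition graft ::
    "nat \<Rightarrow> nat \<Rightarrow> nat list \<Rightarrow> (nat list \<Rightarrow> bool) \<times> (nat list \<Rightarrow> bool) \<Rightarrow> nat list \<Rightarrow> bool" where
  "graft m k \<sigma> = (\<lambda>(\<omega>, \<omega>'). \<lambda>\<tau>\<in>words m k.
     if prefix \<sigma> \<tau> then \<omega> \<sigma> \<and> \<omega>' (drop (length \<sigma>) \<tau>) else \<omega> \<tau>)"

lemma measurable_subtree:
  assumes "\<sigma> \<in> words m k"
  shows "subtree m k \<sigma> \<in> measurable (config_algebra m k) (config_algebra m k)"
proof -
  have "(\<lambda>\<omega>. \<lambda>\<tau>\<in>words m k. \<omega> (\<sigma> @ \<tau>)) \<in> measurable (config_algebra m k) (config_algebra m k)"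
    unfolding config_algebra_def using assms
    by (intro measurable_restrict measurable_component_singleton) (simp add: append_in_words)
  then show ?thesis by (simp add: subtree_def[abs_def])
qed

lemma measurable_graft:
  assumes "\<sigma> \<in> words m k"
  shows "graft m k \<sigma> \<in> measurable (config_algebra m k \<Otimes>\<^sub>M config_algebra m k) (config_algebra m k)"
proof -
  have "(\<lambda>z. \<lambda>\<tau>\<in>words m k. if prefix \<sigma> \<tau> then fst z \<sigma> \<and> snd z (drop (length \<sigma>) \<tau>) else fst z \<tau>)
     \<in> measurable (config_algebra m k \<Otimes>\<^sub>M config_algebra m k) (\<Pi>\<^sub>M \<tau>\<in>words m k. count_space UNIV)"
  proof (intro measurable_restrict)
    fix \<tau> assume t: "\<tau> \<in> words m k"
    note [measurable] = measurable_compose[OF measurable_fst measurable_config_coordinate[OF assms]]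
      measurable_compose[OF measurable_fst measurable_config_coordinate[OF t]]
      measurable_compose[OF measurable_snd measurable_config_coordinate[OF drop_word[OF t]]]
    show "(\<lambda>z. if prefix \<sigma> \<tau> then fst z \<sigma> \<and> snd z (drop (length \<sigma>) \<tau>) else fst z \<tau>) \<in>
      measurable (config_algebra m k \<Otimes>\<^sub>M config_algebra m k) (count_space UNIV)"
      by (cases "prefix \<sigma> \<tau>") simp_all
  qed
  then show ?thesis
    unfolding graft_def config_algebra_def[of m k, symmetric] by (simp add: case_prod_beta' )
qed

text \<open>
  It is enough to look at rectangles over a finite set \<open>J\<close> of coordinates.  The preimage of such a
  rectangle is a rectangle over \<open>J - H\<close> in the first copy times one over \<open>h ` (J \<inter> H)\<close> in the
  second; as \<open>h\<close> is injective on \<open>H\<close>, every factor of the original mass occurs exactly once.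
\<close>

lemma distr_product_resample:
  fixes B :: "'b measure" and H W :: "'a set"
  assumes B: "prob_space B" and H: "H \<subseteq> W" and h: "inj_on h H" "h ` H \<subseteq> W"
  shows "distr (PiM W (\<lambda>_. B) \<Otimes>\<^sub>M PiM W (\<lambda>_. B)) (PiM W (\<lambda>_. B))
    (\<lambda>(b, b'). \<lambda>\<tau>\<in>W. if \<tau> \<in> H then b' (h \<tau>) else b \<tau>) = PiM W (\<lambda>_. B)"
proof -
  interpret B: prob_space B by fact
  interpret product_prob_space "\<lambda>_. B" W by unfold_locales
  let ?C = "PiM W (\<lambda>_. B)"
  let ?\<Phi> = "\<lambda>(b, b'). \<lambda>\<tau>\<in>W. if \<tau> \<in> H then b' (h \<tau>) else b \<tau>"
  have meas [measurable]: "?\<Phi> \<in> measurable (?C \<Otimes>\<^sub>M ?C) ?C"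
    unfolding case_prod_beta'
  proof (intro measurable_restrict)
    fix \<tau> assume t: "\<tau> \<in> W"
    show "(\<lambda>z. if \<tau> \<in> H then snd z (h \<tau>) else fst z \<tau>) \<in> measurable (?C \<Otimes>\<^sub>M ?C) B"
      using t h by (cases "\<tau> \<in> H")
       (auto intro!: measurable_compose[OF measurable_fst measurable_component_singleton]
         measurable_compose[OF measurable_snd measurable_component_singleton])
  qed
  show ?thesis
  proof (rule PiM_eq)
    fix J F assume J: "finite J" "J \<subseteq> W" and F: "\<And>j. j \<in> J \<Longrightarrow> F j \<in> sets B"
    \<comment> \<open>\<open>g\<close> tells which coordinate of the rectangle a coordinate of the second copy is used for\<close>
    define g where "g = the_inv_into H h"
    have g: "g (h \<tau>) = \<tau>" if "\<tau> \<in> H" for \<tau>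
      using that h(1) by (simp add: g_def the_inv_into_f_f)
    let ?E = "prod_emb W (\<lambda>_. B) (J - H) (Pi\<^sub>E (J - H) F)"
    let ?E' = "prod_emb W (\<lambda>_. B) (h ` (J \<inter> H)) (Pi\<^sub>E (h ` (J \<inter> H)) (F \<circ> g))"
    have F': "F (g x) \<in> sets B" if "x \<in> h ` (J \<inter> H)" for x
      using that F g by auto
    have E: "?E \<in> sets ?C" using J F by (intro sets_PiM_I) auto
    have E': "?E' \<in> sets ?C" using J F' h H by (intro sets_PiM_I) auto
    have sp: "\<tau> \<in> J \<Longrightarrow> x \<in> F \<tau> \<Longrightarrow> x \<in> space B" for \<tau> x
      using F[of \<tau>] sets.sets_into_space by blast
    have "?\<Phi> -` prod_emb W (\<lambda>_. B) J (Pi\<^sub>E J F) \<inter> space (?C \<Otimes>\<^sub>M ?C) = ?E \<times> ?E'"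
    proof (intro set_eqI iffI)
      fix z assume "z \<in> ?\<Phi> -` prod_emb W (\<lambda>_. B) J (Pi\<^sub>E J F) \<inter> space (?C \<Otimes>\<^sub>M ?C)"
      then obtain b b' where z: "z = (b, b')" "b \<in> space ?C" "b' \<in> space ?C"
        "\<forall>\<tau>\<in>J. ?\<Phi> (b, b') \<tau> \<in> F \<tau>"
        by (cases z) (auto simp: space_pair_measure prod_emb_def PiE_iff)
      have "b \<tau> \<in> F \<tau>" if "\<tau> \<in> J - H" for \<tau> using z(4) that J by force
      moreover have "b' (h \<tau>) \<in> F (g (h \<tau>))" if "\<tau> \<in> J \<inter> H" for \<tau> using z(4) that J g by force
      ultimately show "z \<in> ?E \<times> ?E'"
        using z(1-3) by (auto simp: prod_emb_def space_PiM PiE_iff)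
    next
      fix z assume "z \<in> ?E \<times> ?E'"
      then obtain b b' where z: "z = (b, b')" "b \<in> space ?C" "b' \<in> space ?C"
        "\<forall>\<tau>\<in>J - H. b \<tau> \<in> F \<tau>" "\<forall>\<tau>\<in>J \<inter> H. b' (h \<tau>) \<in> F (g (h \<tau>))"
        by (auto simp: prod_emb_def space_PiM PiE_iff)
      then have *: "\<forall>\<tau>\<in>J. ?\<Phi> (b, b') \<tau> \<in> F \<tau>" using J(2) g by auto
      have "?\<Phi> (b, b') \<in> space ?C"
        using measurable_space[OF meas, of "(b, b')"] z by (auto simp: space_pair_measure)
      then show "z \<in> ?\<Phi> -` prod_emb W (\<lambda>_. B) J (Pi\<^sub>E J F) \<inter> space (?C \<Otimes>\<^sub>M ?C)"
        using z(1-3) * by (auto simp: space_pair_measure prod_emb_def PiE_iff space_PiM)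
    qed
    then have "emeasure (distr (?C \<Otimes>\<^sub>M ?C) ?C ?\<Phi>) (prod_emb W (\<lambda>_. B) J (Pi\<^sub>E J F)) =
        emeasure (?C \<Otimes>\<^sub>M ?C) (?E \<times> ?E')"
      using J F by (subst emeasure_distr[OF meas]) (auto intro!: sets_PiM_I)
    also have "\<dots> = emeasure ?C ?E * emeasure ?C ?E'"
      using E E' by (rule P.emeasure_pair_measure_Times)
    also have "emeasure ?C ?E = (\<Prod>j\<in>J - H. emeasure B (F j))"
      using J F by (intro emeasure_PiM_emb) auto
    also have "emeasure ?C ?E' = (\<Prod>j\<in>h ` (J \<inter> H). emeasure B ((F \<circ> g) j))"
      using J F' h H by (intro emeasure_PiM_emb) auto
    also have "\<dots> = (\<Prod>j\<in>J \<inter> H. emeasure B (F j))"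
      using h(1) g by (subst prod.reindex) (auto intro: inj_on_subset intro!: prod.cong)
    also have "(\<Prod>j\<in>J - H. emeasure B (F j)) * \<dots> = (\<Prod>j\<in>J. emeasure B (F j))"
      using J(1) by (subst prod.union_disjoint[symmetric]) (auto intro!: prod.cong)
    finally show "emeasure (distr (?C \<Otimes>\<^sub>M ?C) ?C ?\<Phi>) (prod_emb W (\<lambda>_. B) J (Pi\<^sub>E J F)) =
      (\<Prod>j\<in>J. emeasure B (F j))" .
  qed simp
qed

locale branching =
  fixes m k :: nat and p :: real
  assumes k2: "k \<ge> 2" and p_gt: "1 / real k ^ m < p" and p_le: "p \<le> 1"
begin

abbreviation "L \<equiv> letters m k"
abbreviation "W \<equiv> words m k"
abbreviation "C \<equiv> coin_measure m k p"
abbreviation "\<A> \<equiv> config_algebra m k"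
abbreviation "P \<equiv> percolation m k p"
abbreviation "g \<equiv> config_of_coins m k"
abbreviation "sub \<equiv> subtree m k"

sublocale P: prob_space P by (rule prob_space_percolation)
sublocale C: prob_space C
  unfolding coin_measure_def by (intro prob_space_PiM prob_space_measure_pmf)
sublocale PP: pair_prob_space P P ..
sublocale CC: pair_prob_space C C ..

lemma g_measurable: "g \<in> measurable C \<A>"
  by (rule measurable_config_of_coins)

lemma p_pos: "0 < p"
  using p_gt k2 by (smt (verit) divide_nonneg_nonneg of_nat_0_le_iff zero_le_power)

lemma distr_coin_resample:
  assumes "H \<subseteq> W" "inj_on h H" "h ` H \<subseteq> W"
  shows "distr (C \<Otimes>\<^sub>M C) C (\<lambda>(b, b'). \<lambda>\<tau>\<in>W. if \<tau> \<in> H then b' (h \<tau>) else b \<tau>) = C"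
  unfolding coin_measure_def by (rule distr_product_resample[OF prob_space_measure_pmf assms])

lemma measurable_coin_resample:
  assumes "H \<subseteq> W" "h ` H \<subseteq> W"
  shows "(\<lambda>(b, b'). \<lambda>\<tau>\<in>W. if \<tau> \<in> H then b' (h \<tau>) else b \<tau>) \<in> measurable (C \<Otimes>\<^sub>M C) C"
  unfolding case_prod_beta' coin_measure_def
proof (intro measurable_restrict)
  fix \<tau> assume t: "\<tau> \<in> W"
  let ?C = "PiM W (\<lambda>_. measure_pmf (bernoulli_pmf p))"
  show "(\<lambda>z. if \<tau> \<in> H then snd z (h \<tau>) else fst z \<tau>) \<in> measurable (?C \<Otimes>\<^sub>M ?C) (measure_pmf (bernoulli_pmf p))"
    using t assms by (cases "\<tau> \<in> H")
     (auto intro!: measurable_compose[OF measurable_fst measurable_component_singleton]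
       measurable_compose[OF measurable_snd measurable_component_singleton])
qed

lemma config_append:
  assumes "\<sigma> \<in> W" "\<tau> \<in> W"
  shows "g b (\<sigma> @ \<tau>) \<longleftrightarrow> g b \<sigma> \<and> g (\<lambda>\<upsilon>. b (\<sigma> @ \<upsilon>)) \<tau>"
proof -
  have "(\<forall>l\<in>{1..length \<sigma> + length \<tau>}. b (take l (\<sigma> @ \<tau>))) \<longleftrightarrow>
    (\<forall>l\<in>{1..length \<sigma>}. b (take l \<sigma>)) \<and> (\<forall>l\<in>{1..length \<tau>}. b (\<sigma> @ take l \<tau>))" (is "?A \<longleftrightarrow> ?B \<and> ?D")
  proof safe
    fix l assume ?A "l \<in> {1..length \<sigma>}"
    then show "b (take l \<sigma>)" by (auto dest: bspec[of _ _ l])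
  next
    fix l assume ?A "l \<in> {1..length \<tau>}"
    then show "b (\<sigma> @ take l \<tau>)" by (auto dest: bspec[of _ _ "length \<sigma> + l"])
  next
    fix l assume a: ?B ?D "l \<in> {1..length \<sigma> + length \<tau>}"
    show "b (take l (\<sigma> @ \<tau>))"
    proof (cases "l \<le> length \<sigma>")
      case False
      then have "l - length \<sigma> \<in> {1..length \<tau>}" using a(3) by auto
      then show ?thesis using False bspec[OF a(2), of "l - length \<sigma>"] by simp
    qed (use a in auto)
  qed
  then show ?thesis using assms by (simp add: config_of_coins_def append_in_words)
qed

text \<open>
  The branching property.  In terms of coins, grafting leaves the coins at all words that are not
  strictly below \<open>\<sigma>\<close> and takes the remaining ones, shifted by \<open>\<sigma>\<close>, from an independent family; the
  coins of the grafted family are again independent with the same bias.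
\<close>

lemma distr_graft:
  assumes s: "\<sigma> \<in> W"
  shows "distr (P \<Otimes>\<^sub>M P) \<A> (graft m k \<sigma>) = P"
proof -
  let ?H = "{\<tau> \<in> W. strict_prefix \<sigma> \<tau>}"
  let ?h = "drop (length \<sigma>)"
  let ?\<Phi> = "\<lambda>(b, b'). \<lambda>\<tau>\<in>W. if \<tau> \<in> ?H then b' (?h \<tau>) else b \<tau>"
  have inj: "inj_on ?h ?H" by (auto simp: inj_on_def strict_prefix_def prefix_def)
  have im: "?h ` ?H \<subseteq> W" using drop_word by auto
  note gr = measurable_graft[OF s]
  have \<Phi>: "?\<Phi> \<in> measurable (C \<Otimes>\<^sub>M C) C"
    by (rule measurable_coin_resample) (use im in auto)
  have gg: "(\<lambda>(b, b'). (g b, g b')) \<in> measurable (C \<Otimes>\<^sub>M C) (\<A> \<Otimes>\<^sub>M \<A>)"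
    using g_measurable by measurable
  have "P \<Otimes>\<^sub>M P = distr (C \<Otimes>\<^sub>M C) (\<A> \<Otimes>\<^sub>M \<A>) (\<lambda>(b, b'). (g b, g b'))"
    unfolding percolation_def
    by (rule pair_measure_distr[OF g_measurable g_measurable])
       (rule prob_space_imp_sigma_finite, rule prob_space_percolation[unfolded percolation_def])
  then have "distr (P \<Otimes>\<^sub>M P) \<A> (graft m k \<sigma>) =
      distr (C \<Otimes>\<^sub>M C) \<A> (graft m k \<sigma> \<circ> (\<lambda>(b, b'). (g b, g b')))"
    using gr gg by (simp add: distr_distr)
  also have "\<dots> = distr (C \<Otimes>\<^sub>M C) \<A> (g \<circ> ?\<Phi>)"
  proof (intro distr_cong refl)
    fix z :: "(nat list \<Rightarrow> bool) \<times> (nat list \<Rightarrow> bool)" assume "z \<in> space (C \<Otimes>\<^sub>M C)"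
    obtain b b' where z: "z = (b, b')" by (cases z)
    have "graft m k \<sigma> (g b, g b') \<tau> = g (?\<Phi> (b, b')) \<tau>" if t: "\<tau> \<in> W" for \<tau>
    proof (cases "prefix \<sigma> \<tau>")
      case True
      then obtain \<upsilon> where u: "\<tau> = \<sigma> @ \<upsilon>" by (auto simp: prefix_def)
      have uW: "\<upsilon> \<in> W" using t u by (simp add: append_in_words)
      have "g (?\<Phi> (b, b')) \<sigma> = g b \<sigma>"
      proof -
        have "\<not> strict_prefix \<sigma> (take l \<sigma>)" for l
          by (meson prefix_order.leD take_is_prefix)
        then show ?thesis using s take_word[OF s] by (simp add: config_of_coins_def)
      qed
      moreover have "g (\<lambda>\<upsilon>. ?\<Phi> (b, b') (\<sigma> @ \<upsilon>)) \<upsilon> = g b' \<upsilon>"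
      proof -
        have "\<sigma> @ take l \<upsilon> \<in> ?H" if "l \<in> {1..length \<upsilon>}" for l
          using s uW that take_word[OF uW, of l] by (auto simp: append_in_words strict_prefix_def)
        then show ?thesis using uW by (auto simp: config_of_coins_def)
      qed
      ultimately show ?thesis
        using t u config_append[OF s uW, of "?\<Phi> (b, b')"] by (simp add: graft_def)
    next
      case False
      have "\<not> strict_prefix \<sigma> (take l \<tau>)" for l
        using False by (meson prefix_order.less_imp_le prefix_order.trans take_is_prefix)
      then show ?thesis
        using t False take_word[OF t] by (auto simp: config_of_coins_def graft_def)
    qed
    moreover have "graft m k \<sigma> (g b, g b') \<tau> = g (?\<Phi> (b, b')) \<tau>" if "\<tau> \<notin> W" for \<tau>
      using that by (simp add: graft_def config_of_coins_def)
    ultimately have "graft m k \<sigma> (g b, g b') = g (?\<Phi> (b, b'))" by blast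
    then show "(graft m k \<sigma> \<circ> (\<lambda>(b, b'). (g b, g b'))) z = (g \<circ> ?\<Phi>) z"
      unfolding z by simp
  qed
  also have "\<dots> = distr (distr (C \<Otimes>\<^sub>M C) C ?\<Phi>) \<A> g"
    using \<Phi> g_measurable by (simp add: distr_distr)
  also have "\<dots> = P"
    by (subst distr_coin_resample) (use inj im in \<open>auto simp: percolation_def\<close>)
  finally show ?thesis .
qed

end

section \<open>Generations of the branching process\<close>

definition hereditary :: "nat \<Rightarrow> nat \<Rightarrow> (nat list \<Rightarrow> bool) \<Rightarrow> bool" where
  "hereditary m k \<omega> \<longleftrightarrow> (\<forall>\<sigma>\<in>words m k. \<forall>\<tau>\<in>words m k. \<omega> (\<sigma> @ \<tau>) \<longrightarrow> \<omega> \<sigma>)"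

definition dead :: "nat \<Rightarrow> nat \<Rightarrow> nat list \<Rightarrow> bool" where
  "dead m k = (\<lambda>\<tau>\<in>words m k. False)"

lemma dead_space: "dead m k \<in> space (config_algebra m k)"
  by (simp add: space_config dead_def)

lemma subtree_space: "subtree m k \<sigma> \<omega> \<in> space (config_algebra m k)"
  by (simp add: space_config subtree_def)

lemma graft_space: "graft m k \<sigma> z \<in> space (config_algebra m k)"
  by (simp add: space_config graft_def case_prod_beta')

lemma subtree_Nil: "\<omega> \<in> space (config_algebra m k) \<Longrightarrow> subtree m k [] \<omega> = \<omega>"
  by (auto simp: space_config subtree_def extensional_def fun_eq_iff)

lemma subtree_subtree:
  "\<tau> \<in> words m k \<Longrightarrow> subtree m k \<tau> (subtree m k \<sigma> \<omega>) = subtree m k (\<sigma> @ \<tau>) \<omega>"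
  by (auto simp: subtree_def append_in_words)

lemma hereditary_subtree:
  "\<sigma> \<in> words m k \<Longrightarrow> hereditary m k \<omega> \<Longrightarrow> hereditary m k (subtree m k \<sigma> \<omega>)"
  unfolding hereditary_def subtree_def
  by (auto simp: append_in_words)

lemma hereditary_dead_subtree:
  "\<sigma> \<in> words m k \<Longrightarrow> hereditary m k \<omega> \<Longrightarrow> \<not> \<omega> \<sigma> \<Longrightarrow> subtree m k \<sigma> \<omega> = dead m k"
  by (auto simp: hereditary_def subtree_def dead_def fun_eq_iff)

lemma subtree_graft:
  assumes "\<sigma> \<in> words m k" "\<omega>' \<in> space (config_algebra m k)"
  shows "subtree m k \<sigma> (graft m k \<sigma> (\<omega>, \<omega>')) = (if \<omega> \<sigma> then \<omega>' else dead m k)"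
  using assms by (auto simp: subtree_def graft_def dead_def append_in_words space_config extensional_def fun_eq_iff)

lemma graft_outside:
  "\<tau> \<in> words m k \<Longrightarrow> \<not> prefix \<sigma> \<tau> \<Longrightarrow> graft m k \<sigma> (\<omega>, \<omega>') \<tau> = \<omega> \<tau>"
  by (simp add: graft_def)

lemma graft_root:
  "\<sigma> \<in> words m k \<Longrightarrow> \<omega>' [] \<Longrightarrow> graft m k \<sigma> (\<omega>, \<omega>') \<sigma> = \<omega> \<sigma>"
  by (simp add: graft_def)

abbreviation level :: "nat \<Rightarrow> nat \<Rightarrow> nat \<Rightarrow> nat list set" where
  "level m k n \<equiv> {\<sigma> \<in> words m k. length \<sigma> = n}"

lemma card_level: "card (level m k n) = (k ^ m) ^ n"
proof -
  have "level m k n = {xs. set xs \<subseteq> letters m k \<and> length xs = n}"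
    by (auto simp: words_def)
  then show ?thesis using card_lists_length_eq[of "letters m k" n] by (simp add: letters_def)
qed

definition generation :: "nat \<Rightarrow> nat \<Rightarrow> nat \<Rightarrow> (nat list \<Rightarrow> bool) \<Rightarrow> real" where
  "generation m k n \<omega> = real (num_chosen m k \<omega> n [])"

lemma generation_eq_sum: "generation m k n \<omega> = (\<Sum>\<tau>\<in>level m k n. of_bool (\<omega> \<tau>))"
proof -
  have "(\<Sum>\<tau>\<in>level m k n. of_bool (\<omega> \<tau>) :: real) = real (card {\<tau> \<in> level m k n. \<omega> \<tau>})"
    by (subst sum_of_bool_eq) (auto simp: finite_level intro!: arg_cong[where f=card])
  then show ?thesis by (simp add: generation_def num_chosen_def conj_ac)
qed

lemma num_chosen_subtree:
  assumes "\<sigma> \<in> words m k"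
  shows "real (num_chosen m k \<omega> n \<sigma>) = generation m k n (subtree m k \<sigma> \<omega>)"
proof -
  have "bij_betw (\<lambda>\<tau>. \<sigma> @ \<tau>) {\<tau> \<in> words m k. length \<tau> = n \<and> prefix [] \<tau> \<and> subtree m k \<sigma> \<omega> \<tau>}
     {\<tau> \<in> words m k. length \<tau> = length \<sigma> + n \<and> prefix \<sigma> \<tau> \<and> \<omega> \<tau>}"
    using assms by (auto simp: bij_betw_def inj_on_def append_in_words subtree_def prefix_def image_iff)
  then show ?thesis unfolding generation_def num_chosen_def by (simp add: bij_betw_same_card)
qed

lemma generation_nonneg: "0 \<le> generation m k n \<omega>"
  by (simp add: generation_def)

lemma generation_le: "generation m k n \<omega> \<le> (real k ^ m) ^ n"
proof -
  have "generation m k n \<omega> \<le> (\<Sum>\<tau>\<in>level m k n. 1)"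
    unfolding generation_eq_sum by (intro sum_mono) auto
  then show ?thesis by (simp add: card_level)
qed

lemma level_Suc: "level m k (Suc n) = (\<lambda>(\<sigma>, j). \<sigma> @ [j]) ` (level m k n \<times> letters m k)"
proof (intro set_eqI iffI)
  fix \<tau> assume t: "\<tau> \<in> level m k (Suc n)"
  then have "\<tau> \<noteq> []" by auto
  then obtain \<sigma> j where e: "\<tau> = \<sigma> @ [j]" by (metis rev_exhaust)
  with t have "\<sigma> \<in> words m k" "j \<in> letters m k" "length \<sigma> = n" by (auto simp: words_def)
  then show "\<tau> \<in> (\<lambda>(\<sigma>, j). \<sigma> @ [j]) ` (level m k n \<times> letters m k)" unfolding e by force
qed (auto simp: words_def)

lemma level_Suc': "level m k (Suc n) = (\<lambda>(j, \<sigma>). j # \<sigma>) ` (letters m k \<times> level m k n)"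
proof (intro set_eqI iffI)
  fix \<tau> assume t: "\<tau> \<in> level m k (Suc n)"
  then obtain \<sigma> j where e: "\<tau> = j # \<sigma>" by (cases \<tau>) auto
  with t have "\<sigma> \<in> words m k" "j \<in> letters m k" "length \<sigma> = n" by (auto simp: words_def)
  then show "\<tau> \<in> (\<lambda>(j, \<sigma>). j # \<sigma>) ` (letters m k \<times> level m k n)" unfolding e by force
qed (auto simp: words_def)

lemma singleton_word: "[j] \<in> words m k \<longleftrightarrow> j \<in> letters m k"
  by (auto simp: words_def)

lemma generation_Suc_last:
  "generation m k (Suc n) \<omega> = (\<Sum>\<sigma>\<in>level m k n. generation m k 1 (subtree m k \<sigma> \<omega>))"
proof -
  have "generation m k (Suc n) \<omega> = (\<Sum>(\<sigma>, j)\<in>level m k n \<times> letters m k. of_bool (\<omega> (\<sigma> @ [j])))"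
    unfolding generation_eq_sum level_Suc by (subst sum.reindex) (auto simp: inj_on_def case_prod_beta')
  also have "\<dots> = (\<Sum>\<sigma>\<in>level m k n. \<Sum>j\<in>letters m k. of_bool (\<omega> (\<sigma> @ [j])))"
    by (rule sum.cartesian_product[symmetric])
  also have "\<dots> = (\<Sum>\<sigma>\<in>level m k n. generation m k 1 (subtree m k \<sigma> \<omega>))"
  proof (intro sum.cong refl)
    fix \<sigma> assume "\<sigma> \<in> level m k n"
    have l: "level m k 1 = (\<lambda>j. [j]) ` letters m k"
      by (auto simp: length_Suc_conv words_def)
    show "(\<Sum>j\<in>letters m k. of_bool (\<omega> (\<sigma> @ [j]))) = generation m k 1 (subtree m k \<sigma> \<omega>)"
      unfolding generation_eq_sum l
      by (subst sum.reindex) (auto simp: inj_on_def subtree_def singleton_word intro!: sum.cong)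
  qed
  finally show ?thesis .
qed

lemma generation_Suc_first:
  "generation m k (Suc n) \<omega> = (\<Sum>j\<in>letters m k. generation m k n (subtree m k [j] \<omega>))"
proof -
  have "generation m k (Suc n) \<omega> = (\<Sum>(j, \<sigma>)\<in>letters m k \<times> level m k n. of_bool (\<omega> (j # \<sigma>)))"
    unfolding generation_eq_sum level_Suc' by (subst sum.reindex) (auto simp: inj_on_def case_prod_beta')
  also have "\<dots> = (\<Sum>j\<in>letters m k. \<Sum>\<sigma>\<in>level m k n. of_bool (\<omega> (j # \<sigma>)))"
    by (rule sum.cartesian_product[symmetric])
  also have "\<dots> = (\<Sum>j\<in>letters m k. generation m k n (subtree m k [j] \<omega>))"
    unfolding generation_eq_sum by (intro sum.cong refl) (auto simp: subtree_def)
  finally show ?thesis .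
qed

lemma generation_dead [simp]: "generation m k n (dead m k) = 0"
  unfolding generation_eq_sum by (intro sum.neutral) (auto simp: dead_def)

lemma measurable_generation [measurable]: "generation m k n \<in> borel_measurable (config_algebra m k)"
proof -
  have "(\<lambda>\<omega>. \<Sum>\<tau>\<in>level m k n. of_bool (\<omega> \<tau>) :: real) \<in> borel_measurable (config_algebra m k)"
  proof (rule borel_measurable_sum)
    fix \<tau> assume "\<tau> \<in> level m k n"
    then have [measurable]: "Measurable.pred (config_algebra m k) (\<lambda>\<omega>. \<omega> \<tau>)"
      by (intro measurable_config_coordinate) auto
    show "(\<lambda>\<omega>. of_bool (\<omega> \<tau>) :: real) \<in> borel_measurable (config_algebra m k)"
      unfolding of_bool_def by measurable
  qed
  then show ?thesis by (simp add: generation_eq_sum[abs_def])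
qed

context branching
begin

text \<open>
  The mean number of chosen children of a chosen word, equal to \<open>k^d\<close> for the dimension \<open>d\<close>.
\<close>

definition M :: real where "M = real k ^ m * p"

lemma M_gt_1: "M > 1"
  using p_gt k2 by (simp add: M_def field_simps)

lemma M_le: "M \<le> real k ^ m"
  using p_le by (simp add: M_def mult_left_le)

lemma AE_hereditary: "AE \<omega> in P. \<omega> [] \<and> hereditary m k \<omega>"
  using percolation_root_and_extinction
proof (rule AE_mp, intro AE_I2 impI)
  fix \<omega> assume h: "\<omega> [] \<and> (\<forall>\<sigma>\<in>W. \<forall>j\<in>L. \<not> \<omega> \<sigma> \<longrightarrow> \<not> \<omega> (\<sigma> @ [j]))"
  have "\<omega> \<sigma>" if "\<sigma> \<in> W" "\<tau> \<in> W" "\<omega> (\<sigma> @ \<tau>)" for \<sigma> \<tau>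
    using that(2,3)
  proof (induction \<tau> rule: rev_induct)
    case (snoc j \<tau>)
    then have "\<sigma> @ \<tau> \<in> W" "j \<in> L" "\<tau> \<in> W" using that(1) by (auto simp: words_def)
    then show ?case using h snoc by (metis append_assoc)
  qed simp
  then show "\<omega> [] \<and> hereditary m k \<omega>" using h by (auto simp: hereditary_def)
qed

lemma measurable_graft_P:
  "\<sigma> \<in> W \<Longrightarrow> graft m k \<sigma> \<in> measurable (P \<Otimes>\<^sub>M P) \<A>"
  using measurable_graft by (subst measurable_cong_sets) (auto intro!: sets_pair_measure_cong)

lemma nn_integral_graft:
  assumes "\<sigma> \<in> W" and F: "F \<in> borel_measurable \<A>"
  shows "(\<integral>\<^sup>+\<omega>. F \<omega> \<partial>P) = (\<integral>\<^sup>+\<omega>. \<integral>\<^sup>+\<omega>'. F (graft m k \<sigma> (\<omega>, \<omega>')) \<partial>P \<partial>P)"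
proof -
  note [measurable] = measurable_graft_P[OF assms(1)] F
  have "(\<integral>\<^sup>+\<omega>. F \<omega> \<partial>P) = (\<integral>\<^sup>+\<omega>. F \<omega> \<partial>distr (P \<Otimes>\<^sub>M P) \<A> (graft m k \<sigma>))"
    by (simp add: distr_graft[OF assms(1)])
  also have "\<dots> = (\<integral>\<^sup>+z. F (graft m k \<sigma> z) \<partial>(P \<Otimes>\<^sub>M P))"
    by (rule nn_integral_distr) measurable
  also have "\<dots> = (\<integral>\<^sup>+\<omega>. \<integral>\<^sup>+\<omega>'. F (graft m k \<sigma> (\<omega>, \<omega>')) \<partial>P \<partial>P)"
    by (rule P.nn_integral_fst[symmetric]) measurable
  finally show ?thesis .
qed

text \<open>
  The form in which the branching property is used: a function that factorises under grafting has
  the product of the two integrals.  The factorisation is only asked for configurations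
  \<open>\<omega>'\<close> with chosen root, since graftings are then faithful at \<open>\<sigma>\<close>, and this is almost sure.
\<close>

lemma nn_integral_graft_product:
  assumes "\<sigma> \<in> W" and [measurable]: "F \<in> borel_measurable \<A>" "u \<in> borel_measurable \<A>" "v \<in> borel_measurable \<A>"
    and eq: "\<And>\<omega> \<omega>'. \<omega> \<in> space \<A> \<Longrightarrow> \<omega>' \<in> space \<A> \<Longrightarrow> \<omega>' [] \<Longrightarrow> F (graft m k \<sigma> (\<omega>, \<omega>')) = u \<omega> * v \<omega>'"
  shows "(\<integral>\<^sup>+\<omega>. F \<omega> \<partial>P) = (\<integral>\<^sup>+\<omega>. u \<omega> \<partial>P) * (\<integral>\<^sup>+\<omega>. v \<omega> \<partial>P)"
proof -
  have "(\<integral>\<^sup>+\<omega>. F \<omega> \<partial>P) = (\<integral>\<^sup>+\<omega>. \<integral>\<^sup>+\<omega>'. F (graft m k \<sigma> (\<omega>, \<omega>')) \<partial>P \<partial>P)"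
    by (rule nn_integral_graft) fact+
  also have "\<dots> = (\<integral>\<^sup>+\<omega>. \<integral>\<^sup>+\<omega>'. u \<omega> * v \<omega>' \<partial>P \<partial>P)"
  proof (rule nn_integral_cong, rule nn_integral_cong_AE)
    fix \<omega> assume w: "\<omega> \<in> space P"
    show "AE \<omega>' in P. F (graft m k \<sigma> (\<omega>, \<omega>')) = u \<omega> * v \<omega>'"
      using AE_hereditary AE_space by eventually_elim (use w eq in auto)
  qed
  also have "\<dots> = (\<integral>\<^sup>+\<omega>. u \<omega> * (\<integral>\<^sup>+\<omega>'. v \<omega>' \<partial>P) \<partial>P)"
    by (intro nn_integral_cong nn_integral_cmult) measurable
  also have "\<dots> = (\<integral>\<^sup>+\<omega>. u \<omega> \<partial>P) * (\<integral>\<^sup>+\<omega>. v \<omega> \<partial>P)"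
    by (intro nn_integral_multc) measurable
  finally show ?thesis .
qed

lemma integrable_bounded:
  fixes F :: "_ \<Rightarrow> real"
  assumes "F \<in> borel_measurable \<A>" "\<And>\<omega>. \<bar>F \<omega>\<bar> \<le> B"
  shows "integrable P F"
  using assms by (intro P.integrable_const_bound[of _ B]) auto

lemma integral_graft_product:
  fixes F u v :: "_ \<Rightarrow> real"
  assumes s: "\<sigma> \<in> W" and [measurable]: "F \<in> borel_measurable \<A>" "u \<in> borel_measurable \<A>" "v \<in> borel_measurable \<A>"
    and b: "\<And>\<omega>. \<bar>u \<omega>\<bar> \<le> B" "\<And>\<omega>. \<bar>v \<omega>\<bar> \<le> B'"
    and eq: "\<And>\<omega> \<omega>'. \<omega> \<in> space \<A> \<Longrightarrow> \<omega>' \<in> space \<A> \<Longrightarrow> \<omega>' [] \<Longrightarrow> F (graft m k \<sigma> (\<omega>, \<omega>')) = u \<omega> * v \<omega>'"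
  shows "(\<integral>\<omega>. F \<omega> \<partial>P) = (\<integral>\<omega>. u \<omega> \<partial>P) * (\<integral>\<omega>. v \<omega> \<partial>P)"
proof -
  note [measurable] = measurable_graft_P[OF s]
  have "(\<integral>\<omega>. F \<omega> \<partial>P) = (\<integral>\<omega>. F \<omega> \<partial>distr (P \<Otimes>\<^sub>M P) \<A> (graft m k \<sigma>))"
    by (simp add: distr_graft[OF s])
  also have "\<dots> = (\<integral>z. F (graft m k \<sigma> z) \<partial>(P \<Otimes>\<^sub>M P))"
    by (rule integral_distr) measurable
  also have "\<dots> = (\<integral>z. u (fst z) * v (snd z) \<partial>(P \<Otimes>\<^sub>M P))"
  proof (intro integral_cong_AE)
    have "AE \<omega>' in P. \<omega>' []" using AE_hereditary by eventually_elim simp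
    then have "AE z in P \<Otimes>\<^sub>M P. snd z []"
      using measurable_compose[OF measurable_snd measurable_config_coordinate, of "[]" m k \<A>]
      by (intro PP.AE_pair_measure) (auto simp: pred_def space_pair_measure)
    then show "AE z in P \<Otimes>\<^sub>M P. F (graft m k \<sigma> z) = u (fst z) * v (snd z)"
      using AE_space by eventually_elim (use eq in \<open>auto simp: space_pair_measure\<close>)
  qed measurable
  also have "\<dots> = (\<integral>\<omega>. \<integral>\<omega>'. u \<omega> * v \<omega>' \<partial>P \<partial>P)"
  proof (subst PP.integral_fst'[symmetric])
    have "0 \<le> B" using b(1) by (meson abs_ge_zero order_trans)
    then have "\<bar>u (fst z) * v (snd z)\<bar> \<le> B * B'" for z :: "(nat list \<Rightarrow> bool) \<times> (nat list \<Rightarrow> bool)"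
      unfolding abs_mult using b by (intro mult_mono) auto
    then show "integrable (P \<Otimes>\<^sub>M P) (\<lambda>z. u (fst z) * v (snd z))"
      by (intro PP.P.integrable_const_bound[of _ "B * B'"]) auto
  qed simp
  also have "\<dots> = (\<integral>\<omega>. u \<omega> \<partial>P) * (\<integral>\<omega>. v \<omega> \<partial>P)"
    by simp
  finally show ?thesis .
qed

end

section \<open>Convergence of the normalised generation sizes\<close>

lemma sum_sum_offdiag_zero:
  fixes f :: "'a \<Rightarrow> 'a \<Rightarrow> real"
  assumes "finite S" "\<And>x y. x \<in> S \<Longrightarrow> y \<in> S \<Longrightarrow> x \<noteq> y \<Longrightarrow> f x y = 0"
  shows "(\<Sum>x\<in>S. \<Sum>y\<in>S. f x y) = (\<Sum>x\<in>S. f x x)"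
proof (intro sum.cong refl)
  fix x assume x: "x \<in> S"
  have "(\<Sum>y\<in>S. f x y) = (\<Sum>y\<in>S. if y = x then f x x else 0)"
    using assms(2) x by (intro sum.cong) auto
  then show "(\<Sum>y\<in>S. f x y) = f x x" using assms(1) x by simp
qed

context branching
begin

lemma prob_letter:
  assumes "j \<in> L"
  shows "(\<integral>\<omega>. of_bool (\<omega> [j]) \<partial>P) = p"
proof -
  note [measurable] = measurable_config_coordinate[OF singleton_word[THEN iffD2, OF assms]]
  have jW: "[j] \<in> W" using assms by (simp add: singleton_word)
  have "emeasure P {\<omega> \<in> space \<A>. \<omega> [j]} = emeasure C (g -` {\<omega> \<in> space \<A>. \<omega> [j]} \<inter> space C)"
    unfolding percolation_def by (rule emeasure_distr[OF g_measurable]) measurable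
  also have "g -` {\<omega> \<in> space \<A>. \<omega> [j]} \<inter> space C = {b \<in> space C. b [j] \<in> {True}}"
    using measurable_space[OF g_measurable] jW by (auto simp: config_of_coins_def)
  also have "emeasure C \<dots> = emeasure (measure_pmf (bernoulli_pmf p)) {True}"
  proof -
    interpret S: product_prob_space "\<lambda>_. measure_pmf (bernoulli_pmf p)" W
      by (unfold_locales)
    show ?thesis unfolding coin_measure_def
      by (rule S.emeasure_PiM_Collect_single[OF jW]) simp
  qed
  also have "\<dots> = ennreal p"
    using p_pos p_le by (simp add: emeasure_pmf_single)
  finally have e: "emeasure P {\<omega> \<in> space \<A>. \<omega> [j]} = ennreal p" .
  have "(\<integral>\<omega>. of_bool (\<omega> [j]) \<partial>P) = (\<integral>\<omega>. indicator {\<omega> \<in> space \<A>. \<omega> [j]} \<omega> \<partial>P)"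
    by (intro Bochner_Integration.integral_cong) (auto simp: indicator_def)
  also have "\<dots> = p" using e p_pos by (simp add: measure_def)
  finally show ?thesis .
qed

lemma measurable_of_bool:
  "\<sigma> \<in> W \<Longrightarrow> (\<lambda>\<omega>. of_bool (\<omega> \<sigma>) :: real) \<in> borel_measurable \<A>"
  using measurable_config_coordinate[of \<sigma> m k] unfolding of_bool_def by measurable

lemma prob_word:
  "\<sigma> \<in> W \<Longrightarrow> (\<integral>\<omega>. of_bool (\<omega> \<sigma>) \<partial>P) = p ^ length \<sigma>"
proof (induction \<sigma> rule: rev_induct)
  case Nil
  have "(\<integral>\<omega>. of_bool (\<omega> []) \<partial>P) = (\<integral>\<omega>. (1::real) \<partial>P)"
  proof (rule integral_cong_AE)
    show "AE \<omega> in P. of_bool (\<omega> []) = (1::real)"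
      using AE_hereditary by eventually_elim simp
  qed (use measurable_of_bool[of "[]"] in auto)
  then show ?case using P.prob_space by simp
next
  case (snoc j \<sigma>)
  then have s: "\<sigma> \<in> W" "j \<in> L" by (auto simp: words_def)
  have "(\<integral>\<omega>. (of_bool (\<omega> (\<sigma> @ [j])) :: real) \<partial>P) = (\<integral>\<omega>. of_bool (\<omega> \<sigma>) \<partial>P) * (\<integral>\<omega>. of_bool (\<omega> [j]) \<partial>P)"
  proof (rule integral_graft_product[OF s(1), of _ _ _ 1 1])
    show "of_bool (graft m k \<sigma> (\<omega>, \<omega>') (\<sigma> @ [j])) = (of_bool (\<omega> \<sigma>) * of_bool (\<omega>' [j]) :: real)" for \<omega> \<omega>'
      using snoc.prems by (simp add: graft_def)
  qed (use s snoc.prems in \<open>simp_all add: measurable_of_bool singleton_word\<close>)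
  then show ?case using snoc s prob_letter by simp
qed

lemma integrable_generation: "integrable P (generation m k n)"
  by (rule integrable_bounded[of _ "(real k ^ m) ^ n"])
    (simp_all add: abs_of_nonneg generation_nonneg generation_le)

lemma expectation_generation: "(\<integral>\<omega>. generation m k n \<omega> \<partial>P) = M ^ n"
proof -
  have "(\<integral>\<omega>. generation m k n \<omega> \<partial>P) = (\<Sum>\<tau>\<in>level m k n. \<integral>\<omega>. of_bool (\<omega> \<tau>) \<partial>P)"
    unfolding generation_eq_sum
    by (intro Bochner_Integration.integral_sum integrable_bounded[of _ 1]) (auto simp: measurable_of_bool)
  also have "\<dots> = (\<Sum>\<tau>\<in>level m k n. p ^ n)"
    by (intro sum.cong) (auto simp: prob_word)
  finally show ?thesis by (simp add: card_level M_def power_mult_distrib)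
qed

definition offspring_error :: "nat list \<Rightarrow> (nat list \<Rightarrow> bool) \<Rightarrow> real" where
  "offspring_error \<sigma> \<omega> = of_bool (\<omega> \<sigma>) * (generation m k 1 (sub \<sigma> \<omega>) - M)"

lemma measurable_offspring_error:
  "\<sigma> \<in> W \<Longrightarrow> offspring_error \<sigma> \<in> borel_measurable \<A>"
  unfolding offspring_error_def[abs_def]
  by (intro borel_measurable_times borel_measurable_diff borel_measurable_const measurable_of_bool
      measurable_compose[OF measurable_subtree measurable_generation])

lemma abs_generation_error: "\<bar>generation m k 1 \<omega> - M\<bar> \<le> real k ^ m"
  using generation_le[of m k 1 \<omega>] generation_nonneg[of m k 1 \<omega>] M_le M_gt_1
  unfolding abs_le_iff by simp

lemma abs_offspring_error: "\<bar>offspring_error \<sigma> \<omega>\<bar> \<le> real k ^ m"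
  using abs_generation_error[of "sub \<sigma> \<omega>"] by (cases "\<omega> \<sigma>") (simp_all add: offspring_error_def)

text \<open>
  Grafting at \<open>\<sigma>\<close> does not affect the offspring of another word \<open>\<tau>\<close> of the same level, while the
  offspring of \<open>\<sigma>\<close> becomes that of the independent copy.  Hence the centred factor of \<open>\<sigma>\<close> splits
  off and integrates to zero.
\<close>

lemma offspring_error_orthogonal:
  assumes "\<sigma> \<in> level m k n" "\<tau> \<in> level m k n" "\<sigma> \<noteq> \<tau>"
  shows "(\<integral>\<omega>. offspring_error \<sigma> \<omega> * offspring_error \<tau> \<omega> \<partial>P) = 0"
proof -
  have s: "\<sigma> \<in> W" "\<tau> \<in> W" using assms by auto
  have np: "\<not> prefix \<sigma> (\<tau> @ \<upsilon>)" for \<upsilon>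
    using assms by (auto simp: prefix_def append_eq_append_conv)
  have "(\<integral>\<omega>. offspring_error \<sigma> \<omega> * offspring_error \<tau> \<omega> \<partial>P) =
      (\<integral>\<omega>. of_bool (\<omega> \<sigma>) * offspring_error \<tau> \<omega> \<partial>P) * (\<integral>\<omega>. generation m k 1 \<omega> - M \<partial>P)"
  proof (rule integral_graft_product[OF s(1), of _ _ _ "real k ^ m" "real k ^ m"])
    show "\<bar>of_bool (\<omega> \<sigma>) * offspring_error \<tau> \<omega>\<bar> \<le> real k ^ m" for \<omega>
      using abs_offspring_error[of \<tau> \<omega>] by (cases "\<omega> \<sigma>") simp_all
    fix \<omega> \<omega>' assume w: "\<omega> \<in> space \<A>" "\<omega>' \<in> space \<A>" "\<omega>' []"
    have "sub \<tau> (graft m k \<sigma> (\<omega>, \<omega>')) = sub \<tau> \<omega>"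
      unfolding subtree_def using s np by (intro restrict_ext) (simp add: graft_outside append_in_words)
    then have "offspring_error \<tau> (graft m k \<sigma> (\<omega>, \<omega>')) = offspring_error \<tau> \<omega>"
      using s np[of "[]"] by (simp add: offspring_error_def graft_outside)
    moreover have "offspring_error \<sigma> (graft m k \<sigma> (\<omega>, \<omega>')) = of_bool (\<omega> \<sigma>) * (generation m k 1 \<omega>' - M)"
      using s w by (simp add: offspring_error_def graft_root subtree_graft)
    ultimately show "offspring_error \<sigma> (graft m k \<sigma> (\<omega>, \<omega>')) * offspring_error \<tau> (graft m k \<sigma> (\<omega>, \<omega>'))
      = of_bool (\<omega> \<sigma>) * offspring_error \<tau> \<omega> * (generation m k 1 \<omega>' - M)"
      by simp
  next
    show "\<bar>generation m k 1 \<omega> - M\<bar> \<le> real k ^ m" for \<omega> by (rule abs_generation_error)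
    note m = measurable_offspring_error[OF s(1)] measurable_offspring_error[OF s(2)]
    show "(\<lambda>\<omega>. offspring_error \<sigma> \<omega> * offspring_error \<tau> \<omega>) \<in> borel_measurable \<A>"
      by (rule borel_measurable_times[OF m])
    show "(\<lambda>\<omega>. of_bool (\<omega> \<sigma>) * offspring_error \<tau> \<omega>) \<in> borel_measurable \<A>"
      by (rule borel_measurable_times[OF measurable_of_bool[OF s(1)] m(2)])
  qed measurable
  also have "(\<integral>\<omega>. generation m k 1 \<omega> - M \<partial>P) = 0"
    using expectation_generation[of 1] integrable_generation[of 1] P.prob_space by simp
  finally show ?thesis by simp
qed

lemma generation_step_error:
  assumes "hereditary m k \<omega>"
  shows "generation m k (Suc n) \<omega> - M * generation m k n \<omega> = (\<Sum>\<sigma>\<in>level m k n. offspring_error \<sigma> \<omega>)"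
proof -
  have "generation m k 1 (sub \<sigma> \<omega>) - M * of_bool (\<omega> \<sigma>) = offspring_error \<sigma> \<omega>" if "\<sigma> \<in> level m k n" for \<sigma>
    using that assms hereditary_dead_subtree[of \<sigma> m k \<omega>] by (cases "\<omega> \<sigma>") (auto simp: offspring_error_def)
  then show ?thesis
    unfolding generation_Suc_last[of m k n \<omega>] generation_eq_sum[of m k n \<omega>] sum_distrib_left sum_subtractf[symmetric]
    by (intro sum.cong) auto
qed

text \<open>
  By orthogonality only the diagonal terms survive.  Each of them is at most \<open>k^(2m)\<close> and vanishes
  unless its word is chosen, and \<open>M^n\<close> words of level \<open>n\<close> are chosen on average.
\<close>

lemma generation_step_error_bound:
  "(\<integral>\<omega>. (generation m k (Suc n) \<omega> - M * generation m k n \<omega>)\<^sup>2 \<partial>P) \<le> M ^ n * (real k ^ m)\<^sup>2"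
proof -
  have int: "integrable P (\<lambda>\<omega>. offspring_error \<sigma> \<omega> * offspring_error \<tau> \<omega>)"
    if "\<sigma> \<in> level m k n" "\<tau> \<in> level m k n" for \<sigma> \<tau>
  proof (rule integrable_bounded[of _ "real k ^ m * real k ^ m"])
    show "(\<lambda>\<omega>. offspring_error \<sigma> \<omega> * offspring_error \<tau> \<omega>) \<in> borel_measurable \<A>"
      using that by (intro borel_measurable_times measurable_offspring_error) auto
    show "\<bar>offspring_error \<sigma> \<omega> * offspring_error \<tau> \<omega>\<bar> \<le> real k ^ m * real k ^ m" for \<omega>
      unfolding abs_mult by (intro mult_mono abs_offspring_error) auto
  qed
  have "(\<integral>\<omega>. (generation m k (Suc n) \<omega> - M * generation m k n \<omega>)\<^sup>2 \<partial>P) =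
      (\<integral>\<omega>. (\<Sum>\<sigma>\<in>level m k n. \<Sum>\<tau>\<in>level m k n. offspring_error \<sigma> \<omega> * offspring_error \<tau> \<omega>) \<partial>P)"
  proof (rule integral_cong_AE)
    show "AE \<omega> in P. (generation m k (Suc n) \<omega> - M * generation m k n \<omega>)\<^sup>2 =
        (\<Sum>\<sigma>\<in>level m k n. \<Sum>\<tau>\<in>level m k n. offspring_error \<sigma> \<omega> * offspring_error \<tau> \<omega>)"
      using AE_hereditary
    proof eventually_elim
      case (elim \<omega>)
      then show ?case by (simp add: generation_step_error power2_eq_square sum_product)
    qed
    show "(\<lambda>\<omega>. \<Sum>\<sigma>\<in>level m k n. \<Sum>\<tau>\<in>level m k n. offspring_error \<sigma> \<omega> * offspring_error \<tau> \<omega>)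
        \<in> borel_measurable P"
      by (intro borel_measurable_sum borel_measurable_integrable int)
  qed measurable
  also have "\<dots> = (\<Sum>\<sigma>\<in>level m k n. \<integral>\<omega>. (\<Sum>\<tau>\<in>level m k n. offspring_error \<sigma> \<omega> * offspring_error \<tau> \<omega>) \<partial>P)"
    by (rule Bochner_Integration.integral_sum) (intro Bochner_Integration.integrable_sum int)
  also have "\<dots> = (\<Sum>\<sigma>\<in>level m k n. \<Sum>\<tau>\<in>level m k n. \<integral>\<omega>. offspring_error \<sigma> \<omega> * offspring_error \<tau> \<omega> \<partial>P)"
    by (intro sum.cong refl Bochner_Integration.integral_sum int)
  also have "\<dots> = (\<Sum>\<sigma>\<in>level m k n. \<integral>\<omega>. offspring_error \<sigma> \<omega> * offspring_error \<sigma> \<omega> \<partial>P)"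
    by (rule sum_sum_offdiag_zero[OF finite_level offspring_error_orthogonal])
  also have "\<dots> \<le> (\<Sum>\<sigma>\<in>level m k n. p ^ n * (real k ^ m)\<^sup>2)"
  proof (rule sum_mono)
    fix \<sigma> assume s: "\<sigma> \<in> level m k n"
    have "(\<integral>\<omega>. offspring_error \<sigma> \<omega> * offspring_error \<sigma> \<omega> \<partial>P) \<le> (\<integral>\<omega>. of_bool (\<omega> \<sigma>) * (real k ^ m)\<^sup>2 \<partial>P)"
    proof (rule integral_mono)
      show "integrable P (\<lambda>\<omega>. of_bool (\<omega> \<sigma>) * (real k ^ m)\<^sup>2)"
        using s by (intro integrable_mult_left integrable_bounded[of _ 1]) (auto simp: measurable_of_bool)
      show "offspring_error \<sigma> \<omega> * offspring_error \<sigma> \<omega> \<le> of_bool (\<omega> \<sigma>) * (real k ^ m)\<^sup>2" for \<omega>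
        using power_mono[OF abs_generation_error[of "sub \<sigma> \<omega>"], of 2]
        by (auto simp: offspring_error_def power2_eq_square)
    qed (use int s in auto)
    then show "(\<integral>\<omega>. offspring_error \<sigma> \<omega> * offspring_error \<sigma> \<omega> \<partial>P) \<le> p ^ n * (real k ^ m)\<^sup>2"
      using s prob_word[of \<sigma>] by simp
  qed
  also have "\<dots> = M ^ n * (real k ^ m)\<^sup>2"
    by (simp add: card_level M_def power_mult_distrib)
  finally show ?thesis .
qed

definition normed_generation :: "nat \<Rightarrow> (nat list \<Rightarrow> bool) \<Rightarrow> real" where
  "normed_generation n \<omega> = generation m k n \<omega> / M ^ n"

lemma measurable_normed_generation [measurable]: "normed_generation n \<in> borel_measurable \<A>"
  unfolding normed_generation_def[abs_def] by measurable

text \<open>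
  The error of one step has second moment of order \<open>M^n\<close>, hence first moment of order \<open>M^(n/2)\<close>,
  and the normalisation divides by \<open>M^(n+1)\<close>.
\<close>

lemma expectation_increment:
  "(\<integral>\<omega>. \<bar>normed_generation (Suc n) \<omega> - normed_generation n \<omega>\<bar> \<partial>P) \<le> (real k ^ m)\<^sup>2 * (1 / sqrt M) ^ n"
proof -
  \<comment> \<open>in \<open>|y| \<le> (y\<^sup>2 / r + r) / 2\<close> this \<open>r = M^(n/2)\<close> balances the two terms\<close>
  define r where "r = sqrt M ^ n"
  define K where "K = real k ^ m"
  have r: "r > 0" "r * r = M ^ n" "r \<ge> 1"
  proof -
    show "r > 0" "r \<ge> 1" using M_gt_1 by (simp_all add: r_def)
    have "r * r = (sqrt M * sqrt M) ^ n" by (simp only: r_def power_mult_distrib)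
    then show "r * r = M ^ n" using M_gt_1 by simp
  qed
  have K: "K \<ge> 1" using k2 by (simp add: K_def)
  define Y where "Y \<omega> = generation m k (Suc n) \<omega> - M * generation m k n \<omega>" for \<omega>
  have Ym [measurable]: "Y \<in> borel_measurable \<A>" unfolding Y_def[abs_def] by measurable
  have iY2: "integrable P (\<lambda>\<omega>. (Y \<omega>)\<^sup>2)"
  proof (rule integrable_bounded)
    have "\<bar>Y \<omega>\<bar> \<le> K ^ Suc n + M * K ^ n" for \<omega>
    proof -
      have "0 \<le> M * generation m k n \<omega>" "M * generation m k n \<omega> \<le> M * K ^ n"
        using generation_le[of m k n \<omega>] generation_nonneg[of m k n \<omega>] M_gt_1 by (simp_all add: K_def)
      moreover have "0 \<le> generation m k (Suc n) \<omega>" "generation m k (Suc n) \<omega> \<le> K ^ Suc n"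
        using generation_le[of m k "Suc n" \<omega>] generation_nonneg unfolding K_def by blast+
      ultimately show ?thesis unfolding Y_def abs_le_iff by linarith
    qed
    from power_mono[OF this, where n=2] show "\<bar>(Y \<omega>)\<^sup>2\<bar> \<le> (K ^ Suc n + M * K ^ n)\<^sup>2" for \<omega>
      by simp
  qed measurable
  have ineq: "\<bar>Y \<omega>\<bar> \<le> ((Y \<omega>)\<^sup>2 / r + r) / 2" for \<omega>
  proof -
    have "0 \<le> (\<bar>Y \<omega>\<bar> - r)\<^sup>2" by simp
    moreover have "(\<bar>Y \<omega>\<bar> - r)\<^sup>2 = (Y \<omega>)\<^sup>2 - 2 * \<bar>Y \<omega>\<bar> * r + r * r"
      by (simp add: power2_diff power2_eq_square[of r])
    ultimately have "2 * \<bar>Y \<omega>\<bar> * r \<le> (Y \<omega>)\<^sup>2 + r * r" by linarith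
    then show ?thesis using r(1) by (simp add: field_simps)
  qed
  have "(\<integral>\<omega>. \<bar>Y \<omega>\<bar> \<partial>P) \<le> (\<integral>\<omega>. ((Y \<omega>)\<^sup>2 / r + r) / 2 \<partial>P)"
  proof (rule integral_mono_AE')
    show "AE \<omega> in P. \<bar>Y \<omega>\<bar> \<le> ((Y \<omega>)\<^sup>2 / r + r) / 2" using ineq by simp
    show "AE \<omega> in P. 0 \<le> ((Y \<omega>)\<^sup>2 / r + r) / 2" using r(1) by (intro AE_I2) (simp add: add_nonneg_nonneg)
  qed (use iY2 in auto)
  also have "\<dots> = ((\<integral>\<omega>. (Y \<omega>)\<^sup>2 \<partial>P) / r + r) / 2"
    using iY2 P.prob_space by simp
  also have "\<dots> \<le> ((r * r * K\<^sup>2) / r + r) / 2"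
    using generation_step_error_bound[of n] r(1) unfolding Y_def K_def r(2)
    by (intro divide_right_mono add_right_mono) simp_all
  also have "\<dots> \<le> K\<^sup>2 * r"
  proof -
    have le: "r \<le> K\<^sup>2 * r" using r(1) K by (simp add: one_le_power)
    have eq: "(r * r * K\<^sup>2) / r = K\<^sup>2 * r" using r(1) by simp
    have "(z + r) / 2 \<le> z" if "r \<le> z" for z :: real using that by simp
    from this[OF le] show ?thesis unfolding eq .
  qed
  finally have "(\<integral>\<omega>. \<bar>Y \<omega>\<bar> \<partial>P) \<le> K\<^sup>2 * r" .
  moreover have "\<bar>normed_generation (Suc n) \<omega> - normed_generation n \<omega>\<bar> = \<bar>Y \<omega>\<bar> / M ^ Suc n" for \<omega>
  proof -
    have "normed_generation (Suc n) \<omega> - normed_generation n \<omega> = Y \<omega> / M ^ Suc n"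
      using M_gt_1 by (simp add: normed_generation_def Y_def diff_divide_distrib)
    then show ?thesis using M_gt_1 by (simp only: abs_divide) simp
  qed
  ultimately have "(\<integral>\<omega>. \<bar>normed_generation (Suc n) \<omega> - normed_generation n \<omega>\<bar> \<partial>P) \<le> K\<^sup>2 * r / M ^ Suc n"
    using M_gt_1 by (simp add: divide_right_mono)
  also have "\<dots> \<le> K\<^sup>2 * r / M ^ n"
    using M_gt_1 r(1) by (intro divide_left_mono) simp_all
  also have "\<dots> = K\<^sup>2 * (1 / sqrt M) ^ n"
  proof -
    have "(1 / sqrt M) ^ n = 1 / r" by (simp add: power_one_over r_def)
    moreover have "K\<^sup>2 * r / (r * r) = K\<^sup>2 * (1 / r)" using r(1) by simp
    ultimately show ?thesis by (simp only: r(2))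
  qed
  finally show ?thesis by (simp add: K_def)
qed

definition X :: "(nat list \<Rightarrow> bool) \<Rightarrow> real" where
  "X \<omega> = lim (\<lambda>n. normed_generation n \<omega>)"

lemma measurable_X [measurable]: "X \<in> borel_measurable \<A>"
  unfolding X_def[abs_def] by measurable

lemma normed_generation_nonneg: "0 \<le> normed_generation n \<omega>"
  using M_gt_1 generation_nonneg by (simp add: normed_generation_def)

text \<open>
  Since \<open>M > 1\<close>, the \<open>L\<^sup>1\<close>-norms of the increments have a finite sum.  So the increments are almost
  surely absolutely summable, and integration commutes with their sum, which keeps the mean \<open>1\<close>.
\<close>

lemma martingale_convergence:
  "AE \<omega> in P. convergent (\<lambda>n. normed_generation n \<omega>)" (is ?conv)
  and integrable_X: "integrable P X"
  and expectation_X: "(\<integral>\<omega>. X \<omega> \<partial>P) = 1"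
proof -
  define f where "f n \<omega> = normed_generation (Suc n) \<omega> - normed_generation n \<omega>" for n \<omega>
  have f [measurable]: "f n \<in> borel_measurable \<A>" for n unfolding f_def[abs_def] by measurable
  have iN: "integrable P (normed_generation n)" for n
    unfolding normed_generation_def[abs_def] using integrable_generation by simp
  have if_: "integrable P (f n)" for n unfolding f_def[abs_def] using iN by simp
  have sM: "norm (1 / sqrt M) < 1" using M_gt_1 by simp
  have bd: "(\<integral>\<omega>. norm (f n \<omega>) \<partial>P) \<le> (real k ^ m)\<^sup>2 * (1 / sqrt M) ^ n" for n
    using expectation_increment[of n] by (simp add: f_def)
  have sm: "summable (\<lambda>n. (real k ^ m)\<^sup>2 * (1 / sqrt M) ^ n)"
    by (intro summable_mult summable_geometric sM)
  have sE: "summable (\<lambda>n. \<integral>\<omega>. norm (f n \<omega>) \<partial>P)"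
    by (rule summable_comparison_test'[OF sm, of 0]) (use bd in auto)
  have "(\<integral>\<^sup>+\<omega>. (\<Sum>n. ennreal (norm (f n \<omega>))) \<partial>P) = (\<Sum>n. \<integral>\<^sup>+\<omega>. ennreal (norm (f n \<omega>)) \<partial>P)"
    by (rule nn_integral_suminf) measurable
  also have "\<dots> = (\<Sum>n. ennreal (\<integral>\<omega>. norm (f n \<omega>) \<partial>P))"
    using if_ by (intro suminf_cong nn_integral_eq_integral) auto
  also have "\<dots> = ennreal (\<Sum>n. \<integral>\<omega>. norm (f n \<omega>) \<partial>P)"
    by (rule suminf_ennreal2) (use sE in auto)
  also have "\<dots> \<noteq> \<infinity>" by simp
  finally have "AE \<omega> in P. (\<Sum>n. ennreal (norm (f n \<omega>))) \<noteq> \<infinity>"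
    by (intro nn_integral_PInf_AE) auto
  then have sA: "AE \<omega> in P. summable (\<lambda>n. norm (f n \<omega>))"
  proof eventually_elim
    case (elim \<omega>)
    then show ?case by (intro summable_suminf_not_top) auto
  qed
  have tel: "normed_generation n \<omega> = normed_generation 0 \<omega> + (\<Sum>i<n. f i \<omega>)" for n \<omega>
    using sum_lessThan_telescope[of "\<lambda>n. normed_generation n \<omega>" n] by (simp add: f_def)
  have lim: "(\<lambda>n. normed_generation n \<omega>) \<longlonglongrightarrow> normed_generation 0 \<omega> + (\<Sum>n. f n \<omega>)"
    if "summable (\<lambda>n. norm (f n \<omega>))" for \<omega>
  proof -
    have "(\<lambda>n. normed_generation 0 \<omega> + (\<Sum>i<n. f i \<omega>)) \<longlonglongrightarrow> normed_generation 0 \<omega> + (\<Sum>n. f n \<omega>)"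
      using summable_LIMSEQ[OF summable_norm_cancel[OF that]] by (intro tendsto_intros)
    moreover have "(\<lambda>n. normed_generation n \<omega>) = (\<lambda>n. normed_generation 0 \<omega> + (\<Sum>i<n. f i \<omega>))"
      by (rule ext) (rule tel)
    ultimately show ?thesis by (rule back_subst[of "\<lambda>h. h \<longlonglongrightarrow> _", OF _ sym])
  qed
  show ?conv using sA by eventually_elim (rule convergentI[OF lim])
  have isum: "integrable P (\<lambda>\<omega>. \<Sum>n. f n \<omega>)" by (rule integrable_suminf[OF if_ sA sE])
  have "(\<integral>\<omega>. (\<Sum>n. f n \<omega>) \<partial>P) = (\<Sum>n. \<integral>\<omega>. f n \<omega> \<partial>P)"
    by (rule integral_suminf[OF if_ sA sE])
  moreover have EN: "(\<integral>\<omega>. normed_generation n \<omega> \<partial>P) = 1" for n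
    using expectation_generation[of n] M_gt_1 by (simp add: normed_generation_def)
  moreover have "(\<integral>\<omega>. f n \<omega> \<partial>P) = 0" for n
    unfolding f_def using iN EN by simp
  ultimately have s0: "(\<integral>\<omega>. (\<Sum>n. f n \<omega>) \<partial>P) = 0" by simp
  have X: "AE \<omega> in P. X \<omega> = normed_generation 0 \<omega> + (\<Sum>n. f n \<omega>)"
    using sA by eventually_elim (simp add: X_def limI[OF lim])
  show "integrable P X"
  proof (subst integrable_cong_AE[OF _ _ X])
    show "integrable P (\<lambda>\<omega>. normed_generation 0 \<omega> + (\<Sum>n. f n \<omega>))"
      by (rule Bochner_Integration.integrable_add[OF iN isum])
  qed simp_all
  have "(\<integral>\<omega>. X \<omega> \<partial>P) = (\<integral>\<omega>. normed_generation 0 \<omega> + (\<Sum>n. f n \<omega>) \<partial>P)"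
    by (rule integral_cong_AE[OF _ _ X]) simp_all
  also have "\<dots> = (\<integral>\<omega>. normed_generation 0 \<omega> \<partial>P) + (\<integral>\<omega>. (\<Sum>n. f n \<omega>) \<partial>P)"
    by (rule Bochner_Integration.integral_add[OF iN isum])
  also have "\<dots> = 1" using EN[of 0] s0 by simp
  finally show "(\<integral>\<omega>. X \<omega> \<partial>P) = 1" .
qed

lemma X_dead [simp]: "X (dead m k) = 0"
  by (simp add: X_def normed_generation_def limI)

lemma X_nonneg: "convergent (\<lambda>n. normed_generation n \<omega>) \<Longrightarrow> 0 \<le> X \<omega>"
  unfolding X_def by (rule LIMSEQ_le_const[OF convergent_LIMSEQ_iff[THEN iffD1]]) (auto simp: normed_generation_nonneg)

text \<open>
  The subtree at \<open>\<sigma>\<close> is either dead or, when \<open>\<sigma>\<close> is chosen, distributed according to \<open>P\<close>; a null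
  set that avoids the dead configuration is therefore avoided by subtrees as well.
\<close>

lemma AE_subtree:
  assumes s: "\<sigma> \<in> W" and R: "AE \<omega> in P. R \<omega>" "R (dead m k)"
  shows "AE \<omega> in P. R (sub \<sigma> \<omega>)"
proof -
  obtain N where N: "N \<in> sets P" "emeasure P N = 0" "{\<omega> \<in> space P. \<not> R \<omega>} \<subseteq> N"
    using R(1) by (auto elim: AE_E)
  \<comment> \<open>the exceptional null set may contain the dead configuration, which subtrees reach with positive probability\<close>
  define N' where "N' = N - {dead m k}"
  have "emeasure P N' \<le> emeasure P N" unfolding N'_def by (rule emeasure_mono) (use N in auto)
  have dm: "{dead m k} \<in> sets \<A>"
  proof -
    have "{dead m k} = (\<Inter>\<tau>\<in>W. {\<omega> \<in> space \<A>. \<not> \<omega> \<tau>})"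
    proof (intro set_eqI iffI)
      fix \<omega> assume w: "\<omega> \<in> (\<Inter>\<tau>\<in>W. {\<omega> \<in> space \<A>. \<not> \<omega> \<tau>})"
      then have "\<omega> \<in> space \<A>" by (auto intro: Nil_word)
      then have "\<omega> = dead m k" using w by (auto simp: dead_def space_config extensional_def fun_eq_iff)
      then show "\<omega> \<in> {dead m k}" by simp
    qed (use dead_space in \<open>auto simp: dead_def\<close>)
    also have "\<dots> \<in> sets \<A>"
    proof (intro sets.countable_INT')
      show "(\<lambda>\<tau>. {\<omega> \<in> space \<A>. \<not> \<omega> \<tau>}) ` W \<subseteq> sets \<A>"
      proof safe
        fix \<tau> assume "\<tau> \<in> W"
        note [measurable] = measurable_config_coordinate[OF this]
        show "{\<omega> \<in> space \<A>. \<not> \<omega> \<tau>} \<in> sets \<A>" by measurable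
      qed
    qed (auto intro: Nil_word)
    finally show ?thesis .
  qed
  have N': "N' \<in> sets \<A>" "emeasure P N' = 0" "{\<omega> \<in> space P. \<not> R \<omega>} \<subseteq> N'" "dead m k \<notin> N'"
    using N dm R(2) \<open>emeasure P N' \<le> emeasure P N\<close> by (auto simp: N'_def)
  note [measurable] = N'(1) measurable_subtree[OF s] measurable_config_coordinate[OF s]
  have [measurable]: "(\<lambda>\<omega>. indicator N' (sub \<sigma> \<omega>) :: ennreal) \<in> borel_measurable \<A>" by measurable
  have "(\<integral>\<^sup>+\<omega>. indicator N' (sub \<sigma> \<omega>) \<partial>P) = (\<integral>\<^sup>+\<omega>. of_bool (\<omega> \<sigma>) \<partial>P) * (\<integral>\<^sup>+\<omega>. indicator N' \<omega> \<partial>P)"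
  proof (rule nn_integral_graft_product[OF s])
    show "(\<lambda>\<omega>. of_bool (\<omega> \<sigma>) :: ennreal) \<in> borel_measurable \<A>" unfolding of_bool_def by measurable
    show "indicator N' (sub \<sigma> (graft m k \<sigma> (\<omega>, \<omega>'))) = (of_bool (\<omega> \<sigma>) * indicator N' \<omega>' :: ennreal)"
      if "\<omega>' \<in> space \<A>" for \<omega> \<omega>'
      using that s N'(4) by (simp add: subtree_graft)
  qed measurable
  also have "\<dots> = 0" using N' by simp
  finally have "(\<integral>\<^sup>+\<omega>. indicator N' (sub \<sigma> \<omega>) \<partial>P) = 0" .
  then have "AE \<omega> in P. indicator N' (sub \<sigma> \<omega>) = (0::ennreal)"
    by (subst (asm) nn_integral_0_iff_AE) auto
  then show ?thesis
    by eventually_elim (use N'(3) subtree_space in \<open>force simp: indicator_def split: if_splits\<close>)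
qed

end

section \<open>Vanishing limit and extinction\<close>

text \<open>
  The function \<open>s \<mapsto> (1 - p + p s)^K\<close> is strictly convex and fixes \<open>1\<close>.  If \<open>e < q < 1\<close> were fixed
  points, the chords over \<open>[e, q]\<close> and \<open>[q, 1]\<close> would both have slope \<open>1\<close>.  The proof compares
  these two slopes, written as \<open>p\<close> times a sum of products of powers.
\<close>

lemma branching_fixed_point_unique:
  fixes p e q :: real and K :: nat
  assumes p: "0 < p" "p \<le> 1" and K: "K \<ge> 2" and eq: "0 \<le> e" "e \<le> q" "q < 1"
    and e: "e = (1 - p + p * e) ^ K" and q: "q = (1 - p + p * q) ^ K"
  shows "e = q"
proof (rule ccontr)
  assume "e \<noteq> q"
  with eq have lt: "e < q" by simp
  define u v where "u = 1 - p + p * q" and "v = 1 - p + p * e"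
  have uv: "0 \<le> v" "v < u" "u < 1"
    using p eq lt by (auto simp: u_def v_def add_nonneg_nonneg)
  have uq: "u ^ K = q" and ve: "v ^ K = e"
    unfolding u_def v_def by (rule q[symmetric], rule e[symmetric])
  have "(1 - u) * (\<Sum>i<K. u ^ i) = 1 - q"
    using power_diff_sumr2[of u K 1] unfolding uq by (simp add: algebra_simps)
  moreover have "1 - u = p * (1 - q)" by (simp add: u_def algebra_simps)
  ultimately have "(1 - q) * (p * (\<Sum>i<K. u ^ i)) = (1 - q) * 1"
    by (simp add: mult_ac)
  \<comment> \<open>slope of the chord over \<open>[q, 1]\<close>\<close>
  then have s1: "p * (\<Sum>i<K. u ^ i) = 1"
    using eq mult_left_cancel[of "1 - q"] by simp
  have "(u - v) * (\<Sum>i<K. v ^ (K - Suc i) * u ^ i) = q - e"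
    using power_diff_sumr2[of u K v] unfolding uq ve by simp
  moreover have "u - v = p * (q - e)" by (simp add: u_def v_def algebra_simps)
  ultimately have "(q - e) * (p * (\<Sum>i<K. v ^ (K - Suc i) * u ^ i)) = (q - e) * 1"
    by (simp add: mult_ac)
  \<comment> \<open>slope of the chord over \<open>[e, q]\<close>\<close>
  then have s2: "p * (\<Sum>i<K. v ^ (K - Suc i) * u ^ i) = 1"
    using lt mult_left_cancel[of "q - e"] by simp
  have "(\<Sum>i<K. v ^ (K - Suc i) * u ^ i) < (\<Sum>i<K. u ^ i)"
  proof (rule sum_strict_mono_ex1)
    show "\<forall>i\<in>{..<K}. v ^ (K - Suc i) * u ^ i \<le> u ^ i"
      using uv by (auto intro!: mult_left_le_one_le power_le_one)
    have "v ^ (K - Suc 0) < 1"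
      using uv K by (intro power_less_one_iff[THEN iffD2]) auto
    then show "\<exists>i\<in>{..<K}. v ^ (K - Suc i) * u ^ i < u ^ i"
      using K by (intro bexI[of _ 0]) auto
  qed simp
  then have "p * (\<Sum>i<K. v ^ (K - Suc i) * u ^ i) < p * (\<Sum>i<K. u ^ i)"
    using p by simp
  with s1 s2 show False by simp
qed

definition extinct :: "nat \<Rightarrow> nat \<Rightarrow> (nat list \<Rightarrow> bool) \<Rightarrow> bool" where
  "extinct m k \<omega> \<longleftrightarrow> (\<exists>n. generation m k n \<omega> = 0)"

lemma extinct_dead: "extinct m k (dead m k)"
  by (simp add: extinct_def)

lemma generation_zero_iff: "generation m k n \<omega> = 0 \<longleftrightarrow> (\<forall>\<tau>\<in>level m k n. \<not> \<omega> \<tau>)"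
  unfolding generation_eq_sum by (subst sum_nonneg_eq_0_iff) (auto simp: finite_level of_bool_def)

lemma generation_zero_mono:
  assumes "hereditary m k \<omega>" "generation m k n \<omega> = 0" "n \<le> n'"
  shows "generation m k n' \<omega> = 0"
  unfolding generation_zero_iff
proof
  fix \<tau> assume t: "\<tau> \<in> level m k n'"
  have "\<omega> \<tau> \<Longrightarrow> \<omega> (take n \<tau>)"
    using assms(1) t take_word[of \<tau> m k n] drop_word[of \<tau> m k n]
    bspec[OF bspec[OF assms(1)[unfolded hereditary_def], of "take n \<tau>"], of "drop n \<tau>"] by simp
  moreover have "take n \<tau> \<in> level m k n" using t assms(3) take_word[of \<tau> m k n] by auto
  ultimately show "\<not> \<omega> \<tau>" using assms(2) by (auto simp: generation_zero_iff)
qed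

lemma extinct_children:
  assumes "hereditary m k \<omega>"
  shows "extinct m k \<omega> \<longleftrightarrow> (\<forall>j\<in>letters m k. extinct m k (subtree m k [j] \<omega>))"
proof
  assume "extinct m k \<omega>"
  then obtain n where "generation m k n \<omega> = 0" by (auto simp: extinct_def)
  then have "generation m k (Suc n) \<omega> = 0" by (rule generation_zero_mono[OF assms]) simp
  then have "\<forall>j\<in>letters m k. generation m k n (subtree m k [j] \<omega>) = 0"
    unfolding generation_Suc_first by (subst (asm) sum_nonneg_eq_0_iff) (auto simp: generation_nonneg letters_def)
  then show "\<forall>j\<in>letters m k. extinct m k (subtree m k [j] \<omega>)" by (auto simp: extinct_def)
next
  assume "\<forall>j\<in>letters m k. extinct m k (subtree m k [j] \<omega>)"
  then obtain n where n: "\<forall>j\<in>letters m k. generation m k (n j) (subtree m k [j] \<omega>) = 0"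
    unfolding extinct_def by metis
  define N where "N = Max (insert 0 (n ` letters m k))"
  have N: "n j \<le> N" if "j \<in> letters m k" for j
    using that unfolding N_def by (intro Max_ge) (auto simp: letters_def)
  have "generation m k N (subtree m k [j] \<omega>) = 0" if "j \<in> letters m k" for j
    by (rule generation_zero_mono[OF hereditary_subtree[OF _ assms], of "[j]" "n j"])
      (use that n N in \<open>simp_all add: singleton_word\<close>)
  then have "generation m k (Suc N) \<omega> = 0" unfolding generation_Suc_first by simp
  then show "extinct m k \<omega>" by (auto simp: extinct_def)
qed

context branching
begin

lemma letters_ge_2: "k ^ m \<ge> 2"
proof -
  have "m \<noteq> 0" using p_gt p_le by (intro notI) simp
  then show ?thesis using k2 self_le_power[of k m] by simp
qed

lemma measurable_coin [measurable (raw)]: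
  assumes "\<tau> \<in> W" shows "Measurable.pred C (\<lambda>b. b \<tau>)"
proof -
  have "(\<lambda>b. b \<tau>) \<in> measurable C (measure_pmf (bernoulli_pmf p))"
    unfolding coin_measure_def by (rule measurable_component_singleton[OF assms])
  then show ?thesis by (simp add: measurable_def)
qed

lemma prob_coin_Times:
  "A \<in> sets C \<Longrightarrow> B \<in> sets C \<Longrightarrow> measure (C \<Otimes>\<^sub>M C) (A \<times> B) = measure C A * measure C B"
  by (simp add: measure_def C.emeasure_pair_measure_Times enn2real_mult)

text \<open>
  The subtree at the child \<open>j\<close> is determined by the coins at and below \<open>[j]\<close>, and these families are
  independent for different \<open>j\<close>.  A property of the dead configuration holds for the subtree at \<open>j\<close>
  if the coin of \<open>j\<close> fails, and otherwise with the probability that it has under \<open>P\<close>.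
\<close>

lemma prob_all_children:
  assumes R [measurable]: "Measurable.pred \<A> R" and dead: "R (dead m k)" and S: "S \<subseteq> L"
  shows "measure P {\<omega> \<in> space P. \<forall>j\<in>S. R (sub [j] \<omega>)} =
    (1 - p + p * measure P {\<omega> \<in> space P. R \<omega>}) ^ card S"
proof -
  note [measurable] = g_measurable
  define r where "r = measure P {\<omega> \<in> space P. R \<omega>}"
  \<comment> \<open>the coins below a child are read as a family with root coin, which decides whether the child is chosen\<close>
  define V where "V b \<longleftrightarrow> (b [] \<longrightarrow> R (g b))" for b
  define ch where "ch j b = (\<lambda>\<upsilon>\<in>W. b (j # \<upsilon>))" for j and b :: "nat list \<Rightarrow> bool"
  have fin: "finite L" by (simp add: letters_def)
  have jW: "j # \<upsilon> \<in> W" if "j \<in> L" "\<upsilon> \<in> W" for j \<upsilon> using that by (auto simp: words_def)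
  have [measurable]: "Measurable.pred C V"
    unfolding V_def using measurable_coin[OF Nil_word] by measurable
  have chm: "ch j \<in> measurable C C" if "j \<in> L" for j
    using that unfolding ch_def[abs_def] coin_measure_def
    by (intro measurable_restrict measurable_component_singleton jW)
  have transfer: "measure P {\<omega> \<in> space P. T \<omega>} = measure C {b \<in> space C. T (g b)}"
    if [measurable]: "Measurable.pred \<A> T" for T
  proof -
    have "g -` {\<omega> \<in> space \<A>. T \<omega>} \<inter> space C = {b \<in> space C. T (g b)}"
      using measurable_space[OF g_measurable] by auto
    then show ?thesis
      unfolding percolation_def using measure_distr[OF g_measurable, of "{\<omega> \<in> space \<A>. T \<omega>}"] by simp
  qed
  have r: "r = measure C {b \<in> space C. R (g b)}" unfolding r_def by (rule transfer) fact
  have subg: "sub [j] (g b) = (if b [j] then g (ch j b) else dead m k)" if j: "j \<in> L" for j b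
  proof
    fix \<tau>
    show "sub [j] (g b) \<tau> = (if b [j] then g (ch j b) else dead m k) \<tau>"
    proof (cases "\<tau> \<in> W")
      case True
      have "g b ([j] @ \<tau>) \<longleftrightarrow> g b [j] \<and> g (\<lambda>\<upsilon>. b ([j] @ \<upsilon>)) \<tau>"
        using j True by (intro config_append) (auto simp: singleton_word)
      moreover have "g b [j] = b [j]" using j by (simp add: config_of_coins_def singleton_word)
      moreover have "g (\<lambda>\<upsilon>. b ([j] @ \<upsilon>)) \<tau> = g (ch j b) \<tau>"
        using True take_word[OF True] by (auto simp: config_of_coins_def ch_def)
      ultimately show ?thesis using True by (auto simp: subtree_def dead_def)
    qed (auto simp: subtree_def dead_def config_of_coins_def)
  qed
  have chNil: "ch j b [] = b [j]" for j b by (simp add: ch_def)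
  have RV: "R (sub [j] (g b)) \<longleftrightarrow> V (ch j b)" if "j \<in> L" for j b
    using subg[OF that, of b] dead by (auto simp: V_def chNil)
  \<comment> \<open>resampling all coins except the root coin shows that the latter is independent of the configuration\<close>
  have VP: "measure C {b \<in> space C. V b} = 1 - p + p * r"
  proof -
    define \<Phi> where "\<Phi> = (\<lambda>(b, b'). \<lambda>\<tau>\<in>W. if \<tau> \<in> W - {[]} then b' (id \<tau>) else b \<tau> :: bool)"
    have m\<Phi>: "\<Phi> \<in> measurable (C \<Otimes>\<^sub>M C) C"
      unfolding \<Phi>_def by (rule measurable_coin_resample) auto
    have d\<Phi>: "distr (C \<Otimes>\<^sub>M C) C \<Phi> = C"
      unfolding \<Phi>_def by (rule distr_coin_resample) auto
    have g\<Phi>: "g (\<Phi> (b, b')) = g b'" for b b'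
    proof
      fix \<tau>
      have "\<tau> \<in> W \<Longrightarrow> l \<in> {1..length \<tau>} \<Longrightarrow> take l \<tau> \<in> W - {[]}" for l
        using take_word[of \<tau> m k l] by auto
      then show "g (\<Phi> (b, b')) \<tau> = g b' \<tau>" by (auto simp: config_of_coins_def \<Phi>_def)
    qed
    have N\<Phi>: "\<Phi> (b, b') [] = b []" for b b' by (simp add: \<Phi>_def)
    have sp\<Phi>: "\<Phi> (b, b') \<in> space C" if "b \<in> space C" "b' \<in> space C" for b b'
      using measurable_space[OF m\<Phi>, of "(b, b')"] that by (simp add: space_pair_measure)
    have cW [measurable]: "Measurable.pred C (\<lambda>b. b [])" by (rule measurable_coin) simp
    have "measure C {b \<in> space C. b [] \<and> \<not> R (g b)} =
        measure (distr (C \<Otimes>\<^sub>M C) C \<Phi>) {b \<in> space C. b [] \<and> \<not> R (g b)}"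
      by (simp only: d\<Phi>)
    also have "\<dots> = measure (C \<Otimes>\<^sub>M C) (\<Phi> -` {b \<in> space C. b [] \<and> \<not> R (g b)} \<inter> space (C \<Otimes>\<^sub>M C))"
      by (rule measure_distr[OF m\<Phi>]) measurable
    also have "\<Phi> -` {b \<in> space C. b [] \<and> \<not> R (g b)} \<inter> space (C \<Otimes>\<^sub>M C) =
        {b \<in> space C. b []} \<times> {b \<in> space C. \<not> R (g b)}"
      using sp\<Phi> by (auto simp: space_pair_measure g\<Phi> N\<Phi>)
    also have "measure (C \<Otimes>\<^sub>M C) \<dots> = measure C {b \<in> space C. b []} * measure C {b \<in> space C. \<not> R (g b)}"
      by (rule prob_coin_Times) measurable
    also have "measure C {b \<in> space C. b []} = p"
    proof -
      interpret S: product_prob_space "\<lambda>_. measure_pmf (bernoulli_pmf p)" W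
        by unfold_locales
      have "emeasure C {b \<in> space C. b [] \<in> {True}} = emeasure (measure_pmf (bernoulli_pmf p)) {True}"
        unfolding coin_measure_def by (rule S.emeasure_PiM_Collect_single) auto
      then show ?thesis using p_pos p_le by (simp add: measure_def emeasure_pmf_single)
    qed
    also have "measure C {b \<in> space C. \<not> R (g b)} = 1 - r"
      unfolding r by (subst C.prob_neg[symmetric]) auto
    finally have "measure C {b \<in> space C. b [] \<and> \<not> R (g b)} = p * (1 - r)" .
    moreover have "measure C {b \<in> space C. \<not> (b [] \<and> \<not> R (g b))} = 1 - measure C {b \<in> space C. b [] \<and> \<not> R (g b)}"
      by (rule C.prob_neg) measurable
    moreover have "{b \<in> space C. \<not> (b [] \<and> \<not> R (g b))} = {b \<in> space C. V b}" by (auto simp: V_def)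
    ultimately show ?thesis by (simp add: algebra_simps)
  qed
  \<comment> \<open>independence of the children, by resampling the coins at and below one child at a time\<close>
  have main: "measure C {b \<in> space C. \<forall>j\<in>S. V (ch j b)} = (1 - p + p * r) ^ card S" if "S \<subseteq> L" for S
    using finite_subset[OF that fin] that
  proof (induction S rule: finite_induct)
    case empty
    then show ?case by (simp add: C.prob_space)
  next
    case (insert i S)
    let ?H = "{\<tau> \<in> W. prefix [i] \<tau>}"
    define \<Phi> where "\<Phi> = (\<lambda>(b, b'). \<lambda>\<tau>\<in>W. if \<tau> \<in> ?H then b' (drop 1 \<tau>) else b \<tau> :: bool)"
    have im: "drop 1 ` ?H \<subseteq> W" using drop_word by auto
    have m\<Phi>: "\<Phi> \<in> measurable (C \<Otimes>\<^sub>M C) C"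
      unfolding \<Phi>_def by (rule measurable_coin_resample[OF _ im]) auto
    have d\<Phi>: "distr (C \<Otimes>\<^sub>M C) C \<Phi> = C"
      unfolding \<Phi>_def by (rule distr_coin_resample[OF _ _ im]) (auto simp: inj_on_def prefix_def)
    have sp\<Phi>: "\<Phi> (b, b') \<in> space C" if "b \<in> space C" "b' \<in> space C" for b b'
      using measurable_space[OF m\<Phi>, of "(b, b')"] that by (simp add: space_pair_measure)
    have chi: "ch i (\<Phi> (b, b')) = b'" if "b' \<in> space C" for b b'
    proof
      fix \<upsilon>
      have "b' \<in> extensional W" using that by (simp add: coin_measure_def space_PiM PiE_def)
      then show "ch i (\<Phi> (b, b')) \<upsilon> = b' \<upsilon>"
        using insert.prems jW[of i \<upsilon>] by (auto simp: ch_def extensional_def \<Phi>_def)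
    qed
    have chj: "ch j (\<Phi> (b, b')) = ch j b" if "j \<in> S" for j b b'
    proof
      fix \<upsilon> show "ch j (\<Phi> (b, b')) \<upsilon> = ch j b \<upsilon>"
        using that insert.prems insert.hyps jW[of j \<upsilon>] by (auto simp: ch_def \<Phi>_def)
    qed
    have fS: "finite S" and SL: "S \<subseteq> L" and iL: "i \<in> L" using insert by auto
    have Vch: "{b \<in> space C. V (ch j b)} \<in> sets C" if "j \<in> L" for j
      using measurable_compose[OF chm[OF that] \<open>Measurable.pred C V\<close>] by (simp add: pred_def)
    have Sset: "{b \<in> space C. \<forall>j\<in>S'. V (ch j b)} \<in> sets C" if "finite S'" "S' \<subseteq> L" for S'
      using that Vch by (intro sets.sets_Collect_finite_All) auto
    have "measure C {b \<in> space C. \<forall>j\<in>insert i S. V (ch j b)} =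
        measure (distr (C \<Otimes>\<^sub>M C) C \<Phi>) {b \<in> space C. \<forall>j\<in>insert i S. V (ch j b)}"
      by (simp only: d\<Phi>)
    also have "\<dots> = measure (C \<Otimes>\<^sub>M C) (\<Phi> -` {b \<in> space C. \<forall>j\<in>insert i S. V (ch j b)} \<inter> space (C \<Otimes>\<^sub>M C))"
      by (rule measure_distr[OF m\<Phi>]) (use Sset[of "insert i S"] fS SL iL in auto)
    also have "\<Phi> -` {b \<in> space C. \<forall>j\<in>insert i S. V (ch j b)} \<inter> space (C \<Otimes>\<^sub>M C) =
        {b \<in> space C. \<forall>j\<in>S. V (ch j b)} \<times> {b \<in> space C. V b}"
      using sp\<Phi> by (auto simp: space_pair_measure chi chj)
    also have "measure (C \<Otimes>\<^sub>M C) \<dots> = measure C {b \<in> space C. \<forall>j\<in>S. V (ch j b)} * measure C {b \<in> space C. V b}"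
      by (rule prob_coin_Times) (use Sset[of S] fS SL in auto)
    finally show ?case using insert VP by simp
  qed
  have "measure P {\<omega> \<in> space P. \<forall>j\<in>S. R (sub [j] \<omega>)} = measure C {b \<in> space C. \<forall>j\<in>S. R (sub [j] (g b))}"
  proof (rule transfer, rule pred_intros_finite)
    show "finite S" using finite_subset[OF S fin] .
    show "Measurable.pred \<A> (\<lambda>\<omega>. R (sub [j] \<omega>))" if "j \<in> S" for j
      using that S by (intro measurable_compose[OF measurable_subtree R]) (auto simp: singleton_word)
  qed
  also have "{b \<in> space C. \<forall>j\<in>S. R (sub [j] (g b))} = {b \<in> space C. \<forall>j\<in>S. V (ch j b)}"
    using RV S by auto
  finally show ?thesis using main[OF S] by (simp add: r_def)
qed

lemma prob_children_fixed_point: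
  assumes R [measurable]: "Measurable.pred \<A> R" and dead: "R (dead m k)"
    and rec: "AE \<omega> in P. R \<omega> \<longleftrightarrow> (\<forall>j\<in>L. R (sub [j] \<omega>))"
  shows "measure P {\<omega> \<in> space P. R \<omega>} = (1 - p + p * measure P {\<omega> \<in> space P. R \<omega>}) ^ (k ^ m)"
proof -
  have "measure P {\<omega> \<in> space P. R \<omega>} = measure P {\<omega> \<in> space P. \<forall>j\<in>L. R (sub [j] \<omega>)}"
  proof (rule measure_eq_AE)
    have "Measurable.pred \<A> (\<lambda>\<omega>. \<forall>j\<in>L. R (sub [j] \<omega>))"
      by (rule pred_intros_finite, simp add: letters_def)
         (intro measurable_compose[OF measurable_subtree R], simp add: singleton_word)
    then show "{\<omega> \<in> space P. \<forall>j\<in>L. R (sub [j] \<omega>)} \<in> sets P" by (simp add: pred_def)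
    show "AE \<omega> in P. \<omega> \<in> {\<omega> \<in> space P. R \<omega>} \<longleftrightarrow> \<omega> \<in> {\<omega> \<in> space P. \<forall>j\<in>L. R (sub [j] \<omega>)}"
      using rec by eventually_elim auto
  qed measurable
  also have "\<dots> = (1 - p + p * measure P {\<omega> \<in> space P. R \<omega>}) ^ card L"
    by (rule prob_all_children[OF R dead subset_refl])
  also have "card L = k ^ m" by (simp add: letters_def)
  finally show ?thesis .
qed

lemma normed_generation_children:
  "normed_generation (Suc n) \<omega> = (\<Sum>j\<in>L. normed_generation n (sub [j] \<omega>)) / M"
  by (simp add: normed_generation_def generation_Suc_first flip: sum_divide_distrib)

lemma X_children:
  assumes "\<forall>j\<in>L. convergent (\<lambda>n. normed_generation n (sub [j] \<omega>))"
  shows "X \<omega> = (\<Sum>j\<in>L. X (sub [j] \<omega>)) / M"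
proof -
  have "(\<lambda>n. normed_generation (Suc n) \<omega>) \<longlonglongrightarrow> (\<Sum>j\<in>L. X (sub [j] \<omega>)) / M"
    unfolding normed_generation_children[of _ \<omega>]
  proof (intro tendsto_divide tendsto_sum tendsto_const)
    show "(\<lambda>n. normed_generation n (sub [j] \<omega>)) \<longlonglongrightarrow> X (sub [j] \<omega>)" if "j \<in> L" for j
      using assms that unfolding X_def convergent_LIMSEQ_iff by blast
  qed (use M_gt_1 in simp)
  then have "(\<lambda>n. normed_generation n \<omega>) \<longlonglongrightarrow> (\<Sum>j\<in>L. X (sub [j] \<omega>)) / M"
    by (rule LIMSEQ_imp_Suc)
  then show ?thesis unfolding X_def by (rule limI)
qed

lemma AE_all_words: "(\<And>\<sigma>. \<sigma> \<in> W \<Longrightarrow> AE \<omega> in P. R \<sigma> \<omega>) \<Longrightarrow> AE \<omega> in P. \<forall>\<sigma>\<in>W. R \<sigma> \<omega>"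
  by (subst AE_ball_countable) auto

lemma AE_convergent_subtrees:
  "AE \<omega> in P. \<forall>\<sigma>\<in>W. convergent (\<lambda>n. normed_generation n (sub \<sigma> \<omega>))"
  by (intro AE_all_words AE_subtree martingale_convergence)
     (auto simp: normed_generation_def convergent_const)

lemma measurable_extinct [measurable]: "Measurable.pred \<A> (extinct m k)"
  unfolding extinct_def[abs_def] by measurable

text \<open>
  Both \<open>X = 0\<close> and extinction happen if and only if they happen for the subtrees at all children, so
  their probabilities satisfy the same fixed point equation.  Neither of them is \<open>1\<close>, because \<open>X\<close>
  has mean \<open>1\<close>; thus they agree, and extinction implies \<open>X = 0\<close>.
\<close>

lemma AE_extinct_if_limit_zero: "AE \<omega> in P. X \<omega> = 0 \<longrightarrow> extinct m k \<omega>"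
proof -
  define q e where "q = measure P {\<omega> \<in> space P. X \<omega> = 0}"
    and "e = measure P {\<omega> \<in> space P. extinct m k \<omega>}"
  have X0 [measurable]: "Measurable.pred \<A> (\<lambda>\<omega>. X \<omega> = 0)" by measurable
  have q: "q = (1 - p + p * q) ^ (k ^ m)"
    unfolding q_def
  proof (rule prob_children_fixed_point[OF X0])
    show "AE \<omega> in P. X \<omega> = 0 \<longleftrightarrow> (\<forall>j\<in>L. X (sub [j] \<omega>) = 0)"
      using AE_convergent_subtrees
    proof eventually_elim
      case (elim \<omega>)
      then have c: "\<forall>j\<in>L. convergent (\<lambda>n. normed_generation n (sub [j] \<omega>))"
        by (auto simp: singleton_word)
      have "X \<omega> = 0 \<longleftrightarrow> (\<Sum>j\<in>L. X (sub [j] \<omega>)) = 0"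
        using M_gt_1 by (subst X_children[OF c]) simp
      also have "\<dots> \<longleftrightarrow> (\<forall>j\<in>L. X (sub [j] \<omega>) = 0)"
        by (rule sum_nonneg_eq_0_iff) (use c in \<open>simp_all add: letters_def X_nonneg\<close>)
      finally show ?case .
    qed
  qed simp
  have e: "e = (1 - p + p * e) ^ (k ^ m)"
    unfolding e_def
  proof (rule prob_children_fixed_point)
    show "AE \<omega> in P. extinct m k \<omega> \<longleftrightarrow> (\<forall>j\<in>L. extinct m k (sub [j] \<omega>))"
      using AE_hereditary
    proof eventually_elim
      case (elim \<omega>)
      then show ?case by (intro extinct_children) simp
    qed
  qed (simp_all add: extinct_dead)
  have ext0: "AE \<omega> in P. extinct m k \<omega> \<longrightarrow> X \<omega> = 0"
    using AE_hereditary
  proof eventually_elim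
    case (elim \<omega>)
    show ?case
    proof
      assume "extinct m k \<omega>"
      then obtain n where "generation m k n \<omega> = 0" by (auto simp: extinct_def)
      then have "\<forall>i\<ge>n. normed_generation i \<omega> = 0"
        using elim by (simp add: normed_generation_def generation_zero_mono)
      then have "(\<lambda>n. normed_generation n \<omega>) \<longlonglongrightarrow> 0"
        by (intro tendsto_eventually) (auto simp: eventually_sequentially)
      then show "X \<omega> = 0" unfolding X_def by (rule limI)
    qed
  qed
  have "e \<le> q" unfolding e_def q_def
  proof (rule P.finite_measure_mono_AE)
    show "AE \<omega> in P. \<omega> \<in> {\<omega> \<in> space P. extinct m k \<omega>} \<longrightarrow> \<omega> \<in> {\<omega> \<in> space P. X \<omega> = 0}"
      using ext0 by eventually_elim auto
  qed measurable
  have "q \<noteq> 1"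
  proof
    assume "q = 1"
    then have "AE \<omega> in P. \<omega> \<in> {\<omega> \<in> space P. X \<omega> = 0}"
      unfolding q_def by (subst P.AE_in_set_eq_1) measurable
    then have "AE \<omega> in P. X \<omega> = 0" by eventually_elim simp
    then have "(\<integral>\<omega>. X \<omega> \<partial>P) = (\<integral>\<omega>. 0 \<partial>P)" by (intro integral_cong_AE) simp_all
    then show False using expectation_X by simp
  qed
  moreover have "q \<le> 1" unfolding q_def by simp
  ultimately have "e = q"
    using p_pos p_le letters_ge_2 \<open>e \<le> q\<close>
    by (intro branching_fixed_point_unique[OF _ _ _ _ _ _ e q]) (simp_all add: e_def)
  have "{\<omega> \<in> space P. X \<omega> = 0 \<and> \<not> extinct m k \<omega>} =
      {\<omega> \<in> space P. X \<omega> = 0} - {\<omega> \<in> space P. X \<omega> = 0 \<and> extinct m k \<omega>}"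
    by auto
  then have "measure P {\<omega> \<in> space P. X \<omega> = 0 \<and> \<not> extinct m k \<omega>} =
      measure P ({\<omega> \<in> space P. X \<omega> = 0} - {\<omega> \<in> space P. X \<omega> = 0 \<and> extinct m k \<omega>})"
    by (rule arg_cong)
  also have "\<dots> = q - measure P {\<omega> \<in> space P. X \<omega> = 0 \<and> extinct m k \<omega>}"
    unfolding q_def by (rule P.finite_measure_Diff) auto
  also have "measure P {\<omega> \<in> space P. X \<omega> = 0 \<and> extinct m k \<omega>} = e"
    unfolding e_def
  proof (rule measure_eq_AE)
    show "AE \<omega> in P. \<omega> \<in> {\<omega> \<in> space P. X \<omega> = 0 \<and> extinct m k \<omega>} \<longleftrightarrow> \<omega> \<in> {\<omega> \<in> space P. extinct m k \<omega>}"
      using ext0 by eventually_elim auto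
  qed measurable
  finally have "measure P {\<omega> \<in> space P. X \<omega> = 0 \<and> \<not> extinct m k \<omega>} = 0"
    by (simp only: \<open>e = q\<close> diff_self)
  then have "AE \<omega> in P. \<omega> \<notin> {\<omega> \<in> space P. X \<omega> = 0 \<and> \<not> extinct m k \<omega>}"
    by (subst (asm) P.prob_eq_0) auto
  then show ?thesis using AE_space by eventually_elim auto
qed

text \<open>
  The properties of a configuration that hold almost surely and from which the later arguments are
  deterministic.
\<close>

definition regular :: "(nat list \<Rightarrow> bool) \<Rightarrow> bool" where
  "regular \<omega> \<longleftrightarrow> hereditary m k \<omega> \<and> (\<forall>\<sigma>\<in>W. convergent (\<lambda>n. normed_generation n (sub \<sigma> \<omega>))) \<and>
     (\<forall>\<sigma>\<in>W. X (sub \<sigma> \<omega>) = 0 \<longrightarrow> extinct m k (sub \<sigma> \<omega>))"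

lemma AE_regular: "AE \<omega> in P. regular \<omega>"
proof -
  have "AE \<omega> in P. \<forall>\<sigma>\<in>W. X (sub \<sigma> \<omega>) = 0 \<longrightarrow> extinct m k (sub \<sigma> \<omega>)"
    by (intro AE_all_words AE_subtree AE_extinct_if_limit_zero) (auto simp: extinct_dead)
  with AE_convergent_subtrees AE_hereditary show ?thesis
    by eventually_elim (simp add: regular_def)
qed

lemma regular_X_nonneg: "regular \<omega> \<Longrightarrow> \<sigma> \<in> W \<Longrightarrow> 0 \<le> X (sub \<sigma> \<omega>)"
  by (rule X_nonneg) (simp add: regular_def)

lemma regular_X_children:
  assumes "regular \<omega>" "\<sigma> \<in> W"
  shows "X (sub \<sigma> \<omega>) = (\<Sum>j\<in>L. X (sub (\<sigma> @ [j]) \<omega>)) / M"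
proof -
  have "X (sub \<sigma> \<omega>) = (\<Sum>j\<in>L. X (sub [j] (sub \<sigma> \<omega>))) / M"
    using assms by (intro X_children) (auto simp: regular_def subtree_subtree singleton_word append_in_words)
  also have "(\<Sum>j\<in>L. X (sub [j] (sub \<sigma> \<omega>))) = (\<Sum>j\<in>L. X (sub (\<sigma> @ [j]) \<omega>))"
    by (intro sum.cong) (auto simp: subtree_subtree singleton_word)
  finally show ?thesis .
qed

lemma powr_perc_dim: "real k powr (- real n * perc_dim m k p) = 1 / M ^ n"
proof -
  have "real k powr perc_dim m k p = M"
    using k2 M_gt_1 unfolding perc_dim_def M_def[symmetric] by (simp add: powr_def)
  then have "real k powr (real n * perc_dim m k p) = M ^ n"
    using M_gt_1 by (metis mult.commute powr_powr powr_realpow zero_less_one less_trans)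
  then show ?thesis by (simp add: powr_minus_divide)
qed

lemma martingale_limit_eq:
  assumes "\<sigma> \<in> W" shows "martingale_limit m k p \<omega> \<sigma> = X (sub \<sigma> \<omega>)"
  unfolding martingale_limit_def X_def powr_perc_dim normed_generation_def
  by (simp add: num_chosen_subtree[OF assms])

end

section \<open>Measures on codes\<close>

lemma partition_of_interval:
  fixes c :: "nat \<Rightarrow> real"
  assumes c: "\<And>j. j \<in> {1..K} \<Longrightarrow> 0 \<le> c j" and t: "a \<le> t" "t < a + (\<Sum>j\<in>{1..K}. c j)"
  shows "\<exists>!j. j \<in> {1..K} \<and> t \<in> {a + (\<Sum>i\<in>{1..<j}. c i) ..< a + (\<Sum>i\<in>{1..<j}. c i) + c j}"
proof -
  define S where "S j = a + (\<Sum>i\<in>{1..<j}. c i)" for j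
  have S_Suc: "S (Suc j) = S j + c j" if "j \<ge> 1" for j
    using that by (simp add: S_def)
  have mono: "S i \<le> S j" if "i \<le> j" "j \<le> Suc K" for i j
    unfolding S_def using that c by (intro add_left_mono sum_mono2) auto
  have ex: "\<exists>j\<in>{1..n}. S j \<le> t \<and> t < S (Suc j)" if "t < S (Suc n)" for n
    using that
  proof (induction n)
    case 0
    then show ?case using t(1) by (simp add: S_def)
  next
    case (Suc n)
    show ?case
    proof (cases "t < S (Suc n)")
      case True
      then obtain j where "j \<in> {1..n}" "S j \<le> t \<and> t < S (Suc j)" using Suc.IH by blast
      then show ?thesis by (intro bexI[of _ j]) simp_all
    next
      case False
      then show ?thesis using Suc.prems by (intro bexI[of _ "Suc n"]) simp_all
    qed
  qed
  have "{1..<Suc K} = {1..K}" by auto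
  then have "t < S (Suc K)" using t(2) by (simp only: S_def)
  from ex[OF this] obtain j where j: "j \<in> {1..K}" "S j \<le> t" "t < S (Suc j)" by blast
  have uniq: "i = j" if "i \<in> {1..K}" "S i \<le> t" "t < S (Suc i)" for i
  proof (rule ccontr)
    assume "i \<noteq> j"
    then consider "Suc i \<le> j" | "Suc j \<le> i" by linarith
    then show False
    proof cases
      case 1
      then have "S (Suc i) \<le> S j" using j(1) by (intro mono) simp_all
      then show False using that j by linarith
    next
      case 2
      then have "S (Suc j) \<le> S i" using that(1) by (intro mono) simp_all
      then show False using that j by linarith
    qed
  qed
  have *: "t \<in> {a + (\<Sum>i\<in>{1..<i}. c i) ..< a + (\<Sum>i\<in>{1..<i}. c i) + c i} \<longleftrightarrow> S i \<le> t \<and> t < S (Suc i)"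
    if "i \<in> {1..K}" for i
    using that S_Suc[of i] by (simp add: S_def add.assoc)
  show ?thesis
  proof (rule ex1I[of _ j])
    show "j \<in> {1..K} \<and> t \<in> {a + (\<Sum>i\<in>{1..<j}. c i) ..< a + (\<Sum>i\<in>{1..<j}. c i) + c j}"
      using j *[OF j(1)] by (simp only: simp_thms)
  next
    fix i assume "i \<in> {1..K} \<and> t \<in> {a + (\<Sum>i\<in>{1..<i}. c i) ..< a + (\<Sum>i\<in>{1..<i}. c i) + c i}"
    then have "i \<in> {1..K}" "S i \<le> t \<and> t < S (Suc i)" using *[of i] by (simp_all only: simp_thms)
    then show "i = j" using uniq[of i] by (simp only: simp_thms)
  qed
qed

lemma space_code: "space (code_algebra m k) = codes m k"
  by (simp add: code_algebra_def space_PiM codes_def)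

lemma length_code_prefix [simp]: "length (code_prefix \<eta> n) = n"
  by (simp add: code_prefix_def)

lemma code_prefix_Suc: "code_prefix \<eta> (Suc n) = code_prefix \<eta> n @ [\<eta> n]"
  by (simp add: code_prefix_def)

lemma code_prefix_nth: "i < n \<Longrightarrow> code_prefix \<eta> n ! i = \<eta> i"
  by (simp add: code_prefix_def)

lemma code_prefix_0 [simp]: "code_prefix \<eta> 0 = []"
  by (simp add: code_prefix_def)

lemma code_prefix_word: "\<eta> \<in> codes m k \<Longrightarrow> code_prefix \<eta> n \<in> words m k"
  by (auto simp: codes_def code_prefix_def words_def PiE_iff)

lemma code_prefix_level: "\<eta> \<in> codes m k \<Longrightarrow> code_prefix \<eta> n \<in> level m k n"
  by (simp add: code_prefix_word)

lemma cylinder_Nil: "cylinder m k [] = codes m k"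
  by (auto simp: cylinder_def)

lemma measurable_code_coordinate: "(\<lambda>\<eta>. \<eta> i) \<in> measurable (code_algebra m k) (count_space (letters m k))"
  unfolding code_algebra_def by (rule measurable_component_singleton) simp

lemma cylinder_sets [measurable, simp]:
  "cylinder m k \<sigma> \<in> sets (code_algebra m k)"
proof -
  have [measurable]: "Measurable.pred (code_algebra m k) (\<lambda>\<eta>. \<eta> i = a)" for i a
    using measurable_code_coordinate[of i m k]
    by (rule measurable_compose) simp
  have "cylinder m k \<sigma> = {\<eta> \<in> space (code_algebra m k). \<forall>i<length \<sigma>. \<eta> i = \<sigma> ! i}"
  proof -
    have "code_prefix \<eta> (length \<sigma>) = \<sigma> \<longleftrightarrow> (\<forall>i<length \<sigma>. \<eta> i = \<sigma> ! i)" for \<eta>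
      unfolding list_eq_iff_nth_eq[of "code_prefix \<eta> (length \<sigma>)" \<sigma>] by (simp add: code_prefix_nth)
    then show ?thesis by (simp add: cylinder_def space_code)
  qed
  also have "\<dots> \<in> sets (code_algebra m k)" by measurable
  finally show ?thesis .
qed

lemma code_algebra_generated:
  "sets (code_algebra m k) = sigma_sets (codes m k) (cylinder m k ` words m k)"
proof
  let ?S = "sigma_sets (codes m k) (cylinder m k ` words m k)"
  show "?S \<subseteq> sets (code_algebra m k)"
    unfolding space_code[symmetric] by (rule sets.sigma_sets_subset) auto
  have coord: "{\<eta> \<in> codes m k. \<eta> i \<in> A} \<in> ?S" for i A
  proof -
    have "{\<eta> \<in> codes m k. \<eta> i \<in> A} = (\<Union>\<sigma>\<in>{\<sigma> \<in> level m k (Suc i). \<sigma> ! i \<in> A}. cylinder m k \<sigma>)"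
    proof (intro set_eqI iffI)
      fix \<eta> assume "\<eta> \<in> {\<eta> \<in> codes m k. \<eta> i \<in> A}"
      then show "\<eta> \<in> (\<Union>\<sigma>\<in>{\<sigma> \<in> level m k (Suc i). \<sigma> ! i \<in> A}. cylinder m k \<sigma>)"
        by (intro UN_I[of "code_prefix \<eta> (Suc i)"])
           (simp_all add: code_prefix_word cylinder_def code_prefix_nth)
    next
      fix \<eta> assume "\<eta> \<in> (\<Union>\<sigma>\<in>{\<sigma> \<in> level m k (Suc i). \<sigma> ! i \<in> A}. cylinder m k \<sigma>)"
      then obtain \<sigma> where "\<eta> \<in> codes m k" "code_prefix \<eta> (Suc i) = \<sigma>" "\<sigma> ! i \<in> A"
        by (auto simp: cylinder_def)
      then show "\<eta> \<in> {\<eta> \<in> codes m k. \<eta> i \<in> A}" using code_prefix_nth[of i "Suc i" \<eta>] by auto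
    qed
    also have "\<dots> \<in> ?S"
      by (intro sigma_sets_UNION) (auto intro!: countable_finite finite_level finite_subset[OF _ finite_level] sigma_sets.Basic)
    finally show ?thesis .
  qed
  have "sets (code_algebra m k) =
      sigma_sets (codes m k) {{f \<in> codes m k. f i \<in> A} |i A. i \<in> UNIV \<and> A \<in> sets (count_space (letters m k))}"
    unfolding code_algebra_def sets_PiM_single by (simp add: codes_def)
  also have "\<dots> \<subseteq> ?S"
    by (rule sigma_sets_mono) (use coord in auto)
  finally show "sets (code_algebra m k) \<subseteq> ?S" .
qed

lemma cylinder_Int:
  assumes "length \<sigma> \<le> length \<tau>"
  shows "cylinder m k \<sigma> \<inter> cylinder m k \<tau> = (if prefix \<sigma> \<tau> then cylinder m k \<tau> else {})"
proof -
  have *: "code_prefix \<eta> (length \<sigma>) = take (length \<sigma>) (code_prefix \<eta> (length \<tau>))" for \<eta>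
    using assms by (intro nth_equalityI) (simp_all add: code_prefix_nth)
  have pre: "prefix \<sigma> \<tau> \<longleftrightarrow> take (length \<sigma>) \<tau> = \<sigma>"
  proof
    assume "take (length \<sigma>) \<tau> = \<sigma>"
    then show "prefix \<sigma> \<tau>" using take_is_prefix[of "length \<sigma>" \<tau>] by (simp only:)
  next
    assume "prefix \<sigma> \<tau>"
    then obtain \<upsilon> where "\<tau> = \<sigma> @ \<upsilon>" by (rule prefixE)
    then show "take (length \<sigma>) \<tau> = \<sigma>" by simp
  qed
  have "\<eta> \<in> cylinder m k \<sigma> \<longleftrightarrow> prefix \<sigma> \<tau>" if "\<eta> \<in> cylinder m k \<tau>" for \<eta>
  proof -
    have t: "\<eta> \<in> codes m k" "code_prefix \<eta> (length \<tau>) = \<tau>" using that by (simp_all add: cylinder_def)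
    have "code_prefix \<eta> (length \<sigma>) = take (length \<sigma>) \<tau>" using *[of \<eta>] unfolding t(2) .
    then show ?thesis using t(1) unfolding pre cylinder_def mem_Collect_eq by (simp only: simp_thms)
  qed
  then have "cylinder m k \<sigma> \<inter> cylinder m k \<tau> = {\<eta> \<in> cylinder m k \<tau>. prefix \<sigma> \<tau>}"
    by blast
  then show ?thesis by simp
qed

lemma Int_stable_cylinders: "Int_stable (insert {} (cylinder m k ` words m k))"
proof (rule Int_stableI)
  fix A B assume "A \<in> insert {} (cylinder m k ` words m k)" "B \<in> insert {} (cylinder m k ` words m k)"
  then consider "A = {} \<or> B = {}" | \<sigma> \<tau> where "\<sigma> \<in> words m k" "\<tau> \<in> words m k" "A = cylinder m k \<sigma>" "B = cylinder m k \<tau>"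
    by auto
  then show "A \<inter> B \<in> insert {} (cylinder m k ` words m k)"
  proof cases
    case 2
    have *: "cylinder m k \<sigma> \<inter> cylinder m k \<tau> \<in> insert {} (cylinder m k ` words m k)"
      if "length \<sigma> \<le> length \<tau>" "\<tau> \<in> words m k" for \<sigma> \<tau>
      unfolding cylinder_Int[OF that(1)] using that(2) by simp
    show ?thesis
    proof (cases "length \<sigma> \<le> length \<tau>")
      case True
      then show ?thesis using *[of \<sigma> \<tau>] 2 by simp
    next
      case False
      then show ?thesis using *[of \<tau> \<sigma>] 2 by (simp add: Int_commute)
    qed
  qed auto
qed

lemma code_measure_unique:
  assumes "sets M = sets (code_algebra m k)" "sets N = sets (code_algebra m k)"
    and "\<And>\<sigma>. \<sigma> \<in> words m k \<Longrightarrow> emeasure M (cylinder m k \<sigma>) = emeasure N (cylinder m k \<sigma>)"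
    and "emeasure M (codes m k) \<noteq> \<infinity>"
  shows "M = N"
proof (rule measure_eqI_generator_eq[OF Int_stable_cylinders, where \<Omega> = "codes m k"])
  have "sigma_sets (codes m k) (insert {} (cylinder m k ` words m k)) = sets (code_algebra m k)"
    unfolding code_algebra_generated
    by (intro antisym sigma_sets_mono subsetI) (auto intro: sigma_sets.Empty sigma_sets.Basic)
  then show "sets M = sigma_sets (codes m k) (insert {} (cylinder m k ` words m k))"
    "sets N = sigma_sets (codes m k) (insert {} (cylinder m k ` words m k))"
    using assms(1,2) by auto
  show "range (\<lambda>_::nat. codes m k) \<subseteq> insert {} (cylinder m k ` words m k)"
    using cylinder_Nil by (auto intro!: image_eqI[of _ _ "[]"])
qed (use assms(3,4) in \<open>auto simp: cylinder_def\<close>)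

text \<open>
  Cut an interval of length \<open>c []\<close> into consecutive half-open intervals of lengths \<open>c [j]\<close>, cut each
  of those in the proportions of the next letters, and so on.  Every point \<open>t\<close> of the first
  interval gets a code \<open>F t\<close>, and the image of Lebesgue measure under \<open>F\<close> gives the
  cylinder of \<open>\<sigma>\<close> the length \<open>c \<sigma>\<close> of its interval.
\<close>

lemma code_measure_exists:
  fixes c :: "nat list \<Rightarrow> real"
  assumes nonneg: "\<And>\<sigma>. \<sigma> \<in> words m k \<Longrightarrow> 0 \<le> c \<sigma>"
    and additive: "\<And>\<sigma>. \<sigma> \<in> words m k \<Longrightarrow> c \<sigma> = (\<Sum>j\<in>letters m k. c (\<sigma> @ [j]))"
  shows "\<exists>M. sets M = sets (code_algebra m k) \<and>
    (\<forall>\<sigma>\<in>words m k. emeasure M (cylinder m k \<sigma>) = ennreal (c \<sigma>))"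
proof -
  \<comment> \<open>left end point of the interval of \<open>\<sigma>\<close>: the lengths of all intervals to the left that split off at some prefix of \<open>\<sigma>\<close>\<close>
  define lo where "lo \<sigma> = (\<Sum>l<length \<sigma>. \<Sum>i\<in>{1..<\<sigma> ! l}. c (take l \<sigma> @ [i]))" for \<sigma>
  define I where "I \<sigma> = {lo \<sigma> ..< lo \<sigma> + c \<sigma>}" for \<sigma>
  define next_letter where "next_letter t \<sigma> = (THE j. j \<in> letters m k \<and> t \<in> I (\<sigma> @ [j]))" for t \<sigma>
  define w where "w t = rec_nat [] (\<lambda>_ \<sigma>. \<sigma> @ [next_letter t \<sigma>])" for t
  define F where "F t i = next_letter t (w t i)" for t i
  have snoc: "\<sigma> @ [j] \<in> words m k \<longleftrightarrow> \<sigma> \<in> words m k \<and> j \<in> letters m k" for \<sigma> j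
    by (auto simp: words_def)
  have lo_snoc: "lo (\<sigma> @ [j]) = lo \<sigma> + (\<Sum>i\<in>{1..<j}. c (\<sigma> @ [i]))" for \<sigma> j
    by (simp add: lo_def nth_append)
  have step: "\<exists>!j. j \<in> letters m k \<and> t \<in> I (\<sigma> @ [j])" if s: "\<sigma> \<in> words m k" and t: "t \<in> I \<sigma>" for t \<sigma>
    unfolding I_def lo_snoc letters_def
    using t additive[OF s] nonneg s unfolding I_def
    by (intro partition_of_interval) (auto simp: snoc letters_def)
  have parent: "t \<in> I \<sigma>" if s: "\<sigma> \<in> words m k" and j: "j \<in> letters m k" and t: "t \<in> I (\<sigma> @ [j])" for t \<sigma> j
  proof -
    have "(\<Sum>i\<in>{1..<j}. c (\<sigma> @ [i])) + c (\<sigma> @ [j]) = (\<Sum>i\<in>{1..j}. c (\<sigma> @ [i]))"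
      using j by (simp add: letters_def flip: atLeastLessThanSuc_atLeastAtMost)
    also have "\<dots> \<le> (\<Sum>i\<in>letters m k. c (\<sigma> @ [i]))"
      using j s by (intro sum_mono2 nonneg) (auto simp: letters_def snoc)
    finally have "(\<Sum>i\<in>{1..<j}. c (\<sigma> @ [i])) + c (\<sigma> @ [j]) \<le> c \<sigma>" using additive[OF s] by simp
    moreover have "0 \<le> (\<Sum>i\<in>{1..<j}. c (\<sigma> @ [i]))"
      using j s by (intro sum_nonneg nonneg) (auto simp: letters_def snoc)
    ultimately show ?thesis using t by (auto simp: I_def lo_snoc)
  qed
  have w_Suc: "w t (Suc n) = w t n @ [F t n]" for t n by (simp add: w_def F_def)
  have w_0: "w t 0 = []" for t by (simp add: w_def)
  have w_in: "w t n \<in> level m k n \<and> t \<in> I (w t n)" if t: "t \<in> I []" for t n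
  proof (induction n)
    case (Suc n)
    then have "\<exists>!j. j \<in> letters m k \<and> t \<in> I (w t n @ [j])" using step by auto
    from theI'[OF this] have "F t n \<in> letters m k \<and> t \<in> I (w t n @ [F t n])"
      unfolding F_def next_letter_def .
    then show ?case using Suc by (auto simp: w_Suc snoc)
  qed (use t in \<open>simp add: w_0\<close>)
  have F_in: "F t n \<in> letters m k" if "t \<in> I []" for t n
    using w_in[OF that, of "Suc n"] by (simp add: w_Suc snoc)
  have w_unique: "t \<in> I [] \<and> w t (length \<sigma>) = \<sigma>" if "\<sigma> \<in> words m k" "t \<in> I \<sigma>" for t \<sigma>
    using that
  proof (induction \<sigma> rule: rev_induct)
    case (snoc j \<sigma>)
    then have s: "\<sigma> \<in> words m k" "j \<in> letters m k" by (auto simp: words_def)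
    have t: "t \<in> I \<sigma>" using parent s snoc.prems by blast
    then have IH: "t \<in> I []" "w t (length \<sigma>) = \<sigma>" using snoc.IH s by auto
    have "F t (length \<sigma>) = j"
      unfolding F_def IH next_letter_def
      by (rule the1_equality[OF step[OF s(1) t]]) (use s snoc.prems in auto)
    then show ?case using IH by (simp add: w_Suc)
  qed (simp add: w_0)
  have pre: "code_prefix (F t) n = w t n" for t n
    by (induction n) (auto simp: code_prefix_Suc w_Suc w_0)
  define N where "N = restrict_space lborel (I [])"
  have I_meas: "I \<sigma> \<in> sets borel" for \<sigma> by (simp add: I_def)
  have I_sub: "I \<sigma> \<subseteq> I []" if "\<sigma> \<in> words m k" for \<sigma> using w_unique[OF that] by blast
  have spN: "space N = I []" by (simp add: N_def space_restrict_space)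
  have I_N: "I \<sigma> \<in> sets N" if "\<sigma> \<in> words m k" for \<sigma>
    using I_sub[OF that] I_meas by (auto simp: N_def sets_restrict_space)
  have F_meas: "F \<in> measurable N (code_algebra m k)"
    unfolding code_algebra_def
  proof (rule measurable_PiM_single')
    show "F \<in> space N \<rightarrow> UNIV \<rightarrow>\<^sub>E space (count_space (letters m k))"
      using F_in by (auto simp: spN)
    fix i :: nat
    show "(\<lambda>t. F t i) \<in> measurable N (count_space (letters m k))"
    proof (rule measurable_count_space_eq2_countable[THEN iffD2], safe)
      fix a assume a: "a \<in> letters m k"
      have "(\<lambda>t. F t i) -` {a} \<inter> space N = (\<Union>\<sigma>\<in>level m k i. I (\<sigma> @ [a]))"
      proof (intro set_eqI iffI)
        fix t assume "t \<in> (\<lambda>t. F t i) -` {a} \<inter> space N"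
        then have "t \<in> I []" "F t i = a" by (auto simp: spN)
        then show "t \<in> (\<Union>\<sigma>\<in>level m k i. I (\<sigma> @ [a]))"
          using w_in[of t i] w_in[of t "Suc i"] by (auto simp: w_Suc intro!: bexI[of _ "w t i"])
      next
        fix t assume "t \<in> (\<Union>\<sigma>\<in>level m k i. I (\<sigma> @ [a]))"
        then obtain \<sigma> where s: "\<sigma> \<in> level m k i" "t \<in> I (\<sigma> @ [a])" by auto
        then have "t \<in> I [] \<and> w t (Suc i) = \<sigma> @ [a]"
          using w_unique[of "\<sigma> @ [a]" t] a by (simp add: snoc)
        then show "t \<in> (\<lambda>t. F t i) -` {a} \<inter> space N" by (simp add: w_Suc spN)
      qed
      also have "\<dots> \<in> sets N" using a by (intro sets.finite_UN finite_level I_N) (simp add: snoc)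
      finally show "(\<lambda>t. F t i) -` {a} \<inter> space N \<in> sets N" .
    qed (use F_in in \<open>auto simp: spN letters_def\<close>)
  qed
  show ?thesis
  proof (intro exI conjI ballI)
    show "sets (distr N (code_algebra m k) F) = sets (code_algebra m k)" by simp
    fix \<sigma> assume s: "\<sigma> \<in> words m k"
    have "F -` cylinder m k \<sigma> \<inter> space N = I \<sigma>"
    proof (intro set_eqI iffI)
      fix t assume "t \<in> F -` cylinder m k \<sigma> \<inter> space N"
      then have "t \<in> I []" "w t (length \<sigma>) = \<sigma>" by (auto simp: cylinder_def pre spN)
      then show "t \<in> I \<sigma>" using w_in[of t "length \<sigma>"] by simp
    next
      fix t assume "t \<in> I \<sigma>"
      then have "t \<in> I []" "w t (length \<sigma>) = \<sigma>" using w_unique s by auto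
      then show "t \<in> F -` cylinder m k \<sigma> \<inter> space N"
        using F_in by (auto simp: cylinder_def pre spN codes_def)
    qed
    then have "emeasure (distr N (code_algebra m k) F) (cylinder m k \<sigma>) = emeasure N (I \<sigma>)"
      by (subst emeasure_distr[OF F_meas]) auto
    also have "\<dots> = emeasure lborel (I \<sigma>)"
      unfolding N_def using I_meas I_sub[OF s] by (intro emeasure_restrict_space) auto
    also have "\<dots> = ennreal (c \<sigma>)" using nonneg[OF s] by (simp add: I_def)
    finally show "emeasure (distr N (code_algebra m k) F) (cylinder m k \<sigma>) = ennreal (c \<sigma>)" .
  qed
qed

section \<open>Birkhoff's theorem for ergodic systems\<close>

locale ergodic_system = prob_space M for M :: "'a measure" +
  fixes T :: "'a \<Rightarrow> 'a"
  assumes T_measurable [measurable]: "T \<in> measurable M M"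
    and T_preserves: "distr M M T = M"
    and ergodic: "\<And>A. A \<in> sets M \<Longrightarrow> T -` A \<inter> space M = A \<Longrightarrow> prob A = 0 \<or> prob A = 1"
begin

lemma iterate_measurable [measurable]: "(T ^^ n) \<in> measurable M M"
  by (induction n) (auto intro: measurable_comp[OF _ T_measurable])

lemma iterate_space: "x \<in> space M \<Longrightarrow> (T ^^ n) x \<in> space M"
  using measurable_space[OF iterate_measurable] .

lemma iterate_preserves: "distr M M (T ^^ n) = M"
proof (induction n)
  case 0
  then show ?case by (simp add: distr_id id_def)
next
  case (Suc n)
  have "distr M M (T ^^ Suc n) = distr (distr M M (T ^^ n)) M T"
    by (subst distr_distr) simp_all
  then show ?case by (simp only: Suc T_preserves)
qed

lemma integral_iterate:
  fixes f :: "'a \<Rightarrow> real"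
  assumes [measurable]: "f \<in> borel_measurable M"
  shows "(\<integral>x. f ((T ^^ n) x) \<partial>M) = (\<integral>x. f x \<partial>M)"
proof -
  have "(\<integral>x. f x \<partial>M) = (\<integral>x. f x \<partial>distr M M (T ^^ n))" by (simp only: iterate_preserves)
  also have "\<dots> = (\<integral>x. f ((T ^^ n) x) \<partial>M)" by (rule integral_distr) measurable
  finally show ?thesis ..
qed

definition birkhoff_sum :: "('a \<Rightarrow> real) \<Rightarrow> nat \<Rightarrow> 'a \<Rightarrow> real" where
  "birkhoff_sum f n x = (\<Sum>i<n. f ((T ^^ i) x))"

lemma birkhoff_sum_measurable [measurable]:
  assumes [measurable]: "f \<in> borel_measurable M"
  shows "birkhoff_sum f n \<in> borel_measurable M"
  unfolding birkhoff_sum_def[abs_def] by measurable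

lemma birkhoff_sum_add:
  "birkhoff_sum f (n + l) x = birkhoff_sum f n x + birkhoff_sum f l ((T ^^ n) x)"
proof (induction l)
  case (Suc l)
  have "(T ^^ (n + l)) x = (T ^^ l) ((T ^^ n) x)"
    by (simp add: funpow_add add.commute)
  with Suc show ?case by (simp add: birkhoff_sum_def)
qed (simp add: birkhoff_sum_def)

lemma birkhoff_sum_1 [simp]: "birkhoff_sum f (Suc 0) x = f x"
  by (simp add: birkhoff_sum_def)

lemma birkhoff_sum_bounds:
  assumes "\<And>x. 0 \<le> f x" "\<And>x. f x \<le> 1"
  shows "0 \<le> birkhoff_sum f n x" "birkhoff_sum f n x \<le> real n"
proof -
  show "0 \<le> birkhoff_sum f n x" using assms(1) by (simp add: birkhoff_sum_def sum_nonneg)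
  have "birkhoff_sum f n x \<le> (\<Sum>i<n. 1)" unfolding birkhoff_sum_def by (intro sum_mono assms(2))
  then show "birkhoff_sum f n x \<le> real n" by simp
qed

lemma integral_birkhoff_sum:
  fixes f :: "'a \<Rightarrow> real"
  assumes [measurable]: "f \<in> borel_measurable M" and b: "\<And>x. \<bar>f x\<bar> \<le> B"
  shows "integrable M (birkhoff_sum f n)" "(\<integral>x. birkhoff_sum f n x \<partial>M) = real n * (\<integral>x. f x \<partial>M)"
proof -
  have int: "integrable M (\<lambda>x. f ((T ^^ i) x))" for i
    using b by (intro integrable_const_bound[of _ B]) auto
  show "integrable M (birkhoff_sum f n)"
    unfolding birkhoff_sum_def[abs_def] using int by (intro Bochner_Integration.integrable_sum)
  have "(\<integral>x. birkhoff_sum f n x \<partial>M) = (\<Sum>i<n. \<integral>x. f ((T ^^ i) x) \<partial>M)"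
    unfolding birkhoff_sum_def using int by (intro Bochner_Integration.integral_sum)
  also have "\<dots> = (\<Sum>i<n. \<integral>x. f x \<partial>M)" by (simp only: integral_iterate assms)
  finally show "(\<integral>x. birkhoff_sum f n x \<partial>M) = real n * (\<integral>x. f x \<partial>M)" by simp
qed

text \<open>
  Dropping the first term of an orbit changes an average over \<open>n\<close> steps by at most \<open>1 / (n + 1)\<close>.
\<close>

lemma upper_average_invariant:
  assumes f: "\<And>x. 0 \<le> f x" "\<And>x. f x \<le> 1"
  shows "limsup (\<lambda>n. ereal (birkhoff_sum f n (T x) / real n)) = limsup (\<lambda>n. ereal (birkhoff_sum f n x / real n))"
proof -
  define d where "d n = birkhoff_sum f n (T x) / real n - birkhoff_sum f (Suc n) x / real (Suc n)" for n
  have shift: "birkhoff_sum f (Suc n) x = f x + birkhoff_sum f n (T x)" for n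
    using birkhoff_sum_add[of f "Suc 0" n x] by simp
  have d_eq: "d n = (birkhoff_sum f n (T x) / real n - f x) / real (Suc n)" if "n > 0" for n
    using that unfolding d_def shift by (simp add: field_simps)
  have d_le: "\<bar>d n\<bar> \<le> 1 / real (Suc n)" if "n > 0" for n
  proof -
    have "0 \<le> birkhoff_sum f n (T x) / real n" "birkhoff_sum f n (T x) / real n \<le> 1"
      using birkhoff_sum_bounds[of f n "T x"] f that by simp_all
    then have "\<bar>birkhoff_sum f n (T x) / real n - f x\<bar> \<le> 1" using f[of x] by linarith
    then show ?thesis using d_eq[OF that] by (simp add: abs_divide divide_right_mono)
  qed
  have "(\<lambda>n. 1 / real (Suc n)) \<longlonglongrightarrow> 0" by (rule LIMSEQ_Suc[OF lim_1_over_n])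
  then have "d \<longlonglongrightarrow> 0"
    by (rule Lim_null_comparison[rotated]) (use d_le in \<open>auto intro!: eventually_sequentiallyI[of 1]\<close>)
  then have d0: "(\<lambda>n. ereal (d n)) \<longlonglongrightarrow> 0" by (simp add: zero_ereal_def)
  have "limsup (\<lambda>n. ereal (birkhoff_sum f n (T x) / real n)) =
      limsup (\<lambda>n. ereal (d n) + ereal (birkhoff_sum f (Suc n) x / real (Suc n)))"
    by (simp add: d_def)
  also have "\<dots> = 0 + limsup (\<lambda>n. ereal (birkhoff_sum f (Suc n) x / real (Suc n)))"
    by (rule ereal_limsup_lim_add[OF d0]) simp
  also have "\<dots> = limsup (\<lambda>n. ereal (birkhoff_sum f n x / real n))"
    using limsup_shift[of "\<lambda>n. ereal (birkhoff_sum f n x / real n)"] by simp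
  finally show ?thesis .
qed

text \<open>
  Walk along the orbit.  At a point where some block of length at most \<open>l\<close> has \<open>f\<close>-average at least
  \<open>c\<close> jump over this block, otherwise make one step, which contributes at least \<open>c\<close> to the sum of
  \<open>g\<close>.  Only the last at most \<open>l\<close> steps before time \<open>n\<close> are lost.
\<close>

lemma covering_bound:
  assumes f: "\<And>x. 0 \<le> f x" and g: "\<And>x. f x \<le> g x" and c: "0 \<le> c"
    and good: "\<And>x. x \<in> space M \<Longrightarrow> c \<le> g x \<or> (\<exists>n\<in>{1..l}. c * real n \<le> birkhoff_sum f n x)"
    and x: "x \<in> space M"
  shows "c * (real n - real l) \<le> birkhoff_sum g n x"
  using x
proof (induction n arbitrary: x rule: less_induct)
  case (less n x)
  have g0: "0 \<le> birkhoff_sum g i y" for i y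
    unfolding birkhoff_sum_def using f g by (intro sum_nonneg) (meson order_trans)
  have fg: "birkhoff_sum f i y \<le> birkhoff_sum g i y" for i y
    unfolding birkhoff_sum_def using g by (intro sum_mono)
  show ?case
  proof (cases "n \<le> l")
    case True
    then have "c * (real n - real l) \<le> 0" using c by (simp add: mult_nonneg_nonpos)
    then show ?thesis using g0[of n x] by linarith
  next
    case False
    \<comment> \<open>one step with \<open>g\<close> if \<open>x\<close> is exceptional, otherwise a block on which \<open>f\<close> averages at least \<open>c\<close>\<close>
    obtain i where i: "1 \<le> i" "i \<le> n" "c * real i \<le> birkhoff_sum g i x"
      using good[OF less.prems]
    proof
      assume "c \<le> g x"
      then show thesis using False by (intro that[of 1]) auto
    next
      assume "\<exists>i\<in>{1..l}. c * real i \<le> birkhoff_sum f i x"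
      then obtain i where "i \<in> {1..l}" "c * real i \<le> birkhoff_sum f i x" by blast
      then show thesis using False fg[of i x] by (intro that[of i]) auto
    qed
    have "c * (real (n - i) - real l) \<le> birkhoff_sum g (n - i) ((T ^^ i) x)"
      using i less.prems by (intro less.IH iterate_space) auto
    moreover have "birkhoff_sum g n x = birkhoff_sum g i x + birkhoff_sum g (n - i) ((T ^^ i) x)"
      using birkhoff_sum_add[of g i "n - i" x] i by simp
    ultimately show ?thesis using i by (simp add: of_nat_diff algebra_simps)
  qed
qed

text \<open>
  By ergodicity it has to be excluded that the upper average exceeds \<open>c\<close> almost everywhere.  In that
  case the points without a block of length at most \<open>l\<close> and average at least \<open>c\<close> form a set \<open>E l\<close>
  of small measure.  Integrating the covering bound for \<open>f\<close> increased by \<open>1\<close> on \<open>E l\<close> yields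
  \<open>c (n - l) \<le> n (\<integral>f + prob (E l))\<close>, which fails for large \<open>n\<close>.
\<close>

lemma upper_average_not_above:
  assumes f [measurable]: "f \<in> borel_measurable M" and b: "\<And>x. 0 \<le> f x" "\<And>x. f x \<le> 1"
    and c: "(\<integral>x. f x \<partial>M) < c"
  shows "AE x in M. limsup (\<lambda>n. ereal (birkhoff_sum f n x / real n)) \<le> ereal c"
proof -
  define U where "U x = limsup (\<lambda>n. ereal (birkhoff_sum f n x / real n))" for x
  have [measurable]: "U \<in> borel_measurable M" unfolding U_def[abs_def] by measurable
  define A where "A = {x \<in> space M. ereal c < U x}"
  have A: "A \<in> sets M" unfolding A_def by measurable
  have "T -` A \<inter> space M = A"
    using measurable_space[OF T_measurable] upper_average_invariant[OF b] by (auto simp: A_def U_def)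
  then consider "prob A = 0" | "prob A = 1" using ergodic[OF A] by blast
  then show ?thesis
  proof cases
    case 1
    then have "AE x in M. x \<notin> A" using A by (simp add: prob_eq_0)
    then show ?thesis using AE_space by eventually_elim (auto simp: A_def U_def not_less)
  next
    case 2
    have if_: "0 \<le> (\<integral>x. f x \<partial>M)" using b by (simp add: integral_nonneg)
    then have c0: "0 \<le> c" using c by simp
    have exceeds: "\<exists>n\<ge>1. c * real n \<le> birkhoff_sum f n x" if "x \<in> A" for x
    proof (rule ccontr)
      assume "\<not> ?thesis"
      then have le: "birkhoff_sum f n x < c * real n" if "n \<ge> 1" for n using that by (meson not_le)
      have "U x \<le> ereal c"
        unfolding U_def
      proof (rule Limsup_bounded, rule eventually_sequentiallyI[of 1])
        fix n :: nat assume "1 \<le> n"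
        then show "ereal (birkhoff_sum f n x / real n) \<le> ereal c"
          using le[of n] by (simp add: divide_le_eq)
      qed
      then show False using that leD by (auto simp: A_def)
    qed
    define E where "E l = {x \<in> space M. \<forall>n\<in>{1..l}. birkhoff_sum f n x < c * real n}" for l
    have E [measurable]: "E l \<in> sets M" for l unfolding E_def by measurable
    have "decseq E" unfolding E_def by (intro decseq_SucI) auto
    then have "(\<lambda>l. prob (E l)) \<longlonglongrightarrow> prob (\<Inter>l. E l)"
      by (intro finite_Lim_measure_decseq) auto
    moreover have "prob (\<Inter>l. E l) = 0"
    proof -
      have "(\<Inter>l. E l) \<subseteq> space M - A"
      proof
        fix x assume x: "x \<in> (\<Inter>l. E l)"
        have "x \<notin> A"
        proof
          assume "x \<in> A"
          then obtain n where "n \<ge> 1" "c * real n \<le> birkhoff_sum f n x" using exceeds by blast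
          moreover have "x \<in> E n" using x by blast
          ultimately show False by (auto simp: E_def dest: bspec[of _ _ n])
        qed
        then show "x \<in> space M - A" using x by (auto simp: E_def)
      qed
      then have "prob (\<Inter>l. E l) \<le> prob (space M - A)" using A by (intro finite_measure_mono) auto
      also have "\<dots> = 0" using 2 prob_compl[OF A] by simp
      finally show ?thesis by (simp add: measure_le_0_iff)
    qed
    ultimately have "(\<lambda>l. prob (E l)) \<longlonglongrightarrow> 0" by simp
    then have "eventually (\<lambda>l. prob (E l) < c - (\<integral>x. f x \<partial>M)) sequentially"
      using c by (intro order_tendstoD) auto
    then obtain l where l: "prob (E l) < c - (\<integral>x. f x \<partial>M)"
      by (auto simp: eventually_sequentially)
    define d where "d = c - (\<integral>x. f x \<partial>M) - prob (E l)"
    have d: "d > 0" using l by (simp add: d_def)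
    \<comment> \<open>the averages never exceed 1, so only thresholds up to 1 matter\<close>
    have c1: "c \<le> 1"
    proof -
      have "A \<noteq> {}" using 2 by auto
      then obtain x where "x \<in> A" by blast
      then obtain n where n: "n \<ge> 1" "c * real n \<le> birkhoff_sum f n x" using exceeds by blast
      have "c * real n \<le> real n" using n(2) birkhoff_sum_bounds(2)[OF b] by (rule order_trans)
      then show ?thesis using n(1) by simp
    qed
    define g where "g x = f x + indicator (E l) x" for x
    have [measurable]: "g \<in> borel_measurable M" unfolding g_def[abs_def] by measurable
    have gb: "\<bar>g x\<bar> \<le> 2" for x using b[of x] by (auto simp: g_def indicator_def)
    have fi: "integrable M f" using b by (intro integrable_const_bound[of _ 1]) auto
    have ig: "(\<integral>x. g x \<partial>M) = (\<integral>x. f x \<partial>M) + prob (E l)"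
      unfolding g_def using fi by (subst Bochner_Integration.integral_add) (auto simp: less_top[symmetric])
    have cov: "c * (real n - real l) \<le> birkhoff_sum g n x" if "x \<in> space M" for n x
    proof (rule covering_bound[OF b(1) _ c0 _ that])
      show "f x \<le> g x" for x by (simp add: g_def)
      show "c \<le> g x \<or> (\<exists>n\<in>{1..l}. c * real n \<le> birkhoff_sum f n x)" if "x \<in> space M" for x
      proof (cases "x \<in> E l")
        case True
        then show ?thesis using c1 b(1)[of x] by (simp add: g_def)
      next
        case False
        then show ?thesis using that by (auto simp: E_def not_less)
      qed
    qed
    have bound: "real n * d \<le> c * real l" for n
    proof -
      have "c * (real n - real l) = (\<integral>x. c * (real n - real l) \<partial>M)" by (simp add: prob_space)
      also have "\<dots> \<le> (\<integral>x. birkhoff_sum g n x \<partial>M)"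
        using cov integral_birkhoff_sum(1)[OF _ gb] by (intro integral_mono) auto
      also have "\<dots> = real n * ((\<integral>x. f x \<partial>M) + prob (E l))"
        using integral_birkhoff_sum(2)[OF _ gb] ig by simp
      finally show ?thesis by (simp add: d_def algebra_simps)
    qed
    obtain n where "c * real l < real n * d" using reals_Archimedean3[OF d] by blast
    with bound[of n] have False by simp
    then show ?thesis ..
  qed
qed

lemma upper_average_le:
  assumes f: "f \<in> borel_measurable M" and b: "\<And>x. 0 \<le> f x" "\<And>x. f x \<le> 1"
  shows "AE x in M. limsup (\<lambda>n. ereal (birkhoff_sum f n x / real n)) \<le> ereal (\<integral>x. f x \<partial>M)"
proof -
  have "AE x in M. \<forall>j. limsup (\<lambda>n. ereal (birkhoff_sum f n x / real n)) \<le> ereal ((\<integral>x. f x \<partial>M) + 1 / real (Suc j))"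
    unfolding AE_all_countable by (intro allI upper_average_not_above[OF f b]) simp
  then show ?thesis
  proof eventually_elim
    case (elim x)
    have "(\<lambda>j. ereal ((\<integral>x. f x \<partial>M) + 1 / real (Suc j))) \<longlonglongrightarrow> ereal ((\<integral>x. f x \<partial>M) + 0)"
      by (intro tendsto_intros LIMSEQ_Suc[OF lim_1_over_n])
    then show ?case using elim by (intro LIMSEQ_le_const[where X = "\<lambda>j. ereal ((\<integral>x. f x \<partial>M) + 1 / real (Suc j))"]) auto
  qed
qed

text \<open>
  The upper bound applied to \<open>1 - f\<close> is the lower bound for \<open>f\<close>.
\<close>

theorem birkhoff_average:
  assumes f [measurable]: "f \<in> borel_measurable M" and b: "\<And>x. 0 \<le> f x" "\<And>x. f x \<le> 1"
  shows "AE x in M. (\<lambda>n. birkhoff_sum f n x / real n) \<longlonglongrightarrow> (\<integral>x. f x \<partial>M)"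
proof -
  have fi: "integrable M f" using b by (intro integrable_const_bound[of _ 1]) auto
  have "AE x in M. limsup (\<lambda>n. ereal (birkhoff_sum (\<lambda>x. 1 - f x) n x / real n)) \<le> ereal (\<integral>x. 1 - f x \<partial>M)"
    using b by (intro upper_average_le) auto
  with upper_average_le[OF f b] show ?thesis
  proof eventually_elim
    case (elim x)
    define I where "I = (\<integral>x. f x \<partial>M)"
    have I': "(\<integral>x. 1 - f x \<partial>M) = 1 - I" using fi by (simp add: I_def prob_space)
    have comp: "birkhoff_sum (\<lambda>x. 1 - f x) n x / real n = 1 - birkhoff_sum f n x / real n" if "n > 0" for n
      using that by (simp add: birkhoff_sum_def sum_subtractf diff_divide_distrib)
    show ?case
      unfolding I_def[symmetric]
    proof (rule order_tendstoI)
      fix a assume "I < a"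
      then have "limsup (\<lambda>n. ereal (birkhoff_sum f n x / real n)) < ereal a"
        using elim(1) by (simp add: I_def le_less_trans)
      from Limsup_lessD[OF this] show "eventually (\<lambda>n. birkhoff_sum f n x / real n < a) sequentially"
        by simp
    next
      fix a assume "a < I"
      then have "limsup (\<lambda>n. ereal (birkhoff_sum (\<lambda>x. 1 - f x) n x / real n)) < ereal (1 - a)"
        using le_less_trans[OF elim(2)[unfolded I'], of "ereal (1 - a)"] by simp
      from Limsup_lessD[OF this] eventually_gt_at_top[of 0]
      show "eventually (\<lambda>n. a < birkhoff_sum f n x / real n) sequentially"
        by eventually_elim (simp add: comp)
    qed
  qed
qed

end

section \<open>Boxes in the product of code and configuration space\<close>

definition determined :: "nat \<Rightarrow> nat \<Rightarrow> nat \<Rightarrow> (nat list \<Rightarrow> bool) set \<Rightarrow> bool" where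
  "determined m k n E \<longleftrightarrow> E \<subseteq> space (config_algebra m k) \<and>
     (\<forall>\<omega>\<in>space (config_algebra m k). \<forall>\<omega>'\<in>space (config_algebra m k).
        (\<forall>\<tau>\<in>words m k. length \<tau> \<le> n \<longrightarrow> \<omega> \<tau> = \<omega>' \<tau>) \<longrightarrow> (\<omega> \<in> E \<longleftrightarrow> \<omega>' \<in> E))"

lemma determinedI:
  assumes "E \<subseteq> space (config_algebra m k)"
    and "\<And>\<omega> \<omega>'. \<lbrakk>\<omega> \<in> space (config_algebra m k); \<omega>' \<in> space (config_algebra m k);
      \<And>\<tau>. \<tau> \<in> words m k \<Longrightarrow> length \<tau> \<le> n \<Longrightarrow> \<omega> \<tau> = \<omega>' \<tau>\<rbrakk> \<Longrightarrow> \<omega> \<in> E \<longleftrightarrow> \<omega>' \<in> E"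
  shows "determined m k n E"
  unfolding determined_def
proof (intro conjI ballI impI)
  show "E \<subseteq> space (config_algebra m k)" by (rule assms(1))
  fix \<omega> \<omega>' assume "\<omega> \<in> space (config_algebra m k)" "\<omega>' \<in> space (config_algebra m k)"
    and "\<forall>\<tau>\<in>words m k. length \<tau> \<le> n \<longrightarrow> \<omega> \<tau> = \<omega>' \<tau>"
  then show "\<omega> \<in> E \<longleftrightarrow> \<omega>' \<in> E" by (intro assms(2)) simp_all
qed

lemma determined_subset: "determined m k n E \<Longrightarrow> E \<subseteq> space (config_algebra m k)"
  by (simp add: determined_def)

lemma determinedD:
  assumes "determined m k n E" "\<omega> \<in> space (config_algebra m k)" "\<omega>' \<in> space (config_algebra m k)"
    "\<And>\<tau>. \<tau> \<in> words m k \<Longrightarrow> length \<tau> \<le> n \<Longrightarrow> \<omega> \<tau> = \<omega>' \<tau>"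
  shows "\<omega> \<in> E \<longleftrightarrow> \<omega>' \<in> E"
  using assms unfolding determined_def by blast

lemma finite_words_upto: "finite {\<tau> \<in> words m k. length \<tau> \<le> n}"
proof -
  have "{\<tau> \<in> words m k. length \<tau> \<le> n} = (\<Union>l\<le>n. level m k l)" by auto
  then show ?thesis by (simp add: finite_level)
qed

text \<open>
  Only finitely many patterns on the words of length at most \<open>n\<close> exist, and \<open>E\<close> is a union of the
  corresponding elementary events.
\<close>

lemma determined_sets:
  assumes E: "determined m k n E"
  shows "E \<in> sets (config_algebra m k)"
proof -
  define F where "F = {\<tau> \<in> words m k. length \<tau> \<le> n}"
  define pat where "pat \<omega> = {\<tau> \<in> F. \<omega> \<tau>}" for \<omega> :: "nat list \<Rightarrow> bool"
  have F: "finite F" unfolding F_def by (rule finite_words_upto)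
  have Esp: "E \<subseteq> space (config_algebra m k)" using E by (simp add: determined_def)
  have fin: "finite (pat ` E)"
    by (rule finite_subset[of _ "Pow F"]) (auto simp: pat_def F)
  have one: "{\<omega> \<in> space (config_algebra m k). pat \<omega> = S} \<in> sets (config_algebra m k)" for S
  proof (cases "S \<subseteq> F")
    case True
    have "pat \<omega> = S \<longleftrightarrow> (\<forall>\<tau>\<in>F. \<omega> \<tau> = (\<tau> \<in> S))" for \<omega>
      using True unfolding pat_def by blast
    moreover have "Measurable.pred (config_algebra m k) (\<lambda>\<omega>. \<forall>\<tau>\<in>F. \<omega> \<tau> = (\<tau> \<in> S))"
    proof (rule pred_intros_finite[OF F])
      fix \<tau> assume "\<tau> \<in> F"
      then have [measurable]: "Measurable.pred (config_algebra m k) (\<lambda>\<omega>. \<omega> \<tau>)"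
        by (intro measurable_config_coordinate) (simp add: F_def)
      show "Measurable.pred (config_algebra m k) (\<lambda>\<omega>. \<omega> \<tau> = (\<tau> \<in> S))" by measurable
    qed
    ultimately show ?thesis by (simp add: pred_def)
  next
    case False
    then have "{\<omega> \<in> space (config_algebra m k). pat \<omega> = S} = {}" by (auto simp: pat_def)
    then show ?thesis by (simp only: sets.empty_sets)
  qed
  have "E = (\<Union>S\<in>pat ` E. {\<omega> \<in> space (config_algebra m k). pat \<omega> = S})"
  proof (intro set_eqI iffI)
    fix \<omega> assume "\<omega> \<in> (\<Union>S\<in>pat ` E. {\<omega> \<in> space (config_algebra m k). pat \<omega> = S})"
    then obtain \<omega>' where w: "\<omega>' \<in> E" "\<omega> \<in> space (config_algebra m k)" "pat \<omega> = pat \<omega>'" by auto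
    have "\<omega> \<in> E \<longleftrightarrow> \<omega>' \<in> E"
    proof (rule determinedD[OF E])
      fix \<tau> assume "\<tau> \<in> words m k" "length \<tau> \<le> n"
      then have "\<tau> \<in> F" by (simp add: F_def)
      then show "\<omega> \<tau> = \<omega>' \<tau>" using w(3) unfolding pat_def by blast
    qed (use w Esp in auto)
    then show "\<omega> \<in> E" using w by simp
  qed (use Esp in auto)
  moreover have "(\<Union>S\<in>pat ` E. {\<omega> \<in> space (config_algebra m k). pat \<omega> = S}) \<in> sets (config_algebra m k)"
    by (rule sets.finite_UN[OF fin one])
  ultimately show ?thesis by (simp only:)
qed

lemma determined_mono:
  assumes E: "determined m k n E" and le: "n \<le> n'"
  shows "determined m k n' E"
proof (rule determinedI)
  fix \<omega> \<omega>' assume w: "\<omega> \<in> space (config_algebra m k)" "\<omega>' \<in> space (config_algebra m k)"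
    and eq: "\<And>\<tau>. \<tau> \<in> words m k \<Longrightarrow> length \<tau> \<le> n' \<Longrightarrow> \<omega> \<tau> = \<omega>' \<tau>"
  show "\<omega> \<in> E \<longleftrightarrow> \<omega>' \<in> E"
    by (rule determinedD[OF E w]) (use eq le in simp)
qed (rule determined_subset[OF E])

lemma determined_Int:
  assumes E: "determined m k n E" and E': "determined m k n E'"
  shows "determined m k n (E \<inter> E')"
proof (rule determinedI)
  show "E \<inter> E' \<subseteq> space (config_algebra m k)" using determined_subset[OF E] by (rule le_infI1)
  fix \<omega> \<omega>' assume w: "\<omega> \<in> space (config_algebra m k)" "\<omega>' \<in> space (config_algebra m k)"
    and eq: "\<And>\<tau>. \<tau> \<in> words m k \<Longrightarrow> length \<tau> \<le> n \<Longrightarrow> \<omega> \<tau> = \<omega>' \<tau>"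
  show "\<omega> \<in> E \<inter> E' \<longleftrightarrow> \<omega>' \<in> E \<inter> E'"
    using determinedD[OF E w eq] determinedD[OF E' w eq] by simp
qed

lemma determined_space: "determined m k n (space (config_algebra m k))"
  by (simp add: determined_def)

lemma determined_empty: "determined m k n {}"
  by (simp add: determined_def)

text \<open>
  The number of levels seen by the event \<open>E\<close> is tied to the length of \<open>\<sigma>\<close>.  Grafting at \<open>\<sigma>\<close> then
  does not change \<open>E\<close>, which makes the mass of a box under \<open>Q\<close> computable, and boxes are still
  stable under intersection.
\<close>

definition boxes :: "nat \<Rightarrow> nat \<Rightarrow> ((nat \<Rightarrow> nat) \<times> (nat list \<Rightarrow> bool)) set set" where
  "boxes m k = {cylinder m k \<sigma> \<times> E | \<sigma> E. \<sigma> \<in> words m k \<and> determined m k (length \<sigma>) E}"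

abbreviation pair_algebra :: "nat \<Rightarrow> nat \<Rightarrow> ((nat \<Rightarrow> nat) \<times> (nat list \<Rightarrow> bool)) measure" where
  "pair_algebra m k \<equiv> code_algebra m k \<Otimes>\<^sub>M config_algebra m k"

lemma space_pair_algebra: "space (pair_algebra m k) = codes m k \<times> space (config_algebra m k)"
  by (simp add: space_pair_measure space_code)

lemma boxI: "\<sigma> \<in> words m k \<Longrightarrow> determined m k (length \<sigma>) E \<Longrightarrow> cylinder m k \<sigma> \<times> E \<in> boxes m k"
  by (auto simp: boxes_def)

lemma boxE:
  assumes "A \<in> boxes m k"
  obtains \<sigma> E where "\<sigma> \<in> words m k" "determined m k (length \<sigma>) E" "A = cylinder m k \<sigma> \<times> E"
  using assms by (auto simp: boxes_def)

lemma box_sets: "A \<in> boxes m k \<Longrightarrow> A \<in> sets (pair_algebra m k)"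
  by (erule boxE) (simp add: determined_sets)

lemma boxes_space: "boxes m k \<subseteq> Pow (space (pair_algebra m k))"
  using box_sets sets.sets_into_space by blast

lemma Int_stable_boxes: "Int_stable (boxes m k)"
proof (rule Int_stableI)
  have *: "(cylinder m k \<sigma> \<times> E) \<inter> (cylinder m k \<tau> \<times> E') \<in> boxes m k"
    if s: "\<sigma> \<in> words m k" "determined m k (length \<sigma>) E" and t: "\<tau> \<in> words m k" "determined m k (length \<tau>) E'"
      and le: "length \<sigma> \<le> length \<tau>" for \<sigma> \<tau> E E'
  proof (cases "prefix \<sigma> \<tau>")
    case True
    have "(cylinder m k \<sigma> \<times> E) \<inter> (cylinder m k \<tau> \<times> E') = cylinder m k \<tau> \<times> (E \<inter> E')"
      unfolding Times_Int_Times cylinder_Int[OF le] using True by simp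
    then show ?thesis
      using boxI[OF t(1) determined_Int[OF determined_mono[OF s(2) le] t(2)]] by simp
  next
    case False
    have "(cylinder m k \<sigma> \<times> E) \<inter> (cylinder m k \<tau> \<times> E') = cylinder m k \<tau> \<times> {}"
      unfolding Times_Int_Times cylinder_Int[OF le] using False by simp
    then show ?thesis using boxI[OF t(1) determined_empty] by simp
  qed
  fix A B assume "A \<in> boxes m k" "B \<in> boxes m k"
  then obtain \<sigma> E \<tau> E' where s: "\<sigma> \<in> words m k" "determined m k (length \<sigma>) E" "A = cylinder m k \<sigma> \<times> E"
    and t: "\<tau> \<in> words m k" "determined m k (length \<tau>) E'" "B = cylinder m k \<tau> \<times> E'"
    by (auto elim!: boxE)
  show "A \<inter> B \<in> boxes m k"
  proof (cases "length \<sigma> \<le> length \<tau>")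
    case True
    then show ?thesis unfolding s(3) t(3) by (intro * s t)
  next
    case False
    then have "B \<inter> A \<in> boxes m k" unfolding s(3) t(3) by (intro * s t) simp
    then show ?thesis by (simp add: Int_commute)
  qed
qed

lemma determined_coordinate:
  assumes "\<tau> \<in> words m k" "length \<tau> \<le> n"
  shows "determined m k n {\<omega> \<in> space (config_algebra m k). \<omega> \<tau>}"
  by (rule determinedI) (use assms in simp_all)

lemma codes_eq_UN_cylinder: "codes m k = (\<Union>\<sigma>\<in>level m k n. cylinder m k \<sigma>)"
proof (rule antisym)
  show "codes m k \<subseteq> (\<Union>\<sigma>\<in>level m k n. cylinder m k \<sigma>)"
  proof
    fix \<eta> assume h: "\<eta> \<in> codes m k"
    then have "\<eta> \<in> cylinder m k (code_prefix \<eta> n)" by (simp add: cylinder_def)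
    then show "\<eta> \<in> (\<Union>\<sigma>\<in>level m k n. cylinder m k \<sigma>)"
      by (rule UN_I[OF code_prefix_level[OF h]])
  qed
  show "(\<Union>\<sigma>\<in>level m k n. cylinder m k \<sigma>) \<subseteq> codes m k"
    by (rule UN_least) (simp only: cylinder_def Collect_subset)
qed

text \<open>
  The event that \<open>\<tau>\<close> is chosen becomes a finite union of boxes after the code space is cut into
  cylinders of length \<open>|\<tau>|\<close>.
\<close>

lemma sets_pair_algebra: "sets (pair_algebra m k) = sigma_sets (space (pair_algebra m k)) (boxes m k)"
proof
  let ?N = "sigma (space (pair_algebra m k)) (boxes m k)"
  show "sigma_sets (space (pair_algebra m k)) (boxes m k) \<subseteq> sets (pair_algebra m k)"
    by (rule sets.sigma_sets_subset) (use box_sets in blast)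
  have sN: "sets ?N = sigma_sets (space (pair_algebra m k)) (boxes m k)"
    using boxes_space by (rule sets_measure_of)
  have spN: "space ?N = codes m k \<times> space (config_algebra m k)"
    by (subst space_measure_of[OF boxes_space]) (rule space_pair_algebra)
  have boxN: "A \<in> sets ?N" if "A \<in> boxes m k" for A
    unfolding sN using that by (rule sigma_sets.Basic)
  have f: "fst \<in> measurable ?N (code_algebra m k)"
  proof (rule measurable_sigma_sets[OF code_algebra_generated])
    show "cylinder m k ` words m k \<subseteq> Pow (codes m k)" by (auto simp: cylinder_def)
    show "fst \<in> space ?N \<rightarrow> codes m k" unfolding spN by auto
    fix y assume "y \<in> cylinder m k ` words m k"
    then obtain \<sigma> where s: "\<sigma> \<in> words m k" "y = cylinder m k \<sigma>" by blast
    have "fst -` y \<inter> space ?N = cylinder m k \<sigma> \<times> space (config_algebra m k)"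
      unfolding spN s(2) by (auto simp: cylinder_def)
    then show "fst -` y \<inter> space ?N \<in> sets ?N" using boxN[OF boxI[OF s(1) determined_space]] by simp
  qed
  have "(\<lambda>z \<tau>. snd z \<tau>) \<in> measurable ?N (\<Pi>\<^sub>M \<tau>\<in>words m k. count_space UNIV)"
  proof (rule measurable_PiM_single')
    show "(\<lambda>z \<tau>. snd z \<tau>) \<in> space ?N \<rightarrow> (\<Pi>\<^sub>E \<tau>\<in>words m k. space (count_space UNIV))"
      unfolding spN space_config by (auto simp: PiE_def)
    fix \<tau> assume t: "\<tau> \<in> words m k"
    have "{z \<in> space ?N. snd z \<tau>} =
        (\<Union>\<sigma>\<in>level m k (length \<tau>). cylinder m k \<sigma> \<times> {\<omega> \<in> space (config_algebra m k). \<omega> \<tau>})"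
      unfolding spN codes_eq_UN_cylinder[of m k "length \<tau>"] by auto
    also have "\<dots> \<in> sets ?N"
    proof (rule sets.finite_UN[OF finite_level])
      fix \<sigma> assume "\<sigma> \<in> level m k (length \<tau>)"
      then show "cylinder m k \<sigma> \<times> {\<omega> \<in> space (config_algebra m k). \<omega> \<tau>} \<in> sets ?N"
        using t by (intro boxN boxI determined_coordinate) simp_all
    qed
    finally show "(\<lambda>z. snd z \<tau>) \<in> measurable ?N (count_space UNIV)"
      by (simp only: pred_def)
  qed
  then have s: "snd \<in> measurable ?N (config_algebra m k)" by (simp add: config_algebra_def)
  have "(\<lambda>z. (fst z, snd z)) \<in> measurable ?N (pair_algebra m k)"
    by (rule measurable_Pair[OF f s])
  then have id: "(\<lambda>z. z) \<in> measurable ?N (pair_algebra m k)" by simp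
  show "sets (pair_algebra m k) \<subseteq> sigma_sets (space (pair_algebra m k)) (boxes m k)"
  proof
    fix A assume A: "A \<in> sets (pair_algebra m k)"
    have "(\<lambda>z. z) -` A \<inter> space ?N \<in> sets ?N" using id A by (rule measurable_sets)
    moreover have "(\<lambda>z. z) -` A \<inter> space ?N = A"
    proof -
      have "A \<subseteq> space ?N" using sets.sets_into_space[OF A] unfolding spN unfolding space_pair_algebra .
      then show ?thesis by (simp only: vimage_ident Int_absorb2)
    qed
    ultimately show "A \<in> sigma_sets (space (pair_algebra m k)) (boxes m k)" unfolding sN[symmetric] by (simp only:)
  qed
qed

lemma pair_measure_eqI:
  assumes M: "sets M = sets (pair_algebra m k)" and N: "sets N = sets (pair_algebra m k)"
    and eq: "\<And>A. A \<in> boxes m k \<Longrightarrow> emeasure M A = emeasure N A"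
    and fin: "emeasure M (space (pair_algebra m k)) \<noteq> \<infinity>"
  shows "M = N"
proof (rule measure_eqI_generator_eq[OF Int_stable_boxes, where \<Omega> = "space (pair_algebra m k)"])
  have "space (pair_algebra m k) = cylinder m k [] \<times> space (config_algebra m k)"
    by (simp add: cylinder_Nil space_pair_algebra)
  then show "range (\<lambda>_::nat. space (pair_algebra m k)) \<subseteq> boxes m k"
    using boxI[of "[]" m k "space (config_algebra m k)"] determined_space[of m k "length ([] :: nat list)"]
    by auto
  show "sets M = sigma_sets (space (pair_algebra m k)) (boxes m k)"
    "sets N = sigma_sets (space (pair_algebra m k)) (boxes m k)"
    unfolding sets_pair_algebra[symmetric] by (rule M, rule N)
  show "(\<Union>i::nat. space (pair_algebra m k)) = space (pair_algebra m k)" by simp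
  show "boxes m k \<subseteq> Pow (space (pair_algebra m k))" by (rule boxes_space)
  show "emeasure M A = emeasure N A" if "A \<in> boxes m k" for A using that by (rule eq)
  show "emeasure M (space (pair_algebra m k)) \<noteq> \<infinity>" by (rule fin)
qed

section \<open>The measure \<open>Q\<close>\<close>

context branching
begin

abbreviation "\<M> \<equiv> code_algebra m k"
abbreviation "\<S> \<equiv> pair_algebra m k"
abbreviation "cyl \<equiv> cylinder m k"

definition slice :: "((nat \<Rightarrow> nat) \<times> (nat list \<Rightarrow> bool)) set \<Rightarrow> (nat list \<Rightarrow> bool) \<Rightarrow> (nat \<Rightarrow> nat) set" where
  "slice B \<omega> = {\<eta> \<in> codes m k. (\<eta>, \<omega>) \<in> B}"

end

locale mandelbrot = branching "CARD('n)" k p for k :: nat and p :: real and e :: "nat \<Rightarrow> nat ^ 'n::finite" +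
  assumes enum: "subcube_enumeration k e"
begin

abbreviation "\<mu> \<equiv> code_measure k e p"
abbreviation "Q \<equiv> Q_measure k e p"

lemma cube_Nil: "cube k e [] = {x. \<forall>i. 0 \<le> x $ i \<and> x $ i \<le> 1}"
  by (simp add: cube_def corner_def)

lemma diameter_pos: "0 < diameter (cube k e [])"
proof -
  have b: "cube k e [] = cbox 0 1" unfolding cube_Nil by (simp add: set_eq_iff mem_box_cart)
  have "dist (0 :: real ^ 'n) 1 \<le> diameter (cbox (0 :: real ^ 'n) 1)"
    by (rule diameter_bounded_bound[OF bounded_cbox]) (simp_all add: mem_box_cart)
  moreover have "(0 :: real ^ 'n) \<noteq> 1" by (simp add: vec_eq_iff)
  ultimately show ?thesis unfolding b using zero_less_dist_iff[of "0 :: real ^ 'n" 1] by linarith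
qed

text \<open>
  The factor \<open>(diam J_[])^d\<close>, which occurs in the natural measures and cancels in \<open>Q\<close>.
\<close>

definition diam_pow :: real where "diam_pow = diameter (cube k e []) powr perc_dim CARD('n) k p"

lemma diam_pow_pos: "diam_pow > 0"
  using diameter_pos by (simp add: diam_pow_def)

lemma diam_pow_inverse: "ennreal (diameter (cube k e []) powr (- perc_dim CARD('n) k p)) * ennreal diam_pow = 1"
  using diameter_pos by (simp add: diam_pow_def powr_minus ennreal_mult[symmetric])

lemma is_code_measure_iff:
  "is_code_measure k e p \<omega> N \<longleftrightarrow> sets N = sets \<M> \<and>
    (\<forall>\<sigma>\<in>W. emeasure N (cyl \<sigma>) = ennreal (diam_pow * (1 / M ^ length \<sigma>) * X (sub \<sigma> \<omega>)))"
  unfolding is_code_measure_def powr_perc_dim diam_pow_def[symmetric]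
  by (intro conj_cong ball_cong refl) (simp only: martingale_limit_eq)

lemma is_code_measure_unique:
  assumes N: "is_code_measure k e p \<omega> N" and N': "is_code_measure k e p \<omega> N'"
  shows "N = N'"
proof (rule code_measure_unique[of N "CARD('n)" k N'])
  show "sets N = sets \<M>" "sets N' = sets \<M>" using N N' unfolding is_code_measure_iff by blast+
  show "emeasure N (cyl \<sigma>) = emeasure N' (cyl \<sigma>)" if "\<sigma> \<in> W" for \<sigma>
  proof -
    have "emeasure N (cyl \<sigma>) = ennreal (diam_pow * (1 / M ^ length \<sigma>) * X (sub \<sigma> \<omega>))"
      using N that unfolding is_code_measure_iff by blast
    moreover have "emeasure N' (cyl \<sigma>) = ennreal (diam_pow * (1 / M ^ length \<sigma>) * X (sub \<sigma> \<omega>))"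
      using N' that unfolding is_code_measure_iff by blast
    ultimately show ?thesis by (rule trans[OF _ sym])
  qed
  have "emeasure N (cyl []) = ennreal (diam_pow * (1 / M ^ length ([]::nat list)) * X (sub [] \<omega>))"
    using N Nil_word unfolding is_code_measure_iff by blast
  then show "emeasure N (codes CARD('n) k) \<noteq> \<infinity>" unfolding cylinder_Nil by (simp only: ennreal_neq_top infinity_ennreal_def not_False_eq_True)
qed

lemma code_measure_eq:
  assumes N: "is_code_measure k e p \<omega> N"
  shows "\<mu> \<omega> = N"
proof -
  have "(THE N. is_code_measure k e p \<omega> N) = N"
  proof (rule the_equality)
    show "is_code_measure k e p \<omega> N" by (rule N)
    show "N' = N" if "is_code_measure k e p \<omega> N'" for N'
      using that N by (rule is_code_measure_unique)
  qed
  moreover have "\<exists>N. is_code_measure k e p \<omega> N" using N by blast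
  ultimately show ?thesis by (simp only: code_measure_def if_True)
qed

lemma sets_code_measure [simp, measurable_cong]: "sets (\<mu> \<omega>) = sets \<M>"
proof (cases "\<exists>N. is_code_measure k e p \<omega> N")
  case True
  then obtain N where N: "is_code_measure k e p \<omega> N" by blast
  then show ?thesis using code_measure_eq[OF N] unfolding is_code_measure_iff by (simp only:)
next
  case False
  then show ?thesis by (simp add: code_measure_def)
qed

lemma space_code_measure [simp]: "space (\<mu> \<omega>) = codes CARD('n) k"
  using sets_eq_imp_space_eq[OF sets_code_measure] by (simp add: space_code)

text \<open>
  The identity \<open>X \<omega> = (\<Sum>j. X (sub [j] \<omega>)) / M\<close> makes the prescribed masses additive.
\<close>

lemma regular_code_measure:
  assumes r: "regular \<omega>" and s: "\<sigma> \<in> W"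
  shows "emeasure (\<mu> \<omega>) (cyl \<sigma>) = ennreal (diam_pow * (1 / M ^ length \<sigma>) * X (sub \<sigma> \<omega>))"
proof -
  define c where "c \<sigma> = diam_pow * (1 / M ^ length \<sigma>) * X (sub \<sigma> \<omega>)" for \<sigma>
  have c0: "0 \<le> c \<sigma>" if "\<sigma> \<in> W" for \<sigma>
    using regular_X_nonneg[OF r that] diam_pow_pos M_gt_1 by (simp add: c_def)
  have cs: "c \<sigma> = (\<Sum>j\<in>L. c (\<sigma> @ [j]))" if "\<sigma> \<in> W" for \<sigma>
  proof -
    have "c (\<sigma> @ [j]) = diam_pow * (1 / M ^ length \<sigma>) / M * X (sub (\<sigma> @ [j]) \<omega>)" for j
      by (simp add: c_def mult_ac)
    then have "(\<Sum>j\<in>L. c (\<sigma> @ [j])) = diam_pow * (1 / M ^ length \<sigma>) / M * (\<Sum>j\<in>L. X (sub (\<sigma> @ [j]) \<omega>))"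
      by (simp only: sum_distrib_left)
    then show ?thesis unfolding c_def regular_X_children[OF r that] by (simp only: times_divide_eq_left times_divide_eq_right)
  qed
  obtain N where "sets N = sets \<M> \<and> (\<forall>\<sigma>\<in>W. emeasure N (cyl \<sigma>) = ennreal (c \<sigma>))"
    using code_measure_exists[of "CARD('n)" k c, OF c0 cs] by blast
  then have N: "is_code_measure k e p \<omega> N" by (simp add: is_code_measure_iff c_def)
  have "\<mu> \<omega> = N" by (rule code_measure_eq[OF N])
  then show ?thesis using N s by (simp add: is_code_measure_iff)
qed

lemma regular_code_measure_finite:
  assumes r: "regular \<omega>"
  shows "emeasure (\<mu> \<omega>) A \<noteq> \<infinity>"
proof -
  have "emeasure (\<mu> \<omega>) A \<le> emeasure (\<mu> \<omega>) (space (\<mu> \<omega>))" by (rule emeasure_space)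
  also have "\<dots> = ennreal (diam_pow * (1 / M ^ length ([]::nat list)) * X (sub [] \<omega>))"
    using regular_code_measure[OF r Nil_word] by (simp add: cylinder_Nil)
  finally show ?thesis by (auto simp: top_unique)
qed

lemma slice_sets: "B \<in> sets \<S> \<Longrightarrow> slice B \<omega> \<in> sets \<M>"
proof -
  assume B: "B \<in> sets \<S>"
  have "slice B \<omega> = (\<lambda>\<eta>. (\<eta>, \<omega>)) -` B"
    using sets.sets_into_space[OF B] unfolding slice_def space_pair_algebra by auto
  also have "\<dots> \<in> sets \<M>" using B by (rule sets_Pair2)
  finally show ?thesis .
qed

lemma slice_box:
  "\<omega> \<in> space \<A> \<Longrightarrow> slice (cyl \<sigma> \<times> E) \<omega> = (if \<omega> \<in> E then cyl \<sigma> else {})"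
  by (auto simp: slice_def cylinder_def)

lemma measurable_X_sub: "\<sigma> \<in> W \<Longrightarrow> (\<lambda>\<omega>. X (sub \<sigma> \<omega>)) \<in> borel_measurable \<A>"
  by (rule measurable_compose[OF measurable_subtree measurable_X])

text \<open>
  Integrals over \<open>P\<close> do not see the configurations that are not regular, so a measurable version of
  the mass of a slice suffices.  For boxes it is given by the formula for cylinders, and versions
  survive complements and countable disjoint unions.
\<close>

lemma kernel_measurable:
  assumes "B \<in> sets \<S>"
  shows "\<exists>f\<in>borel_measurable \<A>. AE \<omega> in P. f \<omega> = emeasure (\<mu> \<omega>) (slice B \<omega>)"
proof -
  have "B \<in> sigma_sets (space \<S>) (boxes CARD('n) k)" using assms by (simp only: sets_pair_algebra)
  with Int_stable_boxes boxes_space show ?thesis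
  proof (induction rule: sigma_sets_induct_disjoint)
    case (basic A)
    then obtain \<sigma> E where A: "\<sigma> \<in> W" "determined CARD('n) k (length \<sigma>) E" "A = cyl \<sigma> \<times> E"
      by (rule boxE)
    note [measurable] = measurable_X_sub[OF A(1)] determined_sets[OF A(2)]
    show ?case
    proof (intro bexI[of _ "\<lambda>\<omega>. indicator E \<omega> * ennreal (diam_pow * (1 / M ^ length \<sigma>) * X (sub \<sigma> \<omega>))"])
      show "AE \<omega> in P. indicator E \<omega> * ennreal (diam_pow * (1 / M ^ length \<sigma>) * X (sub \<sigma> \<omega>)) =
          emeasure (\<mu> \<omega>) (slice A \<omega>)"
        using AE_regular AE_space
      proof eventually_elim
        case (elim \<omega>)
        then show ?case
          using regular_code_measure[OF elim(1) A(1)] unfolding A(3) by (simp add: slice_box indicator_def)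
      qed
    qed measurable
  next
    case empty
    show ?case by (intro bexI[of _ "\<lambda>_. 0"]) (simp_all add: slice_def)
  next
    case (compl A)
    then obtain f where f [measurable]: "f \<in> borel_measurable \<A>"
      and fA: "AE \<omega> in P. f \<omega> = emeasure (\<mu> \<omega>) (slice A \<omega>)" by blast
    have A: "A \<in> sets \<S>" using compl(1) by (simp only: sets_pair_algebra)
    note [measurable] = measurable_X_sub[OF Nil_word]
    show ?case
    proof (intro bexI[of _ "\<lambda>\<omega>. ennreal (diam_pow * (1 / M ^ length ([]::nat list)) * X (sub [] \<omega>)) - f \<omega>"])
      show "AE \<omega> in P. ennreal (diam_pow * (1 / M ^ length ([]::nat list)) * X (sub [] \<omega>)) - f \<omega> =
          emeasure (\<mu> \<omega>) (slice (space \<S> - A) \<omega>)"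
        using AE_regular AE_space fA
      proof eventually_elim
        case (elim \<omega>)
        have "slice (space \<S> - A) \<omega> = space (\<mu> \<omega>) - slice A \<omega>"
          using elim(2) by (auto simp: slice_def space_pair_algebra)
        then have "emeasure (\<mu> \<omega>) (slice (space \<S> - A) \<omega>) = emeasure (\<mu> \<omega>) (space (\<mu> \<omega>)) - emeasure (\<mu> \<omega>) (slice A \<omega>)"
          using slice_sets[OF A] regular_code_measure_finite[OF elim(1)]
          by (simp add: emeasure_compl del: space_code_measure)
        then show ?case
          using regular_code_measure[OF elim(1) Nil_word] elim(3) by (simp add: cylinder_Nil)
      qed
    qed measurable
  next
    case (union A)
    have "\<forall>i. \<exists>f. f \<in> borel_measurable \<A> \<and> (AE \<omega> in P. f \<omega> = emeasure (\<mu> \<omega>) (slice (A i) \<omega>))"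
      using union(3) by blast
    from choice[OF this] obtain f where f: "\<And>i::nat. f i \<in> borel_measurable \<A>"
      and fA: "\<And>i. AE \<omega> in P. f i \<omega> = emeasure (\<mu> \<omega>) (slice (A i) \<omega>)" by blast
    have A: "A i \<in> sets \<S>" for i using union(2) sets_pair_algebra by blast
    note [measurable] = f
    show ?case
    proof (intro bexI[of _ "\<lambda>\<omega>. \<Sum>i. f i \<omega>"])
      have "AE \<omega> in P. \<forall>i. f i \<omega> = emeasure (\<mu> \<omega>) (slice (A i) \<omega>)"
        unfolding AE_all_countable using fA by blast
      then show "AE \<omega> in P. (\<Sum>i. f i \<omega>) = emeasure (\<mu> \<omega>) (slice (\<Union>i. A i) \<omega>)"
      proof eventually_elim
        case (elim \<omega>)
        have "slice (\<Union>i. A i) \<omega> = (\<Union>i. slice (A i) \<omega>)" by (auto simp: slice_def)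
        moreover have "disjoint_family (\<lambda>i. slice (A i) \<omega>)"
          using union(1) unfolding disjoint_family_on_def slice_def by blast
        moreover have "range (\<lambda>i. slice (A i) \<omega>) \<subseteq> sets (\<mu> \<omega>)" using slice_sets[OF A] by auto
        ultimately show ?case using suminf_emeasure[of "\<lambda>i. slice (A i) \<omega>" "\<mu> \<omega>"] elim by simp
      qed
    qed measurable
  qed
qed

abbreviation Qfun :: "((nat \<Rightarrow> nat) \<times> (nat list \<Rightarrow> bool)) set \<Rightarrow> ennreal" where
  "Qfun B \<equiv> ennreal (diameter (cube k e []) powr (- perc_dim CARD('n) k p)) *
     (\<integral>\<^sup>+ \<omega>. emeasure (\<mu> \<omega>) (slice B \<omega>) \<partial>P)"

lemma Q_eq: "Q = measure_of (space \<S>) (sets \<S>) Qfun"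
  by (simp add: Q_measure_def Let_def slice_def)

lemma sets_Q [simp, measurable_cong]: "sets Q = sets \<S>"
  unfolding Q_eq by simp

lemma space_Q [simp]: "space Q = space \<S>"
  unfolding Q_eq by simp

text \<open>
  \<open>Q\<close> is given by a set function on the product algebra; measurable versions of the slices make it
  countably additive by monotone convergence.
\<close>

lemma emeasure_Q:
  assumes "B \<in> sets \<S>"
  shows "emeasure Q B = Qfun B"
  unfolding Q_eq
proof (rule emeasure_measure_of_sigma)
  show "sigma_algebra (space \<S>) (sets \<S>)" ..
  show "positive (sets \<S>) Qfun" by (simp add: positive_def slice_def)
  show "countably_additive (sets \<S>) Qfun"
  proof (rule countably_additiveI)
    fix A :: "nat \<Rightarrow> _" assume A: "range A \<subseteq> sets \<S>" "disjoint_family A"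
    have Ai: "A i \<in> sets \<S>" for i using A(1) by blast
    have "\<forall>i. \<exists>f. f \<in> borel_measurable \<A> \<and> (AE \<omega> in P. f \<omega> = emeasure (\<mu> \<omega>) (slice (A i) \<omega>))"
      using kernel_measurable[OF Ai] by blast
    from choice[OF this] obtain f where f [measurable]: "\<And>i. f i \<in> borel_measurable \<A>"
      and fA: "\<And>i. AE \<omega> in P. f i \<omega> = emeasure (\<mu> \<omega>) (slice (A i) \<omega>)"
      by blast
    have fall: "AE \<omega> in P. \<forall>i. f i \<omega> = emeasure (\<mu> \<omega>) (slice (A i) \<omega>)"
      unfolding AE_all_countable using fA by blast
    have "(\<Sum>i. \<integral>\<^sup>+ \<omega>. emeasure (\<mu> \<omega>) (slice (A i) \<omega>) \<partial>P) = (\<Sum>i. \<integral>\<^sup>+ \<omega>. f i \<omega> \<partial>P)"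
    proof (rule suminf_cong, rule nn_integral_cong_AE)
      show "AE \<omega> in P. emeasure (\<mu> \<omega>) (slice (A i) \<omega>) = f i \<omega>" for i
        using fA[of i] by eventually_elim simp
    qed
    also have "\<dots> = (\<integral>\<^sup>+ \<omega>. (\<Sum>i. f i \<omega>) \<partial>P)"
      by (rule nn_integral_suminf[symmetric]) measurable
    also have "\<dots> = (\<integral>\<^sup>+ \<omega>. emeasure (\<mu> \<omega>) (slice (\<Union>i. A i) \<omega>) \<partial>P)"
    proof (rule nn_integral_cong_AE)
      show "AE \<omega> in P. (\<Sum>i. f i \<omega>) = emeasure (\<mu> \<omega>) (slice (\<Union>i. A i) \<omega>)"
        using fall
      proof eventually_elim
        case (elim \<omega>)
        have "slice (\<Union>i. A i) \<omega> = (\<Union>i. slice (A i) \<omega>)" by (auto simp: slice_def)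
        moreover have "disjoint_family (\<lambda>i. slice (A i) \<omega>)"
          using A(2) unfolding disjoint_family_on_def slice_def by blast
        moreover have "range (\<lambda>i. slice (A i) \<omega>) \<subseteq> sets (\<mu> \<omega>)" using slice_sets[OF Ai] by auto
        ultimately show ?case using suminf_emeasure[of "\<lambda>i. slice (A i) \<omega>" "\<mu> \<omega>"] elim by simp
      qed
    qed
    finally show "(\<Sum>i. Qfun (A i)) = Qfun (\<Union>i. A i)" by (simp only: ennreal_suminf_cmult)
  qed
qed (rule assms)

lemma Q_null_AE:
  assumes B: "B \<in> sets \<S>"
  shows "emeasure Q B = 0 \<longleftrightarrow> (AE \<omega> in P. emeasure (\<mu> \<omega>) (slice B \<omega>) = 0)"
proof -
  obtain f where f [measurable]: "f \<in> borel_measurable \<A>"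
    and fB: "AE \<omega> in P. f \<omega> = emeasure (\<mu> \<omega>) (slice B \<omega>)"
    using kernel_measurable[OF B] by blast
  have "(\<integral>\<^sup>+ \<omega>. emeasure (\<mu> \<omega>) (slice B \<omega>) \<partial>P) = (\<integral>\<^sup>+ \<omega>. f \<omega> \<partial>P)"
    by (rule nn_integral_cong_AE) (use fB in eventually_elim, simp)
  moreover have "(\<integral>\<^sup>+ \<omega>. f \<omega> \<partial>P) = 0 \<longleftrightarrow> (AE \<omega> in P. f \<omega> = 0)"
    by (rule nn_integral_0_iff_AE) measurable
  moreover have "(AE \<omega> in P. f \<omega> = 0) \<longleftrightarrow> (AE \<omega> in P. emeasure (\<mu> \<omega>) (slice B \<omega>) = 0)"
    by (rule eventually_cong[OF fB]) simp
  moreover have "ennreal (diameter (cube k e []) powr (- perc_dim CARD('n) k p)) \<noteq> 0"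
    using diameter_pos by simp
  ultimately show ?thesis unfolding emeasure_Q[OF B] by simp
qed

lemma AE_Q_of_AE_P:
  assumes "AE \<omega> in P. R \<omega>"
  shows "AE z in Q. R (snd z)"
proof -
  obtain N where N: "N \<in> sets P" "emeasure P N = 0" "{\<omega> \<in> space P. \<not> R \<omega>} \<subseteq> N"
    using assms by (auto elim: AE_E)
  have NS: "codes CARD('n) k \<times> N \<in> sets \<S>"
    using N(1) sets.top[of \<M>] by (simp add: space_code)
  have "AE \<omega> in P. \<omega> \<notin> N" using N by (intro AE_not_in) (simp add: null_sets_def)
  then have "AE \<omega> in P. emeasure (\<mu> \<omega>) (slice (codes CARD('n) k \<times> N) \<omega>) = 0"
    by eventually_elim (simp add: slice_def)
  then have "emeasure Q (codes CARD('n) k \<times> N) = 0" using Q_null_AE[OF NS] by simp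
  then show ?thesis
  proof (intro AE_I)
    show "{z \<in> space Q. \<not> R (snd z)} \<subseteq> codes CARD('n) k \<times> N"
      using N(3) by (auto simp: space_pair_algebra)
  qed (use NS in simp_all)
qed

lemma determined_graft:
  assumes E: "determined CARD('n) k (length \<sigma>) E" and s: "\<sigma> \<in> W" and w: "\<omega> \<in> space \<A>" "\<omega>' []"
  shows "graft CARD('n) k \<sigma> (\<omega>, \<omega>') \<in> E \<longleftrightarrow> \<omega> \<in> E"
proof (rule determinedD[OF E graft_space w(1)])
  fix \<tau> assume t: "\<tau> \<in> W" "length \<tau> \<le> length \<sigma>"
  show "graft CARD('n) k \<sigma> (\<omega>, \<omega>') \<tau> = \<omega> \<tau>"
  proof (cases "prefix \<sigma> \<tau>")
    case True
    then have "\<tau> = \<sigma>" using t(2) by (auto simp: prefix_def)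
    then show ?thesis using graft_root[OF s, where \<omega> = \<omega> and \<omega>' = \<omega>'] w(2) by simp
  qed (use graft_outside[OF t(1)] in simp)
qed

lemma nn_integral_X: "(\<integral>\<^sup>+ \<omega>. ennreal (X \<omega>) \<partial>P) = 1"
proof -
  have "AE \<omega> in P. 0 \<le> X \<omega>" using martingale_convergence by eventually_elim (rule X_nonneg)
  then show ?thesis using integrable_X expectation_X by (simp add: nn_integral_eq_integral)
qed

text \<open>
  The event \<open>E\<close> does not depend on what lies below \<open>\<sigma>\<close>, and \<open>X\<close> of the subtree at \<open>\<sigma>\<close> depends on
  nothing else unless \<open>\<sigma>\<close> is neglected.  Grafting at \<open>\<sigma>\<close> separates the two, and \<open>X\<close> has mean \<open>1\<close>.
\<close>

lemma emeasure_Q_box: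
  assumes s: "\<sigma> \<in> W" and E: "determined CARD('n) k (length \<sigma>) E"
  shows "emeasure Q (cyl \<sigma> \<times> E) = ennreal (1 / M ^ length \<sigma>) * emeasure P {\<omega> \<in> E. \<omega> \<sigma>}"
proof -
  note [measurable] = measurable_X_sub[OF s] determined_sets[OF E] measurable_config_coordinate[OF s]
  have ES: "{\<omega> \<in> E. \<omega> \<sigma>} = {\<omega> \<in> space \<A>. \<omega> \<in> E \<and> \<omega> \<sigma>}"
    using E by (auto simp: determined_def)
  have [measurable]: "{\<omega> \<in> E. \<omega> \<sigma>} \<in> sets \<A>" unfolding ES by measurable
  have "(\<integral>\<^sup>+ \<omega>. indicator E \<omega> * ennreal (X (sub \<sigma> \<omega>)) \<partial>P) =
      (\<integral>\<^sup>+ \<omega>. indicator {\<omega> \<in> E. \<omega> \<sigma>} \<omega> \<partial>P) * (\<integral>\<^sup>+ \<omega>. ennreal (X \<omega>) \<partial>P)"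
  proof (rule nn_integral_graft_product[OF s])
    fix \<omega> \<omega>' assume w: "\<omega> \<in> space \<A>" "\<omega>' \<in> space \<A>" "\<omega>' []"
    show "indicator E (graft CARD('n) k \<sigma> (\<omega>, \<omega>')) * ennreal (X (sub \<sigma> (graft CARD('n) k \<sigma> (\<omega>, \<omega>')))) =
        indicator {\<omega> \<in> E. \<omega> \<sigma>} \<omega> * ennreal (X \<omega>')"
      using determined_graft[OF E s w(1), of \<omega>'] w(3) subtree_graft[OF s w(2), of \<omega>]
      by (simp add: indicator_def)
  qed measurable
  also have "\<dots> = emeasure P {\<omega> \<in> E. \<omega> \<sigma>}" by (simp add: nn_integral_X)
  finally have I: "(\<integral>\<^sup>+ \<omega>. indicator E \<omega> * ennreal (X (sub \<sigma> \<omega>)) \<partial>P) = emeasure P {\<omega> \<in> E. \<omega> \<sigma>}" .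
  have "(\<integral>\<^sup>+ \<omega>. emeasure (\<mu> \<omega>) (slice (cyl \<sigma> \<times> E) \<omega>) \<partial>P) =
      (\<integral>\<^sup>+ \<omega>. ennreal diam_pow * (ennreal (1 / M ^ length \<sigma>) * (indicator E \<omega> * ennreal (X (sub \<sigma> \<omega>)))) \<partial>P)"
  proof (rule nn_integral_cong_AE)
    show "AE \<omega> in P. emeasure (\<mu> \<omega>) (slice (cyl \<sigma> \<times> E) \<omega>) =
        ennreal diam_pow * (ennreal (1 / M ^ length \<sigma>) * (indicator E \<omega> * ennreal (X (sub \<sigma> \<omega>))))"
      using AE_regular AE_space
    proof eventually_elim
      case (elim \<omega>)
      have X0: "0 \<le> X (sub \<sigma> \<omega>)" using regular_X_nonneg[OF elim(1) s] .
      have pos: "0 \<le> 1 / M ^ length \<sigma>" "0 \<le> diam_pow" using M_gt_1 diam_pow_pos by simp_all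
      show ?case
      proof (cases "\<omega> \<in> E")
        case True
        have "emeasure (\<mu> \<omega>) (slice (cyl \<sigma> \<times> E) \<omega>) = ennreal (diam_pow * ((1 / M ^ length \<sigma>) * X (sub \<sigma> \<omega>)))"
          using True elim(2) regular_code_measure[OF elim(1) s] by (simp add: slice_box mult.assoc)
        also have "\<dots> = ennreal diam_pow * ennreal ((1 / M ^ length \<sigma>) * X (sub \<sigma> \<omega>))"
          by (rule ennreal_mult[OF pos(2) mult_nonneg_nonneg[OF pos(1) X0]])
        also have "ennreal ((1 / M ^ length \<sigma>) * X (sub \<sigma> \<omega>)) = ennreal (1 / M ^ length \<sigma>) * ennreal (X (sub \<sigma> \<omega>))"
          by (rule ennreal_mult[OF pos(1) X0])
        finally show ?thesis using True by simp
      next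
        case False
        then show ?thesis using elim(2) by (simp add: slice_box)
      qed
    qed
  qed
  also have "\<dots> = ennreal diam_pow * (ennreal (1 / M ^ length \<sigma>) * emeasure P {\<omega> \<in> E. \<omega> \<sigma>})"
    unfolding I[symmetric] by (subst nn_integral_cmult, measurable)+
  finally have J: "(\<integral>\<^sup>+ \<omega>. emeasure (\<mu> \<omega>) (slice (cyl \<sigma> \<times> E) \<omega>) \<partial>P) = \<dots>" .
  show ?thesis
    unfolding emeasure_Q[OF box_sets[OF boxI[OF s E]]] J mult.assoc[symmetric] diam_pow_inverse by simp
qed

lemma prob_space_Q: "prob_space Q"
proof
  have "space Q = cyl [] \<times> space \<A>" by (simp add: cylinder_Nil space_pair_algebra)
  then have "emeasure Q (space Q) = ennreal (1 / M ^ length ([]::nat list)) * emeasure P {\<omega> \<in> space \<A>. \<omega> []}"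
    using emeasure_Q_box[OF Nil_word determined_space] by simp
  also have "emeasure P {\<omega> \<in> space \<A>. \<omega> []} = 1"
  proof -
    note [measurable] = measurable_config_coordinate[OF Nil_word, of "CARD('n)" k]
    have "AE \<omega> in P. \<omega> []" using AE_hereditary by eventually_elim simp
    then have "AE \<omega> in P. \<omega> \<in> {\<omega> \<in> space \<A>. \<omega> []}" using AE_space by eventually_elim simp
    then show ?thesis by (intro P.emeasure_eq_1_AE) measurable
  qed
  finally show "emeasure Q (space Q) = 1" by simp
qed

lemma prob_word_emeasure: "\<sigma> \<in> W \<Longrightarrow> emeasure P {\<omega> \<in> space \<A>. \<omega> \<sigma>} = ennreal (p ^ length \<sigma>)"
proof -
  assume s: "\<sigma> \<in> W"
  note [measurable] = measurable_config_coordinate[OF s]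
  have "measure P {\<omega> \<in> space \<A>. \<omega> \<sigma>} = (\<integral>\<omega>. indicator {\<omega> \<in> space \<A>. \<omega> \<sigma>} \<omega> \<partial>P)" by simp
  also have "\<dots> = (\<integral>\<omega>. of_bool (\<omega> \<sigma>) \<partial>P)"
    by (intro Bochner_Integration.integral_cong) (auto simp: indicator_def)
  finally show ?thesis using prob_word[OF s] by (simp add: P.emeasure_eq_measure)
qed

text \<open>
  Under \<open>Q\<close> the code is a sequence of independent uniform letters.
\<close>

lemma emeasure_Q_cylinder:
  assumes s: "\<sigma> \<in> W"
  shows "emeasure Q (cyl \<sigma> \<times> space \<A>) = ennreal (1 / (real k ^ CARD('n)) ^ length \<sigma>)"
proof -
  have "emeasure Q (cyl \<sigma> \<times> space \<A>) = ennreal (1 / M ^ length \<sigma>) * ennreal (p ^ length \<sigma>)"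
    using emeasure_Q_box[OF s determined_space] prob_word_emeasure[OF s] by simp
  also have "\<dots> = ennreal (1 / M ^ length \<sigma> * p ^ length \<sigma>)"
    using M_gt_1 p_pos by (intro ennreal_mult[symmetric]) simp_all
  also have "1 / M ^ length \<sigma> * p ^ length \<sigma> = 1 / (real k ^ CARD('n)) ^ length \<sigma>"
    using p_pos by (simp add: M_def power_mult_distrib)
  finally show ?thesis .
qed

end

section \<open>The shift\<close>

lemma code_prefix_add: "code_prefix \<eta> (n + l) = code_prefix \<eta> n @ code_prefix (\<lambda>i. \<eta> (i + n)) l"
  by (induction l) (simp_all add: code_prefix_Suc add.commute)

context branching
begin

text \<open>
  Zooming in to the first cube of the code: the code loses its first letter, and the configuration
  is replaced by its subtree at this letter.
\<close>

definition shift :: "(nat \<Rightarrow> nat) \<times> (nat list \<Rightarrow> bool) \<Rightarrow> (nat \<Rightarrow> nat) \<times> (nat list \<Rightarrow> bool)" where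
  "shift z = (\<lambda>i. fst z (Suc i), sub [fst z 0] (snd z))"

lemma codes_letter: "\<eta> \<in> codes m k \<Longrightarrow> \<eta> i \<in> L"
  by (auto simp: codes_def)

lemma shift_codes: "\<eta> \<in> codes m k \<Longrightarrow> (\<lambda>i. \<eta> (i + n)) \<in> codes m k"
  by (auto simp: codes_def)

lemma shift_funpow:
  assumes "\<eta> \<in> codes m k" "\<omega> \<in> space \<A>"
  shows "(shift ^^ n) (\<eta>, \<omega>) = (\<lambda>i. \<eta> (i + n), sub (code_prefix \<eta> n) \<omega>)"
proof (induction n)
  case 0
  then show ?case using assms(2) by (simp add: subtree_Nil)
next
  case (Suc n)
  have "(shift ^^ Suc n) (\<eta>, \<omega>) = shift (\<lambda>i. \<eta> (i + n), sub (code_prefix \<eta> n) \<omega>)"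
    by (simp only: funpow.simps o_apply Suc)
  also have "\<dots> = (\<lambda>i. \<eta> (Suc i + n), sub [\<eta> n] (sub (code_prefix \<eta> n) \<omega>))"
    by (simp add: shift_def)
  also have "sub [\<eta> n] (sub (code_prefix \<eta> n) \<omega>) = sub (code_prefix \<eta> (Suc n)) \<omega>"
    unfolding code_prefix_Suc
    by (rule subtree_subtree) (simp only: singleton_word codes_letter[OF assms(1)])
  finally show ?case by simp
qed

lemma measurable_shift: "shift \<in> measurable \<S> \<S>"
  unfolding shift_def[abs_def]
proof (rule measurable_Pair)
  have "(\<lambda>z i. fst z (Suc i)) \<in> measurable \<S> (\<Pi>\<^sub>M i\<in>UNIV. count_space L)"
  proof (rule measurable_PiM_single')
    show "(\<lambda>z. fst z (Suc i)) \<in> measurable \<S> (count_space L)" for i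
      by (rule measurable_compose[OF measurable_fst measurable_code_coordinate])
    show "(\<lambda>z i. fst z (Suc i)) \<in> space \<S> \<rightarrow> (\<Pi>\<^sub>E i\<in>UNIV. space (count_space L))"
      using codes_letter by (auto simp: space_pair_algebra)
  qed
  then show "(\<lambda>z i. fst z (Suc i)) \<in> measurable \<S> (code_algebra m k)" by (simp only: code_algebra_def)
  have "(\<lambda>z. \<lambda>\<tau>\<in>W. snd z ([fst z 0] @ \<tau>)) \<in> measurable \<S> (\<Pi>\<^sub>M \<tau>\<in>W. count_space UNIV)"
  proof (rule measurable_restrict)
    fix \<tau> assume t: "\<tau> \<in> W"
    have c: "Measurable.pred \<S> (\<lambda>z. fst z 0 = j)" for j
      by (rule measurable_compose[OF measurable_compose[OF measurable_fst measurable_code_coordinate]]) simp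
    have "Measurable.pred \<S> (\<lambda>z. \<exists>j\<in>L. fst z 0 = j \<and> snd z (j # \<tau>))"
    proof (rule pred_intros_finite)
      show "finite L" by (simp add: letters_def)
      fix j assume "j \<in> L"
      then have "j # \<tau> \<in> W" using t by (auto simp: words_def)
      then have [measurable]: "Measurable.pred \<S> (\<lambda>z. snd z (j # \<tau>))"
        by (rule measurable_compose[OF measurable_snd measurable_config_coordinate])
      note [measurable] = c
      show "Measurable.pred \<S> (\<lambda>z. fst z 0 = j \<and> snd z (j # \<tau>))" by measurable
    qed
    then show "Measurable.pred \<S> (\<lambda>z. snd z ([fst z 0] @ \<tau>))"
    proof (rule measurable_cong[THEN iffD2, rotated])
      fix z assume "z \<in> space \<S>"
      then have "fst z 0 \<in> L" using codes_letter by (auto simp: space_pair_algebra)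
      then show "snd z ([fst z 0] @ \<tau>) = (\<exists>j\<in>L. fst z 0 = j \<and> snd z (j # \<tau>))" by simp
    qed
  qed
  then show "(\<lambda>z. sub [fst z 0] (snd z)) \<in> measurable \<S> \<A>"
    by (simp only: subtree_def config_algebra_def)
qed

end

context mandelbrot
begin

interpretation QP: prob_space Q by (rule prob_space_Q)

lemma shift_measurable_Q [measurable]: "shift \<in> measurable Q Q"
  using measurable_shift by (simp cong: measurable_cong_sets)

lemma funpow_shift_measurable: "(shift ^^ n) \<in> measurable \<S> \<S>"
proof (induction n)
  case (Suc n)
  show ?case unfolding funpow.simps by (rule measurable_comp[OF Suc measurable_shift])
qed simp

lemma shifted_box:
  assumes s: "\<sigma> \<in> W"
  shows "(cyl \<sigma> \<times> E) \<inter> (shift ^^ length \<sigma>) -` (cyl \<tau> \<times> E') \<inter> space \<S> =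
    cyl (\<sigma> @ \<tau>) \<times> {\<omega> \<in> E \<inter> space \<A>. sub \<sigma> \<omega> \<in> E'}"
proof (intro set_eqI)
  fix z :: "(nat \<Rightarrow> nat) \<times> (nat list \<Rightarrow> bool)"
  obtain \<eta> \<omega> where z: "z = (\<eta>, \<omega>)" by (cases z)
  show "z \<in> (cyl \<sigma> \<times> E) \<inter> (shift ^^ length \<sigma>) -` (cyl \<tau> \<times> E') \<inter> space \<S> \<longleftrightarrow>
    z \<in> cyl (\<sigma> @ \<tau>) \<times> {\<omega> \<in> E \<inter> space \<A>. sub \<sigma> \<omega> \<in> E'}"
  proof (cases "\<eta> \<in> codes CARD('n) k \<and> \<omega> \<in> space \<A>")
    case True
    have sp: "z \<in> space \<S>" using True by (simp add: z space_pair_algebra)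
    have c1: "\<eta> \<in> cyl (\<sigma> @ \<tau>) \<longleftrightarrow> code_prefix \<eta> (length \<sigma>) = \<sigma> \<and> code_prefix (\<lambda>i. \<eta> (i + length \<sigma>)) (length \<tau>) = \<tau>"
      using True by (simp add: cylinder_def code_prefix_add)
    have c2: "\<eta> \<in> cyl \<sigma> \<longleftrightarrow> code_prefix \<eta> (length \<sigma>) = \<sigma>" using True by (simp add: cylinder_def)
    have c3: "(\<lambda>i. \<eta> (i + length \<sigma>)) \<in> cyl \<tau> \<longleftrightarrow> code_prefix (\<lambda>i. \<eta> (i + length \<sigma>)) (length \<tau>) = \<tau>"
      using True shift_codes by (simp add: cylinder_def)
    have f: "(shift ^^ length \<sigma>) z = (\<lambda>i. \<eta> (i + length \<sigma>), sub (code_prefix \<eta> (length \<sigma>)) \<omega>)"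
      unfolding z using True by (intro shift_funpow) simp_all
    show ?thesis
      using True sp unfolding Int_iff vimage_eq f unfolding z mem_Times_iff fst_conv snd_conv c1 c2 c3
      by (cases "code_prefix \<eta> (length \<sigma>) = \<sigma>") auto
  next
    case False
    then show ?thesis unfolding z by (auto simp: space_pair_algebra cylinder_def)
  qed
qed

text \<open>
  For boxes \<open>B\<close> the two sides are computed by the mass formula: the intersection is a box again, and
  grafting at \<open>\<sigma>\<close> shows that what happens up to \<open>\<sigma>\<close> is independent of the subtree at a chosen \<open>\<sigma>\<close>.
  Both sides are finite measures in \<open>B\<close>, so they agree on the whole product algebra.
\<close>

lemma mixing:
  assumes s: "\<sigma> \<in> W" and E: "determined CARD('n) k (length \<sigma>) E" and B: "B \<in> sets \<S>"
  shows "emeasure Q ((cyl \<sigma> \<times> E) \<inter> ((shift ^^ length \<sigma>) -` B \<inter> space \<S>)) =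
    emeasure Q (cyl \<sigma> \<times> E) * emeasure Q B"
proof -
  define A where "A = cyl \<sigma> \<times> E"
  define T where "T = shift ^^ length \<sigma>"
  have A [measurable]: "A \<in> sets \<S>" unfolding A_def by (rule box_sets[OF boxI[OF s E]])
  have T: "T \<in> measurable \<S> \<S>" unfolding T_def by (rule funpow_shift_measurable)
  define N1 where "N1 = distr (density Q (indicator A)) \<S> T"
  define N2 where "N2 = scale_measure (emeasure Q A) Q"
  have N1: "emeasure N1 B = emeasure Q (A \<inter> (T -` B \<inter> space \<S>))" if B: "B \<in> sets \<S>" for B
  proof -
    have TB: "T -` B \<inter> space \<S> \<in> sets \<S>" using T B by (rule measurable_sets)
    have Tm: "T \<in> measurable (density Q (indicator A)) \<S>"
      using T by (simp cong: measurable_cong_sets)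
    have "emeasure N1 B = emeasure (density Q (indicator A)) (T -` B \<inter> space \<S>)"
      unfolding N1_def using B by (subst emeasure_distr[OF Tm]) simp_all
    also have "\<dots> = (\<integral>\<^sup>+z. indicator A z * indicator (T -` B \<inter> space \<S>) z \<partial>Q)"
      using TB by (intro emeasure_density) simp_all
    also have "\<dots> = (\<integral>\<^sup>+z. indicator (A \<inter> (T -` B \<inter> space \<S>)) z \<partial>Q)"
      by (simp only: indicator_inter_arith)
    also have "\<dots> = emeasure Q (A \<inter> (T -` B \<inter> space \<S>))"
      using TB A by (intro nn_integral_indicator) simp
    finally show ?thesis .
  qed
  have "N1 = N2"
  proof (rule pair_measure_eqI)
    show "sets N1 = sets \<S>" "sets N2 = sets \<S>" by (simp_all add: N1_def N2_def)
    have "emeasure N1 (space \<S>) \<le> emeasure Q (space Q)"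
      unfolding N1[OF sets.top] by (rule emeasure_space)
    then show "emeasure N1 (space \<S>) \<noteq> \<infinity>"
      using QP.emeasure_space_1 by (auto simp: top_unique)
    fix B assume "B \<in> boxes CARD('n) k"
    then obtain \<tau> E' where t: "\<tau> \<in> W" and E': "determined CARD('n) k (length \<tau>) E'" and Beq: "B = cyl \<tau> \<times> E'"
      by (rule boxE)
    define F where "F = {\<omega> \<in> E \<inter> space \<A>. sub \<sigma> \<omega> \<in> E'}"
    have st: "\<sigma> @ \<tau> \<in> W" using s t by (simp add: append_in_words)
    have F: "determined CARD('n) k (length (\<sigma> @ \<tau>)) F"
    proof (rule determinedI)
      show "F \<subseteq> space \<A>" by (auto simp: F_def)
      fix \<omega> \<omega>' assume w: "\<omega> \<in> space \<A>" "\<omega>' \<in> space \<A>"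
        and eq: "\<And>\<upsilon>. \<upsilon> \<in> W \<Longrightarrow> length \<upsilon> \<le> length (\<sigma> @ \<tau>) \<Longrightarrow> \<omega> \<upsilon> = \<omega>' \<upsilon>"
      have 1: "\<omega> \<in> E \<longleftrightarrow> \<omega>' \<in> E" by (rule determinedD[OF E w]) (simp add: eq)
      have 2: "sub \<sigma> \<omega> \<in> E' \<longleftrightarrow> sub \<sigma> \<omega>' \<in> E'"
      proof (rule determinedD[OF E' subtree_space subtree_space])
        fix \<upsilon> assume u: "\<upsilon> \<in> W" "length \<upsilon> \<le> length \<tau>"
        then have "\<omega> (\<sigma> @ \<upsilon>) = \<omega>' (\<sigma> @ \<upsilon>)" using s by (intro eq) (simp_all add: append_in_words)
        then show "sub \<sigma> \<omega> \<upsilon> = sub \<sigma> \<omega>' \<upsilon>" using u by (simp add: subtree_def)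
      qed
      show "\<omega> \<in> F \<longleftrightarrow> \<omega>' \<in> F" unfolding F_def using 1 2 w by simp
    qed
    note [measurable] = determined_sets[OF E] determined_sets[OF E'] determined_sets[OF F]
      measurable_config_coordinate[OF s] measurable_config_coordinate[OF t] measurable_config_coordinate[OF st]
    have m1 [measurable]: "{\<omega> \<in> E. \<omega> \<sigma>} \<in> sets \<A>"
    proof -
      have "{\<omega> \<in> E. \<omega> \<sigma>} = {\<omega> \<in> space \<A>. \<omega> \<in> E \<and> \<omega> \<sigma>}" using determined_subset[OF E] by blast
      also have "\<dots> \<in> sets \<A>" by measurable
      finally show ?thesis .
    qed
    have m2 [measurable]: "{\<omega> \<in> E'. \<omega> \<tau>} \<in> sets \<A>"
    proof -
      have "{\<omega> \<in> E'. \<omega> \<tau>} = {\<omega> \<in> space \<A>. \<omega> \<in> E' \<and> \<omega> \<tau>}" using determined_subset[OF E'] by blast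
      also have "\<dots> \<in> sets \<A>" by measurable
      finally show ?thesis .
    qed
    have m3 [measurable]: "{\<omega> \<in> F. \<omega> (\<sigma> @ \<tau>)} \<in> sets \<A>"
    proof -
      have "{\<omega> \<in> F. \<omega> (\<sigma> @ \<tau>)} = {\<omega> \<in> space \<A>. \<omega> \<in> F \<and> \<omega> (\<sigma> @ \<tau>)}" using determined_subset[OF F] by blast
      also have "\<dots> \<in> sets \<A>" by measurable
      finally show ?thesis .
    qed
    have "(\<integral>\<^sup>+\<omega>. indicator {\<omega> \<in> F. \<omega> (\<sigma> @ \<tau>)} \<omega> \<partial>P) =
        (\<integral>\<^sup>+\<omega>. indicator {\<omega> \<in> E. \<omega> \<sigma>} \<omega> \<partial>P) * (\<integral>\<^sup>+\<omega>. indicator {\<omega> \<in> E'. \<omega> \<tau>} \<omega> \<partial>P)"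
    proof (rule nn_integral_graft_product[OF s])
      fix \<omega> \<omega>' assume w: "\<omega> \<in> space \<A>" "\<omega>' \<in> space \<A>" "\<omega>' []"
      let ?g = "graft CARD('n) k \<sigma> (\<omega>, \<omega>')"
      have 1: "?g \<in> E \<longleftrightarrow> \<omega> \<in> E" using determined_graft[OF E s w(1), of \<omega>'] w(3) by simp
      have 2: "?g (\<sigma> @ \<tau>) \<longleftrightarrow> \<omega> \<sigma> \<and> \<omega>' \<tau>" using st by (simp add: graft_def)
      have 3: "\<omega> \<sigma> \<Longrightarrow> sub \<sigma> ?g = \<omega>'" using subtree_graft[OF s w(2), of \<omega>] by simp
      have "?g \<in> {\<omega> \<in> F. \<omega> (\<sigma> @ \<tau>)} \<longleftrightarrow> \<omega> \<in> {\<omega> \<in> E. \<omega> \<sigma>} \<and> \<omega>' \<in> {\<omega> \<in> E'. \<omega> \<tau>}"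
        using 3 by (auto simp: F_def 1 2 graft_space)
      then show "indicator {\<omega> \<in> F. \<omega> (\<sigma> @ \<tau>)} ?g =
          (indicator {\<omega> \<in> E. \<omega> \<sigma>} \<omega> * indicator {\<omega> \<in> E'. \<omega> \<tau>} \<omega>' :: ennreal)"
        by (simp add: indicator_def)
    qed measurable
    then have PF: "emeasure P {\<omega> \<in> F. \<omega> (\<sigma> @ \<tau>)} = emeasure P {\<omega> \<in> E. \<omega> \<sigma>} * emeasure P {\<omega> \<in> E'. \<omega> \<tau>}"
      by simp
    have Bs: "B \<in> sets \<S>" unfolding Beq by (rule box_sets[OF boxI[OF t E']])
    have "emeasure N1 B = emeasure Q (A \<inter> (T -` B \<inter> space \<S>))" by (rule N1[OF Bs])
    also have "\<dots> = emeasure Q (cyl (\<sigma> @ \<tau>) \<times> F)"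
      unfolding A_def T_def F_def Beq shifted_box[OF s, symmetric] by (simp only: Int_assoc)
    also have "\<dots> = ennreal (1 / M ^ length (\<sigma> @ \<tau>)) * emeasure P {\<omega> \<in> F. \<omega> (\<sigma> @ \<tau>)}"
      by (rule emeasure_Q_box[OF st F])
    also have "ennreal (1 / M ^ length (\<sigma> @ \<tau>)) = ennreal (1 / M ^ length \<sigma>) * ennreal (1 / M ^ length \<tau>)"
      using M_gt_1 by (simp add: power_add ennreal_mult[symmetric])
    also have "\<dots> * emeasure P {\<omega> \<in> F. \<omega> (\<sigma> @ \<tau>)} = emeasure Q A * emeasure Q B"
      unfolding PF A_def Beq emeasure_Q_box[OF s E] emeasure_Q_box[OF t E'] by (simp only: mult_ac)
    finally show "emeasure N1 B = emeasure N2 B" by (simp add: N2_def)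
  qed
  then have "emeasure N1 B = emeasure N2 B" by (simp only:)
  then show ?thesis unfolding N1[OF B] by (simp add: N2_def A_def T_def)
qed

text \<open>
  The identity of the previous lemma is summed over the cylinders of the first level.
\<close>

lemma shift_preserves: "distr Q Q shift = Q"
proof (rule measure_eqI)
  fix B assume "B \<in> sets (distr Q Q shift)"
  then have B: "B \<in> sets \<S>" by simp
  define V where "V = shift -` B \<inter> space \<S>"
  have V: "V \<in> sets \<S>" unfolding V_def using measurable_shift B by (rule measurable_sets)
  let ?I = "level CARD('n) k 1"
  let ?C = "\<lambda>\<sigma>. cyl \<sigma> \<times> space \<A>"
  have C: "?C \<sigma> \<in> sets \<S>" if "\<sigma> \<in> ?I" for \<sigma>
    using that by (intro box_sets boxI determined_space) simp
  have disj: "disjoint_family_on ?C ?I"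
    unfolding disjoint_family_on_def
  proof (intro ballI impI)
    fix \<sigma> \<tau> assume "\<sigma> \<in> ?I" "\<tau> \<in> ?I" "\<sigma> \<noteq> \<tau>"
    then have "cyl \<sigma> \<inter> cyl \<tau> = {}" by (intro equals0I) (simp add: cylinder_def, blast)
    then show "?C \<sigma> \<inter> ?C \<tau> = {}" by (simp only: Times_Int_Times Sigma_empty1)
  qed
  have cover: "(\<Union>\<sigma>\<in>?I. ?C \<sigma>) = space \<S>"
    unfolding space_pair_algebra codes_eq_UN_cylinder[of "CARD('n)" k 1] by blast
  have "emeasure (distr Q Q shift) B = emeasure Q V"
    unfolding V_def using B by (subst emeasure_distr) simp_all
  also have "V = (\<Union>\<sigma>\<in>?I. ?C \<sigma> \<inter> V)"
  proof -
    have "(\<Union>\<sigma>\<in>?I. ?C \<sigma> \<inter> V) = space \<S> \<inter> V" unfolding cover[symmetric] by (simp only: UN_simps)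
    also have "\<dots> = V" using sets.sets_into_space[OF V] by (rule Int_absorb1)
    finally show ?thesis by (rule sym)
  qed
  also have "emeasure Q \<dots> = (\<Sum>\<sigma>\<in>?I. emeasure Q (?C \<sigma> \<inter> V))"
  proof (rule sum_emeasure[symmetric])
    show "(\<lambda>\<sigma>. ?C \<sigma> \<inter> V) ` ?I \<subseteq> sets Q"
      unfolding sets_Q by (intro image_subsetI sets.Int C V)
    show "disjoint_family_on (\<lambda>\<sigma>. ?C \<sigma> \<inter> V) ?I"
      by (rule disjoint_family_on_bisimulation[OF disj]) blast
  qed (rule finite_level)
  also have "\<dots> = (\<Sum>\<sigma>\<in>?I. emeasure Q (?C \<sigma>) * emeasure Q B)"
  proof (rule sum.cong[OF refl])
    fix \<sigma> assume s: "\<sigma> \<in> ?I"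
    then have "\<sigma> \<in> W" and l: "length \<sigma> = 1" by simp_all
    have f1: "shift ^^ length \<sigma> = shift" unfolding l by (simp add: fun_eq_iff)
    show "emeasure Q (?C \<sigma> \<inter> V) = emeasure Q (?C \<sigma>) * emeasure Q B"
      using mixing[OF \<open>\<sigma> \<in> W\<close> determined_space B] unfolding f1 V_def .
  qed
  also have "\<dots> = (\<Sum>\<sigma>\<in>?I. emeasure Q (?C \<sigma>)) * emeasure Q B"
    by (rule sum_distrib_right[symmetric])
  also have "(\<Sum>\<sigma>\<in>?I. emeasure Q (?C \<sigma>)) = emeasure Q (\<Union>\<sigma>\<in>?I. ?C \<sigma>)"
    by (intro sum_emeasure disj finite_level image_subsetI) (simp only: sets_Q C)
  also have "\<dots> = 1" unfolding cover using QP.emeasure_space_1 by simp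
  finally show "emeasure (distr Q Q shift) B = emeasure Q B" by simp
qed simp

text \<open>
  An invariant set is its own preimage under all iterates of the shift, hence independent of every
  box, hence of every set and in particular of itself.
\<close>

lemma shift_ergodic:
  assumes B: "B \<in> sets Q" and inv: "shift -` B \<inter> space Q = B"
  shows "QP.prob B = 0 \<or> QP.prob B = 1"
proof -
  have BS: "B \<in> sets \<S>" using B by simp
  have invn: "(shift ^^ n) -` B \<inter> space \<S> = B" for n
  proof (induction n)
    case 0
    show ?case using sets.sets_into_space[OF BS] by auto
  next
    case (Suc n)
    have "(shift ^^ Suc n) -` B \<inter> space \<S> = (shift ^^ n) -` (shift -` B \<inter> space \<S>) \<inter> space \<S>"
      using measurable_space[OF funpow_shift_measurable[of n]] by auto
    also have "shift -` B \<inter> space \<S> = B" using inv by simp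
    finally show ?case using Suc by simp
  qed
  have "density Q (indicator B) = scale_measure (emeasure Q B) Q"
  proof (rule pair_measure_eqI)
    have d: "emeasure (density Q (indicator B)) A = emeasure Q (A \<inter> B)" if A: "A \<in> sets \<S>" for A
    proof -
      have "emeasure (density Q (indicator B)) A = (\<integral>\<^sup>+z. indicator B z * indicator A z \<partial>Q)"
        using A B by (intro emeasure_density) simp_all
      also have "\<dots> = (\<integral>\<^sup>+z. indicator (A \<inter> B) z \<partial>Q)"
        by (simp only: indicator_inter_arith mult.commute)
      also have "\<dots> = emeasure Q (A \<inter> B)" using A BS by (intro nn_integral_indicator) simp
      finally show ?thesis .
    qed
    have "emeasure (density Q (indicator B)) (space \<S>) \<le> emeasure Q (space Q)"
      unfolding d[OF sets.top] by (rule emeasure_space)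
    then show "emeasure (density Q (indicator B)) (space \<S>) \<noteq> \<infinity>"
      using QP.emeasure_space_1 by (auto simp: top_unique)
    fix A assume A: "A \<in> boxes CARD('n) k"
    then obtain \<sigma> E where s: "\<sigma> \<in> W" and E: "determined CARD('n) k (length \<sigma>) E" and Aeq: "A = cyl \<sigma> \<times> E"
      by (rule boxE)
    have "emeasure Q (A \<inter> B) = emeasure Q A * emeasure Q B"
      using mixing[OF s E BS] unfolding invn Aeq .
    then show "emeasure (density Q (indicator B)) A = emeasure (scale_measure (emeasure Q B) Q) A"
      using d[OF box_sets[OF A]] by (simp add: mult.commute)
  qed simp_all
  then have "emeasure (density Q (indicator B)) B = emeasure (scale_measure (emeasure Q B) Q) B"
    by (rule arg_cong)
  moreover have "emeasure (density Q (indicator B)) B = emeasure Q B"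
  proof -
    have "emeasure (density Q (indicator B)) B = (\<integral>\<^sup>+z. indicator B z * indicator B z \<partial>Q)"
      using B by (intro emeasure_density) simp_all
    also have "\<dots> = (\<integral>\<^sup>+z. indicator (B \<inter> B) z \<partial>Q)" by (simp only: indicator_inter_arith)
    also have "\<dots> = emeasure Q (B \<inter> B)" using B by (intro nn_integral_indicator) simp
    finally show ?thesis by simp
  qed
  ultimately have "emeasure Q B = emeasure Q B * emeasure Q B" by simp
  then have "ennreal (QP.prob B) = ennreal (QP.prob B * QP.prob B)"
    unfolding QP.emeasure_eq_measure by (simp add: ennreal_mult)
  then have "QP.prob B = QP.prob B * QP.prob B"
    by (subst (asm) ennreal_inj) simp_all
  then show ?thesis by (simp only: mult_cancel_left1)
qed

lemma ergodic_shift: "ergodic_system Q shift"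
  by (intro ergodic_system.intro ergodic_system_axioms.intro prob_space_Q shift_measurable_Q
      shift_preserves shift_ergodic)

text \<open>
  The letters are uniform and independent, so the first \<open>l\<close> letters from position \<open>N\<close> on all belong
  to \<open>J\<close> with probability \<open>(card J / card L)^l\<close>, which tends to zero.
\<close>

lemma emeasure_Q_restricted_letters:
  assumes J: "J \<subseteq> L" "card J < card L"
  shows "{\<eta> \<in> codes CARD('n) k. \<forall>n\<ge>N. \<eta> n \<in> J} \<in> sets (code_algebra CARD('n) k)"
    and "emeasure Q ({\<eta> \<in> codes CARD('n) k. \<forall>n\<ge>N. \<eta> n \<in> J} \<times> space \<A>) = 0"
proof -
  define B where "B = {\<eta> \<in> codes CARD('n) k. \<forall>n\<ge>N. \<eta> n \<in> J}"
  have c: "Measurable.pred (code_algebra CARD('n) k) (\<lambda>\<eta>. \<eta> n \<in> J)" for n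
    by (rule measurable_compose[OF measurable_code_coordinate]) simp
  have Beq: "B = {\<eta> \<in> space (code_algebra CARD('n) k). \<forall>n. n \<ge> N \<longrightarrow> \<eta> n \<in> J}"
    by (simp add: B_def space_code)
  have "B \<in> sets (code_algebra CARD('n) k)"
  proof -
    note [measurable] = c
    show ?thesis unfolding Beq by measurable
  qed
  then show "{\<eta> \<in> codes CARD('n) k. \<forall>n\<ge>N. \<eta> n \<in> J} \<in> sets (code_algebra CARD('n) k)"
    by (simp only: B_def)
  define K where "K = real k ^ CARD('n)"
  have cL: "real (card L) = K" by (simp add: letters_def K_def)
  have finJ: "finite J" using J(1) by (rule finite_subset) (simp add: letters_def)
  define q where "q = real (card J) / K"
  have K0: "K > 0" using k2 by (simp add: K_def)
  have q: "0 \<le> q" "q < 1" using J(2) cL K0 by (simp_all add: q_def divide_less_eq)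
  have bound: "emeasure Q (B \<times> space \<A>) \<le> ennreal (q ^ l)" for l
  proof -
    define S where "S = (\<lambda>(\<sigma>, \<tau>). \<sigma> @ \<tau>) ` (level CARD('n) k N \<times> {\<tau>. set \<tau> \<subseteq> J \<and> length \<tau> = l})"
    have SW: "\<sigma> \<in> W \<and> length \<sigma> = N + l" if \<sigma>S: "\<sigma> \<in> S" for \<sigma>
    proof -
      obtain x where x: "x \<in> level CARD('n) k N \<times> {\<tau>. set \<tau> \<subseteq> J \<and> length \<tau> = l}"
        "\<sigma> = (\<lambda>(\<sigma>, \<tau>). \<sigma> @ \<tau>) x"
        using \<sigma>S[unfolded S_def image_iff] by (rule bexE)
      obtain \<rho> \<tau> where "x = (\<rho>, \<tau>)" by (cases x)
      then have r: "\<sigma> = \<rho> @ \<tau>" "\<rho> \<in> W" "length \<rho> = N" "set \<tau> \<subseteq> J" "length \<tau> = l"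
        using x by simp_all
      have "\<tau> \<in> W" using r(4) J(1) by (auto simp: words_def)
      then show ?thesis using r by (simp add: append_in_words)
    qed
    have CS: "cyl \<sigma> \<times> space \<A> \<in> sets \<S>" if "\<sigma> \<in> S" for \<sigma>
      using SW[OF that] by (intro box_sets boxI determined_space) simp
    have finS: "finite S" unfolding S_def by (intro finite_imageI finite_cartesian_product finite_level finite_lists_length_eq finJ)
    have "card S \<le> card (level CARD('n) k N \<times> {\<tau>. set \<tau> \<subseteq> J \<and> length \<tau> = l})"
      unfolding S_def by (intro card_image_le finite_cartesian_product finite_level finite_lists_length_eq finJ)
    also have "\<dots> = (k ^ CARD('n)) ^ N * card J ^ l"
      by (simp only: card_cartesian_product card_level card_lists_length_eq[OF finJ])
    finally have "real (card S) \<le> real ((k ^ CARD('n)) ^ N * card J ^ l)" by (simp only: of_nat_le_iff)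
    then have cardS: "real (card S) \<le> K ^ N * real (card J) ^ l" by (simp add: K_def)
    have "B \<times> space \<A> \<subseteq> (\<Union>\<sigma>\<in>S. cyl \<sigma> \<times> space \<A>)"
    proof
      fix z assume "z \<in> B \<times> space \<A>"
      then obtain \<eta> \<omega> where z: "z = (\<eta>, \<omega>)" "\<eta> \<in> codes CARD('n) k" "\<forall>n\<ge>N. \<eta> n \<in> J" "\<omega> \<in> space \<A>"
        by (auto simp: B_def)
      have "code_prefix \<eta> (N + l) \<in> S"
        unfolding S_def code_prefix_add
      proof (rule image_eqI[of _ _ "(code_prefix \<eta> N, code_prefix (\<lambda>i. \<eta> (i + N)) l)"])
        have "set (code_prefix (\<lambda>i. \<eta> (i + N)) l) \<subseteq> J"
          using z(3) unfolding code_prefix_def by (simp add: image_subset_iff)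
        then show "(code_prefix \<eta> N, code_prefix (\<lambda>i. \<eta> (i + N)) l) \<in>
            level CARD('n) k N \<times> {\<tau>. set \<tau> \<subseteq> J \<and> length \<tau> = l}"
          using code_prefix_level[OF z(2)] by simp
      qed simp
      moreover have "z \<in> cyl (code_prefix \<eta> (N + l)) \<times> space \<A>"
        using z by (simp add: cylinder_def)
      ultimately show "z \<in> (\<Union>\<sigma>\<in>S. cyl \<sigma> \<times> space \<A>)" by (rule UN_I)
    qed
    then have "emeasure Q (B \<times> space \<A>) \<le> emeasure Q (\<Union>\<sigma>\<in>S. cyl \<sigma> \<times> space \<A>)"
      by (rule emeasure_mono) (simp only: sets_Q, intro sets.finite_UN finS CS)
    also have "\<dots> \<le> (\<Sum>\<sigma>\<in>S. emeasure Q (cyl \<sigma> \<times> space \<A>))"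
      by (rule emeasure_subadditive_finite[OF finS]) (simp only: sets_Q, intro image_subsetI CS)
    also have "\<dots> = (\<Sum>\<sigma>\<in>S. ennreal (1 / K ^ (N + l)))"
    proof (rule sum.cong[OF refl])
      fix \<sigma> assume "\<sigma> \<in> S"
      from SW[OF this] have w: "\<sigma> \<in> W" and l: "length \<sigma> = N + l" by simp_all
      show "emeasure Q (cyl \<sigma> \<times> space \<A>) = ennreal (1 / K ^ (N + l))"
        using emeasure_Q_cylinder[OF w] unfolding l K_def .
    qed
    also have "\<dots> = ennreal (real (card S) * (1 / K ^ (N + l)))"
      using K0 by (simp add: ennreal_of_nat_eq_real_of_nat ennreal_mult[symmetric])
    also have "\<dots> \<le> ennreal (q ^ l)"
    proof (rule ennreal_leI)
      have "real (card S) * (1 / K ^ (N + l)) \<le> (K ^ N * real (card J) ^ l) * (1 / K ^ (N + l))"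
        using cardS K0 by (intro mult_right_mono) simp_all
      also have "\<dots> = q ^ l" using K0 by (simp add: q_def power_add power_divide)
      finally show "real (card S) * (1 / K ^ (N + l)) \<le> q ^ l" .
    qed
    finally show ?thesis .
  qed
  have "(\<lambda>l. ennreal (q ^ l)) \<longlonglongrightarrow> ennreal 0"
    using q by (intro tendsto_ennrealI LIMSEQ_realpow_zero) simp_all
  then have "emeasure Q (B \<times> space \<A>) \<le> ennreal 0"
  proof (rule LIMSEQ_le_const)
    show "\<exists>N. \<forall>n\<ge>N. emeasure Q (B \<times> space \<A>) \<le> ennreal (q ^ n)"
      by (intro exI allI impI) (rule bound)
  qed
  then show "emeasure Q ({\<eta> \<in> codes CARD('n) k. \<forall>n\<ge>N. \<eta> n \<in> J} \<times> space \<A>) = 0"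
    by (simp add: B_def)
qed

end

section \<open>Cubes and coded points\<close>

context mandelbrot
begin

lemma digit_less: "j \<in> L \<Longrightarrow> e j $ i < k"
  using enum unfolding subcube_enumeration_def by (auto dest: bij_betwE)

lemma digits_inj: "j \<in> L \<Longrightarrow> j' \<in> L \<Longrightarrow> e j = e j' \<Longrightarrow> j = j'"
  using enum unfolding subcube_enumeration_def by (auto dest: bij_betw_imp_inj_on inj_onD)

lemma kpow_pos: "0 < real k ^ n"
  using k2 by simp

text \<open>
  The corner of the cube of \<open>\<sigma>\<close> in units of its side length; cubes of the same level are told apart
  by these integers.
\<close>

definition corner_index :: "nat list \<Rightarrow> 'n \<Rightarrow> nat" where
  "corner_index \<sigma> i = foldl (\<lambda>a j. k * a + e j $ i) 0 \<sigma>"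

lemma corner_index_Nil: "corner_index [] i = 0" by (simp add: corner_index_def)

lemma corner_index_snoc: "corner_index (\<sigma> @ [j]) i = k * corner_index \<sigma> i + e j $ i" by (simp add: corner_index_def)

lemma corner_Nil: "corner k e [] $ i = 0"
  by (simp add: corner_def)

lemma corner_snoc: "corner k e (\<sigma> @ [j]) $ i = corner k e \<sigma> $ i + real (e j $ i) / real k ^ Suc (length \<sigma>)"
proof -
  have "(\<Sum>l<length \<sigma>. real (e ((\<sigma> @ [j]) ! l) $ i) / real k ^ Suc l) =
      (\<Sum>l<length \<sigma>. real (e (\<sigma> ! l) $ i) / real k ^ Suc l)"
    by (rule sum.cong) (simp_all add: nth_append)
  then show ?thesis by (simp add: corner_def nth_append)
qed

lemma corner_eq_index: "corner k e \<sigma> $ i = real (corner_index \<sigma> i) / real k ^ length \<sigma>"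
proof (induction \<sigma> rule: rev_induct)
  case Nil
  show ?case by (simp add: corner_Nil corner_index_Nil)
next
  case (snoc j \<sigma>)
  have "real (corner_index (\<sigma> @ [j]) i) / real k ^ length (\<sigma> @ [j]) =
      (real k * real (corner_index \<sigma> i)) / (real k * real k ^ length \<sigma>) + real (e j $ i) / real k ^ Suc (length \<sigma>)"
    by (simp add: corner_index_snoc add_divide_distrib)
  also have "(real k * real (corner_index \<sigma> i)) / (real k * real k ^ length \<sigma>) = corner k e \<sigma> $ i"
    using k2 by (simp add: snoc)
  finally show ?case by (simp only: corner_snoc)
qed

lemma corner_index_less: "\<sigma> \<in> W \<Longrightarrow> corner_index \<sigma> i + 1 \<le> k ^ length \<sigma>"
proof (induction \<sigma> rule: rev_induct)
  case Nil
  show ?case by (simp add: corner_index_Nil)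
next
  case (snoc j \<sigma>)
  then have s: "\<sigma> \<in> W" "j \<in> L" by (simp_all add: append_in_words singleton_word)
  have "corner_index (\<sigma> @ [j]) i + 1 \<le> k * corner_index \<sigma> i + k" using digit_less[OF s(2), of i] by (simp add: corner_index_snoc)
  also have "\<dots> = k * (corner_index \<sigma> i + 1)" by simp
  also have "\<dots> \<le> k * k ^ length \<sigma>" using snoc.IH[OF s(1)] by (rule mult_le_mono2)
  finally show ?case by simp
qed

lemma corner_index_inj:
  "\<sigma> \<in> W \<Longrightarrow> \<tau> \<in> W \<Longrightarrow> length \<sigma> = length \<tau> \<Longrightarrow> (\<And>i. corner_index \<sigma> i = corner_index \<tau> i) \<Longrightarrow> \<sigma> = \<tau>"
proof (induction \<sigma> arbitrary: \<tau> rule: rev_induct)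
  case Nil
  then show ?case by simp
next
  case (snoc j \<sigma>)
  obtain j' \<tau>' where t: "\<tau> = \<tau>' @ [j']" using snoc.prems(3) by (cases \<tau> rule: rev_cases) simp_all
  have s: "\<sigma> \<in> W" "j \<in> L" "\<tau>' \<in> W" "j' \<in> L" "length \<sigma> = length \<tau>'"
    using snoc.prems(1-3) unfolding t by (simp_all add: append_in_words singleton_word)
  have eq: "k * corner_index \<sigma> i + e j $ i = k * corner_index \<tau>' i + e j' $ i" for i
    using snoc.prems(4)[of i] unfolding t by (simp only: corner_index_snoc)
  have l: "e j $ i < k" "e j' $ i < k" for i using digit_less s by simp_all
  have "corner_index \<sigma> i = (k * corner_index \<sigma> i + e j $ i) div k" for i using l(1)[of i] by simp
  moreover have "corner_index \<tau>' i = (k * corner_index \<tau>' i + e j' $ i) div k" for i using l(2)[of i] by simp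
  ultimately have n: "corner_index \<sigma> i = corner_index \<tau>' i" for i by (simp only: eq)
  have "e j $ i = e j' $ i" for i using eq[of i] unfolding n by (simp only: add_left_cancel)
  then have "e j = e j'" by (simp add: vec_eq_iff)
  then have "j = j'" using digits_inj s by simp
  moreover have "\<sigma> = \<tau>'" using s n by (intro snoc.IH) simp_all
  ultimately show ?case by (simp only: t)
qed

lemma corner_append:
  "corner k e (\<sigma> @ \<tau>) $ i = corner k e \<sigma> $ i + corner k e \<tau> $ i / real k ^ length \<sigma>"
proof (induction \<tau> rule: rev_induct)
  case Nil
  show ?case by (simp add: corner_Nil)
next
  case (snoc j \<tau>)
  have "corner k e (\<sigma> @ \<tau> @ [j]) $ i = corner k e (\<sigma> @ \<tau>) $ i + real (e j $ i) / real k ^ Suc (length (\<sigma> @ \<tau>))"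
    using corner_snoc[of "\<sigma> @ \<tau>" j i] by simp
  also have "real (e j $ i) / real k ^ Suc (length (\<sigma> @ \<tau>)) = (real (e j $ i) / real k ^ Suc (length \<tau>)) / real k ^ length \<sigma>"
    by (simp add: power_add mult_ac)
  finally show ?case by (simp only: snoc corner_snoc add_divide_distrib add.assoc)
qed

lemma corner_nonneg: "0 \<le> corner k e \<sigma> $ i"
  unfolding corner_eq_index by simp

lemma corner_upper: "\<sigma> \<in> W \<Longrightarrow> corner k e \<sigma> $ i + 1 / real k ^ length \<sigma> \<le> 1"
proof -
  assume "\<sigma> \<in> W"
  then have "real (corner_index \<sigma> i + 1) \<le> real (k ^ length \<sigma>)" using corner_index_less by (simp only: of_nat_le_iff)
  then show ?thesis unfolding corner_eq_index add_divide_distrib[symmetric] using kpow_pos[of "length \<sigma>"] by simp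
qed

text \<open>
  The affine map from the unit cube onto the cube of \<open>\<sigma>\<close>.  It carries the cube of \<open>\<tau>\<close> to the cube of
  \<open>\<sigma> @ \<tau>\<close>.
\<close>

definition embed :: "nat list \<Rightarrow> real ^ 'n \<Rightarrow> real ^ 'n" where
  "embed \<sigma> y = (\<chi> i. corner k e \<sigma> $ i + y $ i / real k ^ length \<sigma>)"

lemma embed_component: "embed \<sigma> y $ i = corner k e \<sigma> $ i + y $ i / real k ^ length \<sigma>"
  by (simp add: embed_def)

lemma embed_surj: "\<exists>y. x = embed \<sigma> y"
proof
  show "x = embed \<sigma> (\<chi> i. (x $ i - corner k e \<sigma> $ i) * real k ^ length \<sigma>)"
    using kpow_pos[of "length \<sigma>"] by (simp add: vec_eq_iff embed_component)
qed

lemma mem_cube: "x \<in> cube k e \<sigma> \<longleftrightarrow> (\<forall>i. corner k e \<sigma> $ i \<le> x $ i \<and> x $ i \<le> corner k e \<sigma> $ i + 1 / real k ^ length \<sigma>)"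
  by (simp add: cube_def)

lemma embed_mem_cube: "embed \<sigma> y \<in> cube k e (\<sigma> @ \<tau>) \<longleftrightarrow> y \<in> cube k e \<tau>"
proof -
  let ?s = "real k ^ length \<sigma>"
  have s: "0 < ?s" by (rule kpow_pos)
  have "1 / real k ^ length (\<sigma> @ \<tau>) = (1 / real k ^ length \<tau>) / ?s" by (simp add: power_add mult.commute)
  then have "(corner k e (\<sigma> @ \<tau>) $ i \<le> embed \<sigma> y $ i \<and>
      embed \<sigma> y $ i \<le> corner k e (\<sigma> @ \<tau>) $ i + 1 / real k ^ length (\<sigma> @ \<tau>)) \<longleftrightarrow>
      (corner k e \<tau> $ i / ?s \<le> y $ i / ?s \<and> y $ i / ?s \<le> (corner k e \<tau> $ i + 1 / real k ^ length \<tau>) / ?s)" for i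
    unfolding corner_append embed_component add_divide_distrib by simp
  then show ?thesis unfolding mem_cube using s by (simp only: divide_le_cancel) simp
qed

lemma cube_unit: "\<tau> \<in> W \<Longrightarrow> y \<in> cube k e \<tau> \<Longrightarrow> 0 \<le> y $ i \<and> y $ i \<le> 1"
  using corner_nonneg[of \<tau> i] corner_upper[of \<tau> i] unfolding mem_cube by (meson order_trans)

lemma cube_antimono:
  assumes "\<tau> \<in> W" shows "cube k e (\<sigma> @ \<tau>) \<subseteq> cube k e \<sigma>"
proof
  fix x assume x: "x \<in> cube k e (\<sigma> @ \<tau>)"
  obtain y where y: "x = embed \<sigma> y" using embed_surj by blast
  have "y \<in> cube k e \<tau>" using x unfolding y by (simp only: embed_mem_cube)
  then have "y \<in> cube k e []" using cube_unit[OF assms] by (simp add: cube_Nil)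
  then have "embed \<sigma> y \<in> cube k e (\<sigma> @ [])" by (simp only: embed_mem_cube)
  then show "x \<in> cube k e \<sigma>" by (simp add: y)
qed

lemma cube_prefix:
  assumes "\<tau> \<in> W" shows "cube k e \<tau> \<subseteq> cube k e (take n \<tau>)"
  using cube_antimono[of "drop n \<tau>" "take n \<tau>"] drop_word[OF assms, of n] by simp

lemma cube_interior_unique:
  assumes s: "\<sigma> \<in> W" and t: "\<tau> \<in> W" and l: "length \<tau> = length \<sigma>"
    and y: "\<And>i. 0 < y $ i \<and> y $ i < 1" and x: "embed \<sigma> y \<in> cube k e \<tau>"
  shows "\<tau> = \<sigma>"
proof (rule corner_index_inj[OF t s l])
  fix i
  let ?s = "real k ^ length \<sigma>"
  have pos: "0 < ?s" by (rule kpow_pos)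
  have "real (corner_index \<tau> i) / ?s \<le> (real (corner_index \<sigma> i) + y $ i) / ?s"
    "(real (corner_index \<sigma> i) + y $ i) / ?s \<le> (real (corner_index \<tau> i) + 1) / ?s"
    using x[unfolded mem_cube] unfolding embed_component corner_eq_index l add_divide_distrib by blast+
  then have "real (corner_index \<tau> i) \<le> real (corner_index \<sigma> i) + y $ i" "real (corner_index \<sigma> i) + y $ i \<le> real (corner_index \<tau> i) + 1"
    using pos by (simp_all only: divide_le_cancel)
  then show "corner_index \<tau> i = corner_index \<sigma> i" using y[of i] by linarith
qed

text \<open>
  The point \<open>x(\<eta>)\<close> through its \<open>k\<close>-adic expansion.
\<close>

definition pt :: "(nat \<Rightarrow> nat) \<Rightarrow> real ^ 'n" where
  "pt \<eta> = (\<chi> i. \<Sum>l. real (e (\<eta> l) $ i) / real k ^ Suc l)"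

lemma corner_code_prefix:
  "corner k e (code_prefix \<eta> n) $ i = (\<Sum>l<n. real (e (\<eta> l) $ i) / real k ^ Suc l)"
  by (induction n) (simp_all add: corner_Nil code_prefix_Suc corner_snoc)

lemma corner_prefix_upper_step:
  assumes "\<eta> \<in> codes CARD('n) k"
  shows "corner k e (code_prefix \<eta> (Suc n)) $ i + 1 / real k ^ Suc n =
      corner k e (code_prefix \<eta> n) $ i + 1 / real k ^ n - (real k - 1 - real (e (\<eta> n) $ i)) / real k ^ Suc n"
proof -
  have "1 / real k ^ n = real k / real k ^ Suc n" using k2 by simp
  then show ?thesis unfolding code_prefix_Suc corner_snoc by (simp add: diff_divide_distrib)
qed

lemma digit_le: "\<eta> \<in> codes CARD('n) k \<Longrightarrow> real (e (\<eta> n) $ i) \<le> real k - 1"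
proof -
  assume "\<eta> \<in> codes CARD('n) k"
  then have "\<eta> n \<in> L" by (auto simp: codes_def)
  from digit_less[OF this, of i] show ?thesis by linarith
qed

lemma corner_prefix_upper_antimono:
  assumes h: "\<eta> \<in> codes CARD('n) k" and "n \<le> n'"
  shows "corner k e (code_prefix \<eta> n') $ i + 1 / real k ^ n' \<le> corner k e (code_prefix \<eta> n) $ i + 1 / real k ^ n"
  using assms(2)
proof (induction n' rule: dec_induct)
  case (step n')
  have "0 \<le> (real k - 1 - real (e (\<eta> n') $ i)) / real k ^ Suc n'" using digit_le[OF h, of n' i] by simp
  then show ?case using step.IH unfolding corner_prefix_upper_step[OF h] by linarith
qed simp

lemma corner_prefix_bound:
  assumes h: "\<eta> \<in> codes CARD('n) k" and "n \<le> n'"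
  shows "corner k e (code_prefix \<eta> n') $ i \<le> corner k e (code_prefix \<eta> n) $ i + 1 / real k ^ n"
proof -
  have "0 \<le> 1 / real k ^ n'" by simp
  then show ?thesis using corner_prefix_upper_antimono[OF assms, of i] by linarith
qed

lemma corner_prefix_tendsto:
  assumes h: "\<eta> \<in> codes CARD('n) k"
  shows "(\<lambda>n. corner k e (code_prefix \<eta> n) $ i) \<longlonglongrightarrow> pt \<eta> $ i"
proof -
  have "summable (\<lambda>l. real (e (\<eta> l) $ i) / real k ^ Suc l)"
  proof (rule summableI_nonneg_bounded)
    show "0 \<le> real (e (\<eta> n) $ i) / real k ^ Suc n" for n by simp
    show "(\<Sum>l<n. real (e (\<eta> l) $ i) / real k ^ Suc l) \<le> 1" for n
      using corner_prefix_bound[OF h, of 0 n i] unfolding corner_code_prefix by simp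
  qed
  from summable_LIMSEQ[OF this] show ?thesis unfolding corner_code_prefix pt_def by simp
qed

lemma pt_lower: "\<eta> \<in> codes CARD('n) k \<Longrightarrow> corner k e (code_prefix \<eta> n) $ i \<le> pt \<eta> $ i"
proof (rule incseq_le)
  show "incseq (\<lambda>n. corner k e (code_prefix \<eta> n) $ i)"
    by (rule incseq_SucI) (simp add: code_prefix_Suc corner_snoc)
qed (rule corner_prefix_tendsto)

lemma pt_upper:
  assumes h: "\<eta> \<in> codes CARD('n) k"
  shows "pt \<eta> $ i \<le> corner k e (code_prefix \<eta> n) $ i + 1 / real k ^ n"
  by (rule LIMSEQ_le_const2[OF corner_prefix_tendsto[OF h]]) (intro exI[of _ n] allI impI corner_prefix_bound[OF h])

lemma inverse_kpow_tendsto: "(\<lambda>n. 1 / real k ^ n) \<longlonglongrightarrow> 0"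
  using LIMSEQ_realpow_zero[of "1 / real k"] k2 by (simp add: power_one_over)

lemma code_point_eq:
  assumes h: "\<eta> \<in> codes CARD('n) k"
  shows "code_point k e \<eta> = pt \<eta>"
  unfolding code_point_def
proof (rule the_equality)
  show "pt \<eta> \<in> (\<Inter>i. cube k e (code_prefix \<eta> i))"
    using pt_lower[OF h] pt_upper[OF h] by (simp add: mem_cube)
  fix x assume x: "x \<in> (\<Inter>i. cube k e (code_prefix \<eta> i))"
  have "x $ i = pt \<eta> $ i" for i
  proof -
    have "\<bar>x $ i - pt \<eta> $ i\<bar> \<le> 1 / real k ^ n" for n
    proof -
      have "x \<in> cube k e (code_prefix \<eta> n)" using x by blast
      then have "corner k e (code_prefix \<eta> n) $ i \<le> x $ i"
        "x $ i \<le> corner k e (code_prefix \<eta> n) $ i + 1 / real k ^ n"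
        by (simp_all add: mem_cube)
      then show ?thesis using pt_lower[OF h, of n i] pt_upper[OF h, of i n] by linarith
    qed
    then have "\<bar>x $ i - pt \<eta> $ i\<bar> \<le> 0"
      by (intro LIMSEQ_le_const[OF inverse_kpow_tendsto]) blast
    then show ?thesis by simp
  qed
  then show "x = pt \<eta>" by (simp add: vec_eq_iff)
qed

definition top_letters :: "'n \<Rightarrow> nat set" where
  "top_letters i = {j \<in> L. e j $ i = k - 1}"

text \<open>
  A point with such a code lies on upper faces of all late cubes of its code, and therefore outside
  the half-open \<open>k\<close>-adic cubes that correspond to them.
\<close>

definition eventually_top :: "(nat \<Rightarrow> nat) \<Rightarrow> bool" where
  "eventually_top \<eta> \<longleftrightarrow> (\<exists>i N. \<forall>n\<ge>N. \<eta> n \<in> top_letters i)"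

text \<open>
  The upper faces of the cubes of the code decrease, strictly so whenever the digit is not \<open>k - 1\<close>.
\<close>

lemma pt_upper_strict:
  assumes h: "\<eta> \<in> codes CARD('n) k" and nt: "\<not> eventually_top \<eta>"
  shows "pt \<eta> $ i < corner k e (code_prefix \<eta> n) $ i + 1 / real k ^ n"
proof (rule ccontr)
  define u where "u n = corner k e (code_prefix \<eta> n) $ i + 1 / real k ^ n" for n
  assume "\<not> pt \<eta> $ i < corner k e (code_prefix \<eta> n) $ i + 1 / real k ^ n"
  then have un: "u n \<le> pt \<eta> $ i" by (simp add: u_def)
  have eq: "u n' = u n" if "n' \<ge> n" for n'
  proof -
    have "pt \<eta> $ i \<le> u n'" unfolding u_def by (rule pt_upper[OF h])
    moreover have "u n' \<le> u n" unfolding u_def by (rule corner_prefix_upper_antimono[OF h that])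
    ultimately show ?thesis using un by linarith
  qed
  have "\<eta> n' \<in> top_letters i" if "n' \<ge> n" for n'
  proof -
    have "u (Suc n') = u n' - (real k - 1 - real (e (\<eta> n') $ i)) / real k ^ Suc n'"
      unfolding u_def by (rule corner_prefix_upper_step[OF h])
    then have "(real k - 1 - real (e (\<eta> n') $ i)) / real k ^ Suc n' = 0"
      using eq[of n'] eq[of "Suc n'"] that by simp
    then have "real k - 1 - real (e (\<eta> n') $ i) = 0" using k2 by (simp only: divide_eq_0_iff) simp
    then have "e (\<eta> n') $ i = k - 1" using k2 by linarith
    moreover have "\<eta> n' \<in> L" using h by (auto simp: codes_def)
    ultimately show ?thesis by (simp add: top_letters_def)
  qed
  then have "eventually_top \<eta>" unfolding eventually_top_def by blast
  then show False using nt by simp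
qed

lemma top_letters_subset: "top_letters i \<subseteq> L"
  by (auto simp: top_letters_def)

lemma card_top_letters: "card (top_letters i) < card L"
proof (rule psubset_card_mono)
  show "finite L" by (simp add: letters_def)
  have "(0 :: nat ^ 'n) \<in> {a. \<forall>i. a $ i < k}" using k2 by simp
  also have "{a. \<forall>i. a $ i < k} = e ` L"
    using enum unfolding subcube_enumeration_def by (simp add: bij_betw_def)
  finally obtain j where j: "j \<in> L" "e j = 0" by auto
  then have "j \<notin> top_letters i" using k2 by (simp add: top_letters_def)
  then show "top_letters i \<subset> L" using j top_letters_subset by blast
qed

lemma kadic_cube_floor:
  assumes "\<And>i. corner k e \<sigma> $ i \<le> x $ i \<and> x $ i < corner k e \<sigma> $ i + 1 / real k ^ length \<sigma>"
  shows "kadic_cube k (length \<sigma>) x =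
    {y. \<forall>i. corner k e \<sigma> $ i \<le> y $ i \<and> y $ i < corner k e \<sigma> $ i + 1 / real k ^ length \<sigma>}"
proof -
  let ?s = "real k ^ length \<sigma>"
  have s: "0 < ?s" by (rule kpow_pos)
  have fl: "\<lfloor>?s * x $ i\<rfloor> = int (corner_index \<sigma> i)" for i
  proof (rule floor_unique)
    have "real (corner_index \<sigma> i) / ?s \<le> x $ i" "x $ i < (real (corner_index \<sigma> i) + 1) / ?s"
      using assms[of i] unfolding corner_eq_index add_divide_distrib by simp_all
    then have "real (corner_index \<sigma> i) \<le> x $ i * ?s" "x $ i * ?s < real (corner_index \<sigma> i) + 1"
      using s by (simp_all add: divide_le_eq less_divide_eq)
    then show "real_of_int (int (corner_index \<sigma> i)) \<le> ?s * x $ i" "?s * x $ i < real_of_int (int (corner_index \<sigma> i)) + 1"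
      by (simp_all add: mult.commute)
  qed
  show ?thesis unfolding kadic_cube_def fl corner_eq_index add_divide_distrib by simp
qed

text \<open>
  Off the boundary codes, the half-open \<open>k\<close>-adic cube of level \<open>n\<close> that contains \<open>x(\<eta>)\<close> is the cube
  of the prefix of length \<open>n\<close> without its upper faces.
\<close>

lemma kadic_cube_pt:
  assumes h: "\<eta> \<in> codes CARD('n) k" and nt: "\<not> eventually_top \<eta>"
  shows "embed (code_prefix \<eta> n) y \<in> kadic_cube k n (pt \<eta>) \<longleftrightarrow> (\<forall>i. 0 \<le> y $ i \<and> y $ i < 1)"
proof -
  let ?\<sigma> = "code_prefix \<eta> n"
  have "kadic_cube k (length ?\<sigma>) (pt \<eta>) =
    {y. \<forall>i. corner k e ?\<sigma> $ i \<le> y $ i \<and> y $ i < corner k e ?\<sigma> $ i + 1 / real k ^ length ?\<sigma>}"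
    using pt_lower[OF h] pt_upper_strict[OF h nt] by (intro kadic_cube_floor) simp
  moreover have "(corner k e ?\<sigma> $ i \<le> embed ?\<sigma> y $ i \<and> embed ?\<sigma> y $ i < corner k e ?\<sigma> $ i + 1 / real k ^ n) \<longleftrightarrow>
      (0 \<le> y $ i \<and> y $ i < 1)" for i
  proof -
    have s: "0 < real k ^ n" by (rule kpow_pos)
    have "0 \<le> y $ i / real k ^ n \<longleftrightarrow> 0 \<le> y $ i" by (simp add: pos_le_divide_eq[OF s])
    moreover have "y $ i / real k ^ n < 1 / real k ^ n \<longleftrightarrow> y $ i < 1" using s by (simp only: divide_less_cancel) auto
    ultimately show ?thesis by (simp only: embed_component length_code_prefix add_less_cancel_left le_add_same_cancel1)
  qed
  ultimately show ?thesis by simp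
qed

lemma measurable_pt: "(\<lambda>\<eta>. pt \<eta>) \<in> borel_measurable (code_algebra CARD('n) k)"
proof -
  have comp: "(\<lambda>\<eta>. pt \<eta> $ i) \<in> borel_measurable (code_algebra CARD('n) k)" for i
  proof -
    have "(\<lambda>\<eta>. real (e (\<eta> l) $ i) / real k ^ Suc l) \<in> borel_measurable (code_algebra CARD('n) k)" for l
      by (rule measurable_compose[OF measurable_code_coordinate]) simp
    then show ?thesis unfolding pt_def by simp
  qed
  show ?thesis
  proof (subst borel_measurable_euclidean_space, rule ballI)
    fix b :: "real ^ 'n" assume "b \<in> Basis"
    then obtain i where b: "b = axis i 1" by (auto simp: Basis_vec_def)
    show "(\<lambda>\<eta>. pt \<eta> \<bullet> b) \<in> borel_measurable (code_algebra CARD('n) k)"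
      unfolding b using comp[of i] by (simp add: inner_axis)
  qed
qed

lemma measurable_code_point [measurable]: "code_point k e \<in> borel_measurable (code_algebra CARD('n) k)"
proof (rule measurable_cong[THEN iffD2, OF _ measurable_pt])
  show "code_point k e \<eta> = pt \<eta>" if "\<eta> \<in> space (code_algebra CARD('n) k)" for \<eta>
    using that by (intro code_point_eq) (simp add: space_code)
qed

end

section \<open>Holes of the limit set\<close>

lemma infnorm_less_cart: "infnorm (x :: real ^ 'n::finite) < r \<longleftrightarrow> (\<forall>i. \<bar>x $ i\<bar> < r)"
proof -
  have B: "(Basis :: (real ^ 'n) set) = range (\<lambda>i. axis i 1)" by (auto simp: Basis_vec_def)
  have "infnorm x = Max (range (\<lambda>i. \<bar>x $ i\<bar>))"
    unfolding infnorm_Max B image_image by (simp add: inner_axis)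
  then show ?thesis by simp
qed

lemma mem_max_ball: "y \<in> max_ball z r \<longleftrightarrow> (\<forall>i. \<bar>y $ i - z $ i\<bar> < r)"
  by (simp add: max_ball_def infnorm_less_cart)

text \<open>
  The centres of the open balls of radius \<open>r > 0\<close> that are contained in the half-open unit cube.
\<close>

definition centres :: "real \<Rightarrow> (real ^ 'n::finite) set" where
  "centres r = {z. \<forall>i. r \<le> z $ i \<and> z $ i \<le> 1 - r}"

text \<open>
  An \<open>\<alpha>\<close>-hole at scale \<open>0\<close> corresponds to
  \<open>r = \<alpha> / 2\<close>.
\<close>

definition hole_at :: "(real ^ 'n::finite) set \<Rightarrow> real \<Rightarrow> bool" where
  "hole_at A r \<longleftrightarrow> (\<exists>z\<in>centres r. max_ball z r \<inter> A = {})"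

lemma max_ball_interior:
  assumes "z \<in> centres r" "y \<in> max_ball z r"
  shows "0 < y $ i \<and> y $ i < 1"
proof -
  have "r \<le> z $ i" "z $ i \<le> 1 - r" "\<bar>y $ i - z $ i\<bar> < r" using assms by (simp_all add: centres_def mem_max_ball)
  then show ?thesis by linarith
qed

text \<open>
  An open ball does not reach the upper faces unless it sticks out beyond them, so the condition is
  symmetric although the cube is half-open.
\<close>

lemma max_ball_subset_unit_cube:
  assumes r: "0 < r"
  shows "(\<forall>y\<in>max_ball z r. \<forall>i. 0 \<le> y $ i \<and> y $ i < 1) \<longleftrightarrow> z \<in> centres r"
proof
  assume a: "\<forall>y\<in>max_ball z r. \<forall>i. 0 \<le> y $ i \<and> y $ i < 1"
  have "r \<le> z $ i \<and> z $ i \<le> 1 - r" for i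
  proof -
    have move: "0 \<le> z $ i + t \<and> z $ i + t < 1" if t: "\<bar>t\<bar> < r" for t
    proof -
      define y where "y = (\<chi> j. if j = i then z $ i + t else z $ j)"
      have "y \<in> max_ball z r" using r t by (simp add: mem_max_ball y_def)
      then have "0 \<le> y $ i \<and> y $ i < 1" using a by blast
      then show ?thesis by (simp add: y_def)
    qed
    have "r \<le> z $ i"
    proof (rule ccontr)
      assume "\<not> r \<le> z $ i"
      moreover have "0 \<le> z $ i" using move[of 0] r by simp
      ultimately show False using move[of "- ((z $ i + r) / 2)"] r by (simp add: field_simps)
    qed
    moreover have "z $ i \<le> 1 - r"
    proof (rule ccontr)
      assume "\<not> z $ i \<le> 1 - r"
      moreover have "z $ i < 1" using move[of 0] r by simp
      ultimately show False using move[of "1 - z $ i"] by simp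
    qed
    ultimately show ?thesis by simp
  qed
  then show "z \<in> centres r" by (simp add: centres_def)
next
  assume "z \<in> centres r"
  then show "\<forall>y\<in>max_ball z r. \<forall>i. 0 \<le> y $ i \<and> y $ i < 1"
    using max_ball_interior[of z r] less_imp_le by blast
qed

lemma centres_antimono: "r' \<le> r \<Longrightarrow> centres r \<subseteq> centres r'"
proof
  fix z :: "real ^ 'n" assume "r' \<le> r" "z \<in> centres r"
  then have "r' \<le> z $ i \<and> z $ i \<le> 1 - r'" for i
    unfolding centres_def mem_Collect_eq by (metis diff_left_mono order_trans)
  then show "z \<in> centres r'" by (simp add: centres_def)
qed

lemma max_ball_mono: "r' \<le> r \<Longrightarrow> max_ball z r' \<subseteq> max_ball z r"
  by (auto simp: max_ball_def)

lemma hole_at_antimono: "hole_at A r \<Longrightarrow> r' \<le> r \<Longrightarrow> hole_at A r'"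
  unfolding hole_at_def using centres_antimono[of r' r] max_ball_mono[of r' r] by blast

text \<open>
  The balls are open and thus avoid the boundary of the unit cube; this matters because on the
  boundary a point may belong to the limit set through a neighbouring cube.
\<close>

lemma hole_at_cong:
  assumes "\<And>y. (\<And>i. 0 < y $ i \<and> y $ i < 1) \<Longrightarrow> y \<in> A \<longleftrightarrow> y \<in> B"
  shows "hole_at A r \<longleftrightarrow> hole_at B r"
proof -
  have "max_ball z r \<inter> A = max_ball z r \<inter> B" if z: "z \<in> centres r" for z
    using assms max_ball_interior[OF z] by blast
  then show ?thesis by (simp add: hole_at_def)
qed

lemma compact_centres: "compact (centres r :: (real ^ 'n::finite) set)"
proof -
  have "(centres r :: (real ^ 'n) set) = cbox (\<chi> i. r) (\<chi> i. 1 - r)"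
    by (auto simp: centres_def mem_box_cart)
  then show ?thesis by (simp only: compact_cbox)
qed

context mandelbrot
begin

lemma embed_mem_max_ball:
  "embed \<sigma> y \<in> max_ball (embed \<sigma> z) (r / real k ^ length \<sigma>) \<longleftrightarrow> y \<in> max_ball z r"
proof -
  have s: "0 < real k ^ length \<sigma>" by (rule kpow_pos)
  have "\<bar>embed \<sigma> y $ i - embed \<sigma> z $ i\<bar> < r / real k ^ length \<sigma> \<longleftrightarrow> \<bar>y $ i - z $ i\<bar> < r" for i
  proof -
    have "embed \<sigma> y $ i - embed \<sigma> z $ i = (y $ i - z $ i) / real k ^ length \<sigma>"
      by (simp add: embed_component diff_divide_distrib)
    then have "\<bar>embed \<sigma> y $ i - embed \<sigma> z $ i\<bar> = \<bar>y $ i - z $ i\<bar> / real k ^ length \<sigma>"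
      using s by (simp add: abs_divide)
    then show ?thesis by (simp only: pos_divide_less_eq[OF s] pos_less_divide_eq[OF s]) (use s in simp)
  qed
  then show ?thesis by (simp add: mem_max_ball)
qed

text \<open>
  Scales are compared by the affine map of the cube, under which the ball of radius
  \<open>\<alpha> / 2 / k^n\<close> becomes a ball of radius \<open>\<alpha> / 2\<close>.
\<close>

lemma set_hole_embed:
  assumes kad: "\<And>y. embed \<sigma> y \<in> kadic_cube k (length \<sigma>) x \<longleftrightarrow> (\<forall>i. 0 \<le> y $ i \<and> y $ i < 1)" and a: "0 < \<alpha>"
  shows "set_hole k A (length \<sigma>) x \<alpha> \<longleftrightarrow> hole_at {y. embed \<sigma> y \<in> A} (\<alpha> / 2)"
proof
  define r where "r = \<alpha> / 2"
  have r: "0 < r" using a by (simp add: r_def)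
  let ?\<rho> = "\<alpha> / 2 / real k ^ length \<sigma>"
  note ball = embed_mem_max_ball[of \<sigma> _ _ r, unfolded r_def]
  assume "set_hole k A (length \<sigma>) x \<alpha>"
  then obtain z where z: "max_ball z ?\<rho> \<subseteq> kadic_cube k (length \<sigma>) x - A"
    unfolding set_hole_def by blast
  obtain z' where z': "z = embed \<sigma> z'" using embed_surj by blast
  have sub: "embed \<sigma> y \<in> kadic_cube k (length \<sigma>) x \<and> embed \<sigma> y \<notin> A" if "y \<in> max_ball z' (\<alpha> / 2)" for y
    using z that unfolding z' ball[symmetric] by blast
  then have "z' \<in> centres (\<alpha> / 2)"
    unfolding kad using a by (subst max_ball_subset_unit_cube[symmetric]) simp_all
  then show "hole_at {y. embed \<sigma> y \<in> A} (\<alpha> / 2)"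
    unfolding hole_at_def using sub by (intro bexI[of _ z']) auto
next
  assume "hole_at {y. embed \<sigma> y \<in> A} (\<alpha> / 2)"
  then obtain z' where z': "z' \<in> centres (\<alpha> / 2)" "max_ball z' (\<alpha> / 2) \<inter> {y. embed \<sigma> y \<in> A} = {}"
    unfolding hole_at_def by blast
  have in_k: "embed \<sigma> y \<in> kadic_cube k (length \<sigma>) x" if "y \<in> max_ball z' (\<alpha> / 2)" for y
    unfolding kad using max_ball_interior[OF z'(1) that] by (simp add: less_imp_le)
  have zz: "z' \<in> max_ball z' (\<alpha> / 2)" using a by (simp add: mem_max_ball)
  show "set_hole k A (length \<sigma>) x \<alpha>"
    unfolding set_hole_def
  proof (rule bexI[of _ "embed \<sigma> z'"])
    show "embed \<sigma> z' \<in> kadic_cube k (length \<sigma>) x" by (rule in_k[OF zz])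
    show "max_ball (embed \<sigma> z') (\<alpha> / 2 / real k ^ length \<sigma>) \<subseteq> kadic_cube k (length \<sigma>) x - A"
    proof
      fix w assume w: "w \<in> max_ball (embed \<sigma> z') (\<alpha> / 2 / real k ^ length \<sigma>)"
      obtain y where y: "w = embed \<sigma> y" using embed_surj by blast
      have yb: "y \<in> max_ball z' (\<alpha> / 2)" using w unfolding y by (simp only: embed_mem_max_ball)
      then have "embed \<sigma> y \<notin> A" using z'(2) by blast
      then show "w \<in> kadic_cube k (length \<sigma>) x - A" using in_k[OF yb] unfolding y by blast
    qed
  qed
qed

lemma mem_limit_set:
  "x \<in> limit_set k e \<omega> \<longleftrightarrow> (\<forall>i. \<exists>\<tau>\<in>W. length \<tau> = i \<and> \<omega> \<tau> \<and> x \<in> cube k e \<tau>)"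
  unfolding limit_set_def by blast

lemma hereditary_prefix:
  assumes "hereditary CARD('n) k \<omega>" "\<tau> \<in> W" "\<omega> \<tau>"
  shows "\<omega> (take n \<tau>)"
  using bspec[OF bspec[OF assms(1)[unfolded hereditary_def] take_word[OF assms(2), of n]] drop_word[OF assms(2), of n]]
    assms(3) by simp

text \<open>
  An interior point of the cube of \<open>\<sigma>\<close> lies in no other cube of the same level, so all cubes that
  witness its membership in the limit set descend from \<open>\<sigma>\<close>.
\<close>

lemma limit_set_embed:
  assumes h: "hereditary CARD('n) k \<omega>" and s: "\<sigma> \<in> W" and y: "\<And>i. 0 < y $ i \<and> y $ i < 1"
  shows "embed \<sigma> y \<in> limit_set k e \<omega> \<longleftrightarrow> y \<in> limit_set k e (sub \<sigma> \<omega>)"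
proof
  assume x: "embed \<sigma> y \<in> limit_set k e \<omega>"
  show "y \<in> limit_set k e (sub \<sigma> \<omega>)"
    unfolding mem_limit_set
  proof
    fix i
    obtain \<tau> where t: "\<tau> \<in> W" "length \<tau> = length \<sigma> + i" "\<omega> \<tau>" "embed \<sigma> y \<in> cube k e \<tau>"
      using x[unfolded mem_limit_set] by blast
    have "embed \<sigma> y \<in> cube k e (take (length \<sigma>) \<tau>)" using cube_prefix[OF t(1)] t(4) by blast
    then have "take (length \<sigma>) \<tau> = \<sigma>"
      using t(2) by (intro cube_interior_unique[OF s take_word[OF t(1)] _ y]) simp_all
    then have te: "\<tau> = \<sigma> @ drop (length \<sigma>) \<tau>" using append_take_drop_id[of "length \<sigma>" \<tau>] by simp
    define \<upsilon> where "\<upsilon> = drop (length \<sigma>) \<tau>"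
    have te': "\<tau> = \<sigma> @ \<upsilon>" unfolding \<upsilon>_def by (rule te)
    have u: "\<upsilon> \<in> W" unfolding \<upsilon>_def by (rule drop_word[OF t(1)])
    have "y \<in> cube k e \<upsilon>" using t(4) unfolding te' by (simp only: embed_mem_cube)
    moreover have "length \<upsilon> = i" using t(2) unfolding te' by simp
    moreover have "sub \<sigma> \<omega> \<upsilon>" using t(3) u unfolding te' by (simp add: subtree_def)
    ultimately show "\<exists>\<tau>\<in>W. length \<tau> = i \<and> sub \<sigma> \<omega> \<tau> \<and> y \<in> cube k e \<tau>" using u by blast
  qed
next
  assume x: "y \<in> limit_set k e (sub \<sigma> \<omega>)"
  show "embed \<sigma> y \<in> limit_set k e \<omega>"
    unfolding mem_limit_set
  proof
    fix i
    obtain \<upsilon> where u: "\<upsilon> \<in> W" "length \<upsilon> = i" "sub \<sigma> \<omega> \<upsilon>" "y \<in> cube k e \<upsilon>"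
      using x[unfolded mem_limit_set] by blast
    have w: "\<sigma> @ \<upsilon> \<in> W" using s u by (simp add: append_in_words)
    have "\<omega> (\<sigma> @ \<upsilon>)" using u by (simp add: subtree_def)
    then have "\<omega> (take i (\<sigma> @ \<upsilon>))" by (rule hereditary_prefix[OF h w])
    moreover have "embed \<sigma> y \<in> cube k e (take i (\<sigma> @ \<upsilon>))"
      using cube_prefix[OF w, of i] u(4) embed_mem_cube[of \<sigma> y \<upsilon>] by blast
    moreover have "length (take i (\<sigma> @ \<upsilon>)) = i" using u(2) by simp
    ultimately show "\<exists>\<tau>\<in>W. length \<tau> = i \<and> \<omega> \<tau> \<and> embed \<sigma> y \<in> cube k e \<tau>"
      using take_word[OF w] by blast
  qed
qed

text \<open>
  The occurrence of a hole at scale \<open>n\<close> is a property of the \<open>n\<close>-fold shift, the same one for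
  every \<open>n\<close>.
\<close>

lemma set_hole_scale:
  assumes h: "hereditary CARD('n) k \<omega>" and c: "\<eta> \<in> codes CARD('n) k" "\<not> eventually_top \<eta>" and a: "0 < \<alpha>"
  shows "set_hole k (limit_set k e \<omega>) n (code_point k e \<eta>) \<alpha> \<longleftrightarrow>
    hole_at (limit_set k e (sub (code_prefix \<eta> n) \<omega>)) (\<alpha> / 2)"
proof -
  have "set_hole k (limit_set k e \<omega>) (length (code_prefix \<eta> n)) (pt \<eta>) \<alpha> \<longleftrightarrow>
      hole_at {y. embed (code_prefix \<eta> n) y \<in> limit_set k e \<omega>} (\<alpha> / 2)"
    by (rule set_hole_embed[OF _ a]) (simp only: length_code_prefix kadic_cube_pt[OF c])
  also have "\<dots> \<longleftrightarrow> hole_at (limit_set k e (sub (code_prefix \<eta> n) \<omega>)) (\<alpha> / 2)"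
    by (rule hole_at_cong) (simp only: mem_Collect_eq limit_set_embed[OF h code_prefix_word[OF c(1)]])
  finally show ?thesis by (simp only: length_code_prefix code_point_eq[OF c(1)])
qed

text \<open>
  The condition is imposed for all levels up to \<open>N\<close>, so that these sets decrease in \<open>N\<close> for every
  configuration, hereditary or not.
\<close>

definition level_approx :: "(nat list \<Rightarrow> bool) \<Rightarrow> nat \<Rightarrow> (real ^ 'n) set" where
  "level_approx \<omega> N = {x. \<forall>i\<le>N. \<exists>\<tau>\<in>W. length \<tau> = i \<and> \<omega> \<tau> \<and> x \<in> cube k e \<tau>}"

lemma closed_cube: "closed (cube k e \<sigma>)"
proof -
  have "cube k e \<sigma> = cbox (corner k e \<sigma>) (\<chi> i. corner k e \<sigma> $ i + 1 / real k ^ length \<sigma>)"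
    by (auto simp: cube_def mem_box_cart)
  then show ?thesis by (simp only: closed_cbox)
qed

lemma closed_level_approx: "closed (level_approx \<omega> N)"
proof -
  have "level_approx \<omega> N = (\<Inter>i\<in>{..N}. \<Union>\<tau>\<in>{\<tau> \<in> level CARD('n) k i. \<omega> \<tau>}. cube k e \<tau>)"
    unfolding level_approx_def by auto
  moreover have "closed \<dots>"
    by (intro closed_INT ballI closed_UN closed_cube finite_subset[OF _ finite_level]) auto
  ultimately show ?thesis by simp
qed

text \<open>
  A formulation of holes by countably many conditions on finitely many levels.  If a ball misses the
  limit set, then a slightly smaller closed ball with the same centre misses one of the decreasing
  closed approximations, by compactness.  Conversely the centres of almost optimal balls accumulate,
  and the limit is the centre of a hole.
\<close>

lemma hole_at_limit_set:
  assumes r: "0 < r"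
  shows "hole_at (limit_set k e \<omega>) r \<longleftrightarrow>
    (\<forall>n. \<exists>N. \<exists>z\<in>centres r. max_ball z (r - 1 / real (Suc n)) \<inter> level_approx \<omega> N = {})"
proof
  assume "hole_at (limit_set k e \<omega>) r"
  then obtain z where z: "z \<in> centres r" "max_ball z r \<inter> limit_set k e \<omega> = {}" unfolding hole_at_def by blast
  show "\<forall>n. \<exists>N. \<exists>z\<in>centres r. max_ball z (r - 1 / real (Suc n)) \<inter> level_approx \<omega> N = {}"
  proof
    fix n
    \<comment> \<open>the closed ball of radius \<open>s\<close> lies between the open balls of radius \<open>s\<close> and \<open>r\<close>\<close>
    define s where "s = r - 1 / real (Suc n)"
    have sr: "s < r" by (simp add: s_def)
    define cb where "cb = cbox (\<chi> i. z $ i - s) (\<chi> i. z $ i + s)"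
    have cb: "y \<in> cb \<longleftrightarrow> (\<forall>i. \<bar>y $ i - z $ i\<bar> \<le> s)" for y
      unfolding cb_def mem_box_cart abs_le_iff by (auto simp: algebra_simps)
    have ballcb: "max_ball z s \<subseteq> cb" by (auto simp: mem_max_ball cb less_imp_le)
    have cbball: "cb \<subseteq> max_ball z r"
    proof
      fix y assume "y \<in> cb"
      then have "\<bar>y $ i - z $ i\<bar> < r" for i using sr le_less_trans[of "\<bar>y $ i - z $ i\<bar>" s r] by (simp add: cb)
      then show "y \<in> max_ball z r" by (simp add: mem_max_ball)
    qed
    have "\<exists>N. cb \<inter> level_approx \<omega> N = {}"
    proof (rule ccontr)
      assume a: "\<not> (\<exists>N. cb \<inter> level_approx \<omega> N = {})"
      have "(\<Inter>N. cb \<inter> level_approx \<omega> N) \<noteq> {}"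
      proof (rule compact_nest)
        show "compact (cb \<inter> level_approx \<omega> N)" for N
          unfolding cb_def by (intro compact_Int_closed compact_cbox closed_level_approx)
        show "cb \<inter> level_approx \<omega> N \<noteq> {}" for N using a by blast
        show "cb \<inter> level_approx \<omega> N' \<subseteq> cb \<inter> level_approx \<omega> N" if "N \<le> N'" for N N'
          unfolding level_approx_def using that order_trans by blast
      qed
      then obtain y where y: "y \<in> cb" "\<And>N. y \<in> level_approx \<omega> N" by blast
      have "y \<in> limit_set k e \<omega>"
        unfolding mem_limit_set
      proof
        fix i show "\<exists>\<tau>\<in>W. length \<tau> = i \<and> \<omega> \<tau> \<and> y \<in> cube k e \<tau>"
          using y(2)[of i] unfolding level_approx_def by blast
      qed
      then show False using z(2) cbball y(1) by blast
    qed
    then show "\<exists>N. \<exists>z\<in>centres r. max_ball z (r - 1 / real (Suc n)) \<inter> level_approx \<omega> N = {}"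
      using z(1) ballcb unfolding s_def by blast
  qed
next
  assume a: "\<forall>n. \<exists>N. \<exists>z\<in>centres r. max_ball z (r - 1 / real (Suc n)) \<inter> level_approx \<omega> N = {}"
  have lim_sub: "limit_set k e \<omega> \<subseteq> level_approx \<omega> N" for N
    unfolding level_approx_def limit_set_def by blast
  have "\<forall>n. \<exists>z. z \<in> centres r \<and> max_ball z (r - 1 / real (Suc n)) \<inter> limit_set k e \<omega> = {}"
    using a lim_sub by blast
  from choice[OF this] obtain c where c: "\<And>n. c n \<in> centres r"
    "\<And>n. max_ball (c n) (r - 1 / real (Suc n)) \<inter> limit_set k e \<omega> = {}" by blast
  obtain z f where z: "z \<in> centres r" and f: "strict_mono (f :: nat \<Rightarrow> nat)" and lim: "(c \<circ> f) \<longlonglongrightarrow> z"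
    using compact_centres[of r] c(1) unfolding compact_def by blast
  have "y \<notin> limit_set k e \<omega>" if y: "y \<in> max_ball z r" for y
  proof
    assume yK: "y \<in> limit_set k e \<omega>"
    \<comment> \<open>\<open>y\<close> keeps the distance \<open>d\<close> from the sphere, half of which pays for moving the centre and half for shrinking the radius\<close>
    define d where "d = r - infnorm (y - z)"
    have d: "d > 0" using y by (simp add: d_def max_ball_def)
    have "eventually (\<lambda>n. dist ((c \<circ> f) n) z < d / 2) sequentially"
      by (rule tendstoD[OF lim]) (use d in simp)
    moreover have "eventually (\<lambda>n. 1 / real (Suc n) < d / 2) sequentially"
      using d by (intro order_tendstoD(2)[OF LIMSEQ_Suc[OF lim_1_over_n]]) simp
    ultimately have "eventually (\<lambda>n. dist ((c \<circ> f) n) z < d / 2 \<and> 1 / real (Suc n) < d / 2) sequentially"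
      by (rule eventually_conj)
    then obtain n where n: "dist (c (f n)) z < d / 2" "1 / real (Suc n) < d / 2"
      by (auto simp: eventually_sequentially)
    define t t' where "t = 1 / real (Suc n)" and "t' = 1 / real (Suc (f n))"
    have "t' \<le> t"
      unfolding t_def t'_def using seq_suble[OF f, of n] by (intro divide_left_mono) simp_all
    moreover have "infnorm (z - c (f n)) < d / 2"
      using n(1) infnorm_le_norm[of "z - c (f n)"] by (simp add: dist_norm norm_minus_commute)
    moreover have "infnorm (y - c (f n)) \<le> infnorm (y - z) + infnorm (z - c (f n))"
      using infnorm_triangle[of "y - z" "z - c (f n)"] by simp
    moreover have "infnorm (y - z) = r - d" by (simp add: d_def)
    moreover have "t < d / 2" unfolding t_def by (rule n(2))
    ultimately have "infnorm (y - c (f n)) < r - t'" by linarith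
    then have "y \<in> max_ball (c (f n)) (r - 1 / real (Suc (f n)))" unfolding t'_def by (simp only: max_ball_def mem_Collect_eq)
    then show False using c(2)[of "f n"] yK by blast
  qed
  then show "hole_at (limit_set k e \<omega>) r" unfolding hole_at_def using z by blast
qed

lemma measurable_hole_at:
  assumes r: "0 < r"
  shows "Measurable.pred \<A> (\<lambda>\<omega>. hole_at (limit_set k e \<omega>) r)"
proof -
  have "Measurable.pred \<A> (\<lambda>\<omega>. \<exists>z\<in>centres r. max_ball z s \<inter> level_approx \<omega> N = {})" for s N
  proof -
    have "determined CARD('n) k N {\<omega> \<in> space \<A>. \<exists>z\<in>centres r. max_ball z s \<inter> level_approx \<omega> N = {}}"
    proof (rule determinedI)
      fix \<omega> \<omega>' assume w: "\<omega> \<in> space \<A>" "\<omega>' \<in> space \<A>"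
        and eq: "\<And>\<tau>. \<tau> \<in> W \<Longrightarrow> length \<tau> \<le> N \<Longrightarrow> \<omega> \<tau> = \<omega>' \<tau>"
      have "level_approx \<omega> N = level_approx \<omega>' N"
        unfolding level_approx_def using eq by blast
      then show "\<omega> \<in> {\<omega> \<in> space \<A>. \<exists>z\<in>centres r. max_ball z s \<inter> level_approx \<omega> N = {}} \<longleftrightarrow>
          \<omega>' \<in> {\<omega> \<in> space \<A>. \<exists>z\<in>centres r. max_ball z s \<inter> level_approx \<omega> N = {}}"
        using w by simp
    qed blast
    from determined_sets[OF this] show ?thesis by (simp only: pred_def)
  qed
  note [measurable] = this
  show ?thesis unfolding hole_at_limit_set[OF r] by measurable
qed

end

section \<open>Holes of the natural measure\<close>

context mandelbrot
begin

lemma borel_component: "(\<lambda>y :: real ^ 'n. y $ i) \<in> borel_measurable borel"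
  by (intro borel_measurable_continuous_onI continuous_intros)

lemma max_ball_borel: "max_ball (z :: real ^ 'n) r \<in> sets borel"
proof -
  note [measurable] = borel_component
  have "max_ball z r = {y \<in> space borel. \<forall>i. \<bar>y $ i - z $ i\<bar> < r}" by (auto simp: mem_max_ball)
  also have "\<dots> \<in> sets borel" by measurable
  finally show ?thesis .
qed

lemma kadic_cube_borel: "kadic_cube k n (x :: real ^ 'n) \<in> sets borel"
proof -
  note [measurable] = borel_component
  have "kadic_cube k n x = {y \<in> space borel. \<forall>i. of_int \<lfloor>real k ^ n * x $ i\<rfloor> / real k ^ n \<le> y $ i \<and>
             y $ i < (of_int \<lfloor>real k ^ n * x $ i\<rfloor> + 1) / real k ^ n}" by (auto simp: kadic_cube_def)
  also have "\<dots> \<in> sets borel" by measurable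
  finally show ?thesis .
qed

lemma code_point_measurable_\<mu>: "code_point k e \<in> measurable (\<mu> \<omega>) borel"
  using measurable_code_point by (simp cong: measurable_cong_sets)

lemma emeasure_natural_measure:
  "A \<in> sets borel \<Longrightarrow> emeasure (natural_measure k e p \<omega>) A = emeasure (\<mu> \<omega>) {\<eta> \<in> codes CARD('n) k. code_point k e \<eta> \<in> A}"
proof -
  assume A: "A \<in> sets borel"
  have "code_point k e -` A \<inter> space (\<mu> \<omega>) = {\<eta> \<in> codes CARD('n) k. code_point k e \<eta> \<in> A}" by auto
  then show ?thesis unfolding natural_measure_def emeasure_distr[OF code_point_measurable_\<mu> A] by simp
qed

lemma code_point_preimage_sets:
  assumes "A \<in> sets borel"
  shows "{\<eta> \<in> codes CARD('n) k. code_point k e \<eta> \<in> A} \<in> sets (\<mu> \<omega>)"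
proof -
  have "code_point k e -` A \<inter> space (\<mu> \<omega>) \<in> sets (\<mu> \<omega>)"
    using code_point_measurable_\<mu> assms by (rule measurable_sets)
  moreover have "code_point k e -` A \<inter> space (\<mu> \<omega>) = {\<eta> \<in> codes CARD('n) k. code_point k e \<eta> \<in> A}" by auto
  ultimately show ?thesis by (simp only:)
qed

lemma dead_cylinder_null:
  assumes r: "regular \<omega>" and s: "\<sigma> \<in> W" "\<not> \<omega> \<sigma>"
  shows "emeasure (\<mu> \<omega>) (cyl \<sigma>) = 0"
proof -
  have "sub \<sigma> \<omega> = dead CARD('n) k"
    using r s by (intro hereditary_dead_subtree) (simp_all add: regular_def)
  then show ?thesis unfolding regular_code_measure[OF r s(1)] by simp
qed

text \<open>
  The code of a point off the limit set has a neglected prefix, and the countably many cylinders of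
  neglected words carry no mass.
\<close>

lemma natural_measure_off_limit_set:
  assumes r: "regular \<omega>" and A: "A \<in> sets borel" "A \<inter> limit_set k e \<omega> = {}"
  shows "emeasure (natural_measure k e p \<omega>) A = 0"
proof -
  let ?I = "{\<tau> \<in> W. \<not> \<omega> \<tau>}"
  have nul: "(\<Union>\<tau>\<in>?I. cyl \<tau>) \<in> null_sets (\<mu> \<omega>)"
  proof (rule null_sets_UN')
    show "countable ?I" by (rule countableI_type)
    show "cyl \<tau> \<in> null_sets (\<mu> \<omega>)" if "\<tau> \<in> ?I" for \<tau>
    proof (rule null_setsI)
      show "emeasure (\<mu> \<omega>) (cyl \<tau>) = 0" using that by (intro dead_cylinder_null[OF r]) simp_all
    qed simp
  qed
  have subs: "{\<eta> \<in> codes CARD('n) k. code_point k e \<eta> \<in> A} \<subseteq> (\<Union>\<tau>\<in>?I. cyl \<tau>)"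
  proof
    fix \<eta> assume "\<eta> \<in> {\<eta> \<in> codes CARD('n) k. code_point k e \<eta> \<in> A}"
    then have h: "\<eta> \<in> codes CARD('n) k" "pt \<eta> \<in> A" using code_point_eq[of \<eta>] by simp_all
    have "pt \<eta> \<notin> limit_set k e \<omega>" using h(2) A(2) by blast
    have "\<exists>n. \<not> \<omega> (code_prefix \<eta> n)"
    proof (rule ccontr)
      assume "\<not> ?thesis"
      then have a: "\<omega> (code_prefix \<eta> n)" for n by blast
      have "pt \<eta> \<in> limit_set k e \<omega>"
        unfolding mem_limit_set
      proof
        fix n
        have "pt \<eta> \<in> cube k e (code_prefix \<eta> n)"
          using pt_lower[OF h(1)] pt_upper[OF h(1)] by (simp add: mem_cube)
        then show "\<exists>\<tau>\<in>W. length \<tau> = n \<and> \<omega> \<tau> \<and> pt \<eta> \<in> cube k e \<tau>"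
          using a code_prefix_word[OF h(1), of n] by (intro bexI[of _ "code_prefix \<eta> n"]) simp_all
      qed
      then show False using \<open>pt \<eta> \<notin> limit_set k e \<omega>\<close> by simp
    qed
    then obtain n where "\<not> \<omega> (code_prefix \<eta> n)" by blast
    then have "code_prefix \<eta> n \<in> ?I" using code_prefix_word[OF h(1)] by simp
    moreover have "\<eta> \<in> cyl (code_prefix \<eta> n)" using h(1) by (simp add: cylinder_def)
    ultimately show "\<eta> \<in> (\<Union>\<tau>\<in>?I. cyl \<tau>)" by (rule UN_I)
  qed
  have "{\<eta> \<in> codes CARD('n) k. code_point k e \<eta> \<in> A} \<in> null_sets (\<mu> \<omega>)"
    by (rule null_sets_subset[OF nul code_point_preimage_sets[OF A(1)] subs])
  then show ?thesis unfolding emeasure_natural_measure[OF A(1)] by (simp add: null_sets_def)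
qed

lemma set_hole_imp_measure_hole:
  assumes r: "regular \<omega>" and h: "set_hole k (limit_set k e \<omega>) n x \<alpha>"
  shows "measure_hole k (natural_measure k e p \<omega>) n x \<alpha> \<epsilon>"
proof -
  obtain z where z: "z \<in> kadic_cube k n x" "max_ball z (\<alpha> / 2 / real k ^ n) \<subseteq> kadic_cube k n x - limit_set k e \<omega>"
    using h unfolding set_hole_def by blast
  have "emeasure (natural_measure k e p \<omega>) (max_ball z (\<alpha> / 2 / real k ^ n)) = 0"
    by (rule natural_measure_off_limit_set[OF r max_ball_borel]) (use z(2) in blast)
  then have "emeasure (natural_measure k e p \<omega>) (max_ball z (\<alpha> / 2 / real k ^ n)) \<le>
      ennreal \<epsilon> * emeasure (natural_measure k e p \<omega>) (kadic_cube k n x)" by simp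
  moreover have "max_ball z (\<alpha> / 2 / real k ^ n) \<subseteq> kadic_cube k n x" using z(2) by blast
  ultimately show ?thesis unfolding measure_hole_def using z(1) by blast
qed

definition touching :: "nat \<Rightarrow> real ^ 'n \<Rightarrow> real \<Rightarrow> nat list set" where
  "touching N z r = {\<upsilon> \<in> level CARD('n) k N. cube k e \<upsilon> \<inter> max_ball z r \<noteq> {}}"

text \<open>
  The trace of an \<open>(\<alpha>, \<epsilon>)\<close>-hole on the configuration at its scale, with \<open>r = \<alpha> / 2\<close> and a smaller
  radius \<open>r'\<close>.  The cube of \<open>\<upsilon>\<close> has a fraction \<open>X (sub \<upsilon> \<omega>) / (M^N X \<omega>)\<close> of the total mass; the
  inequality is multiplied out to remain meaningful for \<open>X \<omega> = 0\<close>.  In contrast to the mass of a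
  ball the masses of these cubes are measurable in \<open>\<omega>\<close> by construction, and only finitely many
  families \<open>touching N z r'\<close> occur.
\<close>

definition small_hole :: "real \<Rightarrow> real \<Rightarrow> nat \<Rightarrow> real \<Rightarrow> (nat list \<Rightarrow> bool) \<Rightarrow> bool" where
  "small_hole r r' N \<epsilon> \<omega> \<longleftrightarrow> (\<exists>z\<in>centres r. \<forall>\<upsilon>\<in>touching N z r'. X (sub \<upsilon> \<omega>) \<le> \<epsilon> * M ^ N * X \<omega>)"

lemma finite_touching: "finite ((\<lambda>z. touching N z r') ` centres r)"
  by (rule finite_subset[of _ "Pow (level CARD('n) k N)"]) (auto simp: touching_def finite_level)

lemma measurable_small_hole: "Measurable.pred \<A> (small_hole r r' N \<epsilon>)"
proof -
  have "small_hole r r' N \<epsilon> \<omega> \<longleftrightarrow>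
      (\<exists>T\<in>(\<lambda>z. touching N z r') ` centres r. \<forall>\<upsilon>\<in>T. X (sub \<upsilon> \<omega>) \<le> \<epsilon> * M ^ N * X \<omega>)" for \<omega>
    by (simp add: small_hole_def)
  moreover have "Measurable.pred \<A> (\<lambda>\<omega>. \<exists>T\<in>(\<lambda>z. touching N z r') ` centres r.
      \<forall>\<upsilon>\<in>T. X (sub \<upsilon> \<omega>) \<le> \<epsilon> * M ^ N * X \<omega>)"
  proof (intro pred_intros_finite(4)[OF finite_touching])
    fix T assume "T \<in> (\<lambda>z. touching N z r') ` centres r"
    then have T: "T \<subseteq> level CARD('n) k N" by (auto simp: touching_def)
    show "Measurable.pred \<A> (\<lambda>\<omega>. \<forall>\<upsilon>\<in>T. X (sub \<upsilon> \<omega>) \<le> \<epsilon> * M ^ N * X \<omega>)"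
    proof (rule pred_intros_finite)
      show "finite T" using T finite_level by (rule finite_subset)
      fix \<upsilon> assume "\<upsilon> \<in> T"
      then have "(\<lambda>\<omega>. X (sub \<upsilon> \<omega>)) \<in> borel_measurable \<A>" using T by (intro measurable_X_sub) blast
      then show "Measurable.pred \<A> (\<lambda>\<omega>. X (sub \<upsilon> \<omega>) \<le> \<epsilon> * M ^ N * X \<omega>)"
        unfolding pred_def by (rule borel_measurable_le) measurable
    qed
  qed
  ultimately show ?thesis by (simp cong: measurable_cong)
qed

text \<open>
  Both points determine their prefixes by rounding down, and rounding agrees on a \<open>k\<close>-adic cube.
\<close>

lemma same_kadic_cube_prefix:
  assumes h: "\<eta> \<in> codes CARD('n) k" "\<not> eventually_top \<eta>" and h': "\<eta>' \<in> codes CARD('n) k" "\<not> eventually_top \<eta>'"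
    and x: "pt \<eta>' \<in> kadic_cube k n (pt \<eta>)"
  shows "code_prefix \<eta>' n = code_prefix \<eta> n"
proof (rule corner_index_inj)
  fix i
  let ?s = "real k ^ n"
  have s: "0 < ?s" by (rule kpow_pos)
  obtain y where y: "pt \<eta>' = embed (code_prefix \<eta> n) y" using embed_surj by blast
  have y01: "0 \<le> y $ i \<and> y $ i < 1" using x unfolding y kadic_cube_pt[OF h] by blast
  have cancel: "(a / ?s + b / ?s) * ?s = a + b" for a b :: real
    unfolding add_divide_distrib[symmetric] using s by (intro nonzero_eq_divide_eq[THEN iffD1, rotated]) simp_all
  have "pt \<eta>' $ i * ?s = real (corner_index (code_prefix \<eta> n) i) + y $ i"
    unfolding y embed_component corner_eq_index length_code_prefix by (rule cancel)
  then have 1: "real (corner_index (code_prefix \<eta> n) i) \<le> pt \<eta>' $ i * ?s"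
    "pt \<eta>' $ i * ?s < real (corner_index (code_prefix \<eta> n) i) + 1"
    using y01 by linarith+
  have "corner k e (code_prefix \<eta>' n) $ i \<le> pt \<eta>' $ i" "pt \<eta>' $ i < corner k e (code_prefix \<eta>' n) $ i + 1 / ?s"
    by (rule pt_lower[OF h'(1)], rule pt_upper_strict[OF h'])
  then have 2: "real (corner_index (code_prefix \<eta>' n) i) \<le> pt \<eta>' $ i * ?s"
    "pt \<eta>' $ i * ?s < real (corner_index (code_prefix \<eta>' n) i) + 1"
    unfolding corner_eq_index length_code_prefix add_divide_distrib[symmetric]
    by (simp_all only: pos_divide_le_eq[OF s] pos_less_divide_eq[OF s])
  show "corner_index (code_prefix \<eta>' n) i = corner_index (code_prefix \<eta> n) i" using 1 2 by linarith
qed (use code_prefix_word h h' in simp_all)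

text \<open>
  Cubes of level \<open>N\<close> have side length \<open>k^(-N)\<close>, so those touching the ball of radius \<open>r'\<close> are contained
  in the concentric ball of radius \<open>\<alpha> / 2\<close>, and their mass is bounded by that of the hole.
\<close>

lemma measure_hole_imp_small_hole:
  assumes r: "regular \<omega>" and h: "\<eta> \<in> codes CARD('n) k" "\<not> eventually_top \<eta>"
    and bad: "emeasure (\<mu> \<omega>) {\<eta> \<in> codes CARD('n) k. eventually_top \<eta>} = 0"
      "{\<eta> \<in> codes CARD('n) k. eventually_top \<eta>} \<in> sets (code_algebra CARD('n) k)"
    and a: "0 < \<alpha>" and N: "r' + 1 / real k ^ N \<le> \<alpha> / 2" and eps: "0 \<le> \<epsilon>"
    and mh: "measure_hole k (natural_measure k e p \<omega>) n (code_point k e \<eta>) \<alpha> \<epsilon>"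
  shows "small_hole (\<alpha> / 2) r' N \<epsilon> (sub (code_prefix \<eta> n) \<omega>)"
proof -
  define \<sigma> where "\<sigma> = code_prefix \<eta> n"
  have sW: "\<sigma> \<in> W" and ls: "length \<sigma> = n" unfolding \<sigma>_def using code_prefix_word[OF h(1)] by simp_all
  let ?\<nu> = "natural_measure k e p \<omega>"
  let ?\<rho> = "\<alpha> / 2 / real k ^ n"
  obtain z where z: "max_ball z ?\<rho> \<subseteq> kadic_cube k n (pt \<eta>)"
    "emeasure ?\<nu> (max_ball z ?\<rho>) \<le> ennreal \<epsilon> * emeasure ?\<nu> (kadic_cube k n (pt \<eta>))"
    using mh unfolding measure_hole_def code_point_eq[OF h(1)] by blast
  obtain z' where z': "z = embed \<sigma> z'" using embed_surj by blast
  have ball: "embed \<sigma> y \<in> max_ball z ?\<rho> \<longleftrightarrow> y \<in> max_ball z' (\<alpha> / 2)" for y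
    using embed_mem_max_ball[of \<sigma> y z' "\<alpha> / 2"] unfolding ls z' .
  have "\<forall>y\<in>max_ball z' (\<alpha> / 2). \<forall>i. 0 \<le> y $ i \<and> y $ i < 1"
    unfolding kadic_cube_pt[OF h, of n, symmetric] using z(1) ball unfolding \<sigma>_def by blast
  then have zc: "z' \<in> centres (\<alpha> / 2)" using a by (subst max_ball_subset_unit_cube[symmetric]) simp_all
  \<comment> \<open>up to the null set of codes on cube boundaries, the k-adic cube is coded by the cylinder\<close>
  have upper: "emeasure ?\<nu> (kadic_cube k n (pt \<eta>)) \<le> emeasure (\<mu> \<omega>) (cyl \<sigma>)"
  proof -
    have "{\<eta>' \<in> codes CARD('n) k. code_point k e \<eta>' \<in> kadic_cube k n (pt \<eta>)} \<subseteq>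
        cyl \<sigma> \<union> {\<eta> \<in> codes CARD('n) k. eventually_top \<eta>}"
    proof
      fix \<eta>' assume "\<eta>' \<in> {\<eta>' \<in> codes CARD('n) k. code_point k e \<eta>' \<in> kadic_cube k n (pt \<eta>)}"
      then have e': "\<eta>' \<in> codes CARD('n) k" "pt \<eta>' \<in> kadic_cube k n (pt \<eta>)" using code_point_eq[of \<eta>'] by simp_all
      show "\<eta>' \<in> cyl \<sigma> \<union> {\<eta> \<in> codes CARD('n) k. eventually_top \<eta>}"
      proof (cases "eventually_top \<eta>'")
        case False
        then have "code_prefix \<eta>' n = \<sigma>" unfolding \<sigma>_def by (rule same_kadic_cube_prefix[OF h e'(1) _ e'(2)])
        then show ?thesis using e'(1) by (simp add: cylinder_def ls)
      qed (use e'(1) in simp)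
    qed
    then have "emeasure (\<mu> \<omega>) {\<eta>' \<in> codes CARD('n) k. code_point k e \<eta>' \<in> kadic_cube k n (pt \<eta>)} \<le>
        emeasure (\<mu> \<omega>) (cyl \<sigma> \<union> {\<eta> \<in> codes CARD('n) k. eventually_top \<eta>})"
      using bad(2) by (intro emeasure_mono) simp_all
    also have "\<dots> \<le> emeasure (\<mu> \<omega>) (cyl \<sigma>) + emeasure (\<mu> \<omega>) {\<eta> \<in> codes CARD('n) k. eventually_top \<eta>}"
      using bad(2) by (intro emeasure_subadditive) simp_all
    finally show ?thesis unfolding emeasure_natural_measure[OF kadic_cube_borel] bad(1) by simp
  qed
  have "X (sub \<upsilon> (sub \<sigma> \<omega>)) \<le> \<epsilon> * M ^ N * X (sub \<sigma> \<omega>)" if u: "\<upsilon> \<in> touching N z' r'" for \<upsilon>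
  proof -
    have uW: "\<upsilon> \<in> W" and lu: "length \<upsilon> = N" using u by (simp_all add: touching_def)
    obtain w where w: "w \<in> cube k e \<upsilon>" "w \<in> max_ball z' r'" using u unfolding touching_def by blast
    have su: "\<sigma> @ \<upsilon> \<in> W" using sW uW by (simp add: append_in_words)
    have "cyl (\<sigma> @ \<upsilon>) \<subseteq> {\<eta> \<in> codes CARD('n) k. code_point k e \<eta> \<in> max_ball z ?\<rho>}"
    proof
      fix \<eta>' assume "\<eta>' \<in> cyl (\<sigma> @ \<upsilon>)"
      then have e': "\<eta>' \<in> codes CARD('n) k" "code_prefix \<eta>' (n + N) = \<sigma> @ \<upsilon>"
        by (simp_all add: cylinder_def ls lu)
      obtain y where y: "pt \<eta>' = embed \<sigma> y" using embed_surj by blast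
      have "pt \<eta>' \<in> cube k e (\<sigma> @ \<upsilon>)"
        using pt_lower[OF e'(1), of "n + N"] pt_upper[OF e'(1), of _ "n + N"] unfolding e'(2)
        by (simp add: mem_cube ls lu)
      then have yu: "y \<in> cube k e \<upsilon>" unfolding y by (simp only: embed_mem_cube)
      have "\<bar>y $ i - z' $ i\<bar> < \<alpha> / 2" for i
      proof -
        have "corner k e \<upsilon> $ i \<le> y $ i" "y $ i \<le> corner k e \<upsilon> $ i + 1 / real k ^ N"
          "corner k e \<upsilon> $ i \<le> w $ i" "w $ i \<le> corner k e \<upsilon> $ i + 1 / real k ^ N"
          using yu w(1) unfolding mem_cube lu by blast+
        moreover have "\<bar>w $ i - z' $ i\<bar> < r'" using w(2) by (simp add: mem_max_ball)
        ultimately show ?thesis using N by linarith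
      qed
      then have "y \<in> max_ball z' (\<alpha> / 2)" by (simp add: mem_max_ball)
      then have "code_point k e \<eta>' \<in> max_ball z ?\<rho>" unfolding code_point_eq[OF e'(1)] y ball .
      then show "\<eta>' \<in> {\<eta> \<in> codes CARD('n) k. code_point k e \<eta> \<in> max_ball z ?\<rho>}"
        using e'(1) by blast
    qed
    then have "emeasure (\<mu> \<omega>) (cyl (\<sigma> @ \<upsilon>)) \<le> emeasure ?\<nu> (max_ball z ?\<rho>)"
      unfolding emeasure_natural_measure[OF max_ball_borel]
      by (intro emeasure_mono code_point_preimage_sets max_ball_borel)
    also have "\<dots> \<le> ennreal \<epsilon> * emeasure ?\<nu> (kadic_cube k n (pt \<eta>))" by (rule z(2))
    also have "\<dots> \<le> ennreal \<epsilon> * emeasure (\<mu> \<omega>) (cyl \<sigma>)" by (rule mult_left_mono[OF upper]) simp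
    also have "\<dots> = ennreal (\<epsilon> * (diam_pow * (1 / M ^ n) * X (sub \<sigma> \<omega>)))"
      unfolding regular_code_measure[OF r sW] ls by (rule ennreal_mult'[OF eps, symmetric])
    finally have "ennreal (diam_pow * (1 / M ^ (n + N)) * X (sub (\<sigma> @ \<upsilon>) \<omega>)) \<le> ennreal (\<epsilon> * (diam_pow * (1 / M ^ n) * X (sub \<sigma> \<omega>)))"
      unfolding regular_code_measure[OF r su] by (simp add: ls lu)
    then have "diam_pow * (1 / M ^ (n + N)) * X (sub (\<sigma> @ \<upsilon>) \<omega>) \<le> \<epsilon> * (diam_pow * (1 / M ^ n) * X (sub \<sigma> \<omega>))"
      using eps diam_pow_pos M_gt_1 regular_X_nonneg[OF r sW] by (subst (asm) ennreal_le_iff) simp_all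
    then have "(diam_pow / M ^ (n + N)) * X (sub (\<sigma> @ \<upsilon>) \<omega>) \<le> (diam_pow / M ^ (n + N)) * (\<epsilon> * M ^ N * X (sub \<sigma> \<omega>))"
      using M_gt_1 by (simp add: power_add mult_ac)
    moreover have "0 < diam_pow / M ^ (n + N)" using diam_pow_pos M_gt_1 by simp
    ultimately have "X (sub (\<sigma> @ \<upsilon>) \<omega>) \<le> \<epsilon> * M ^ N * X (sub \<sigma> \<omega>)" by (simp only: mult_le_cancel_left_pos)
    then show ?thesis by (simp only: subtree_subtree[OF uW])
  qed
  then show ?thesis unfolding small_hole_def \<sigma>_def[symmetric] using zc by blast
qed

text \<open>
  Only finitely many families of touching cubes exist, hence a single one works for arbitrarily
  small \<open>\<epsilon>\<close>, and its cubes have mass zero.  By regularity their subtrees are extinct after finitely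
  many generations, and the common ball misses the limit set.
\<close>

lemma small_holes_imp_hole:
  assumes r: "regular \<omega>" and le: "r' \<le> r"
    and sm: "\<And>l. small_hole r r' N (1 / real (Suc l)) \<omega>"
  shows "hole_at (limit_set k e \<omega>) r'"
proof -
  have h: "hereditary CARD('n) k \<omega>" using r by (simp add: regular_def)
  have "\<exists>z\<in>centres r. \<forall>\<upsilon>\<in>touching N z r'. X (sub \<upsilon> \<omega>) = 0"
  proof (rule ccontr)
    assume "\<not> ?thesis"
    then have no: "\<exists>\<upsilon>\<in>touching N z r'. X (sub \<upsilon> \<omega>) \<noteq> 0" if "z \<in> centres r" for z using that by blast
    \<comment> \<open>if every family contained a cube of positive mass, then a small \<open>\<epsilon>\<close> would violate all of them at once\<close>
    have "eventually (\<lambda>l. \<forall>T\<in>(\<lambda>z. touching N z r') ` centres r.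
        \<exists>\<upsilon>\<in>T. 1 / real (Suc l) * M ^ N * X \<omega> < X (sub \<upsilon> \<omega>)) sequentially"
    proof (rule eventually_ball_finite[OF finite_touching], rule ballI)
      fix T assume "T \<in> (\<lambda>z. touching N z r') ` centres r"
      then obtain z where z: "z \<in> centres r" "T = touching N z r'" by blast
      obtain \<upsilon> where u: "\<upsilon> \<in> T" "X (sub \<upsilon> \<omega>) \<noteq> 0" using no[OF z(1)] z(2) by blast
      have "\<upsilon> \<in> W" using u(1) unfolding z(2) touching_def by blast
      then have pos: "0 < X (sub \<upsilon> \<omega>)" using regular_X_nonneg[OF r] u(2) by (simp add: less_le)
      have "(\<lambda>l. 1 / real (Suc l) * M ^ N * X \<omega>) \<longlonglongrightarrow> 0 * M ^ N * X \<omega>"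
        by (intro tendsto_mult tendsto_const LIMSEQ_Suc[OF lim_1_over_n])
      then have "eventually (\<lambda>l. 1 / real (Suc l) * M ^ N * X \<omega> < X (sub \<upsilon> \<omega>)) sequentially"
        using pos by (intro order_tendstoD(2)) simp_all
      then show "eventually (\<lambda>l. \<exists>\<upsilon>\<in>T. 1 / real (Suc l) * M ^ N * X \<omega> < X (sub \<upsilon> \<omega>)) sequentially"
        by (rule eventually_mono) (use u(1) in blast)
    qed
    then obtain l where l: "\<forall>T\<in>(\<lambda>z. touching N z r') ` centres r.
        \<exists>\<upsilon>\<in>T. 1 / real (Suc l) * M ^ N * X \<omega> < X (sub \<upsilon> \<omega>)"
      by (auto simp: eventually_sequentially)
    obtain z where z: "z \<in> centres r" "\<forall>\<upsilon>\<in>touching N z r'. X (sub \<upsilon> \<omega>) \<le> 1 / real (Suc l) * M ^ N * X \<omega>"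
      using sm[of l] unfolding small_hole_def by blast
    have "touching N z r' \<in> (\<lambda>z. touching N z r') ` centres r" using z(1) by (rule imageI)
    from bspec[OF l this] obtain \<upsilon> where "\<upsilon> \<in> touching N z r'" "1 / real (Suc l) * M ^ N * X \<omega> < X (sub \<upsilon> \<omega>)"
      by blast
    moreover from this(1) have "X (sub \<upsilon> \<omega>) \<le> 1 / real (Suc l) * M ^ N * X \<omega>" using z(2) by blast
    ultimately show False by linarith
  qed
  then obtain z where z: "z \<in> centres r" "\<And>\<upsilon>. \<upsilon> \<in> touching N z r' \<Longrightarrow> X (sub \<upsilon> \<omega>) = 0" by blast
  have "\<exists>n. generation CARD('n) k n (sub \<upsilon> \<omega>) = 0" if u: "\<upsilon> \<in> touching N z r'" for \<upsilon>
  proof -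
    have "\<upsilon> \<in> W" using u by (simp add: touching_def)
    then have "extinct CARD('n) k (sub \<upsilon> \<omega>)" using r z(2)[OF u] unfolding regular_def by blast
    then show ?thesis by (simp only: extinct_def)
  qed
  then have "\<forall>\<upsilon>\<in>touching N z r'. \<exists>n. generation CARD('n) k n (sub \<upsilon> \<omega>) = 0" by blast
  from bchoice[OF this] obtain f where f: "\<And>\<upsilon>. \<upsilon> \<in> touching N z r' \<Longrightarrow> generation CARD('n) k (f \<upsilon>) (sub \<upsilon> \<omega>) = 0"
    by blast
  have finT: "finite (touching N z r')" unfolding touching_def by (rule finite_subset[OF _ finite_level[of "CARD('n)" k N]]) blast
  define l where "l = Max (insert 0 (f ` touching N z r'))"
  have fl: "f \<upsilon> \<le> l" if "\<upsilon> \<in> touching N z r'" for \<upsilon>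
    unfolding l_def by (rule Max_ge) (use finT that in simp_all)
  have "x \<notin> limit_set k e \<omega>" if x: "x \<in> max_ball z r'" for x
  proof
    assume "x \<in> limit_set k e \<omega>"
    then obtain \<tau> where t: "\<tau> \<in> W" "length \<tau> = N + l" "\<omega> \<tau>" "x \<in> cube k e \<tau>"
      unfolding mem_limit_set by blast
    define \<upsilon> where "\<upsilon> = take N \<tau>"
    have uW: "\<upsilon> \<in> W" unfolding \<upsilon>_def by (rule take_word[OF t(1)])
    have "x \<in> cube k e \<upsilon>" unfolding \<upsilon>_def using cube_prefix[OF t(1)] t(4) by blast
    moreover have "length \<upsilon> = N" using t(2) by (simp add: \<upsilon>_def)
    ultimately have u: "\<upsilon> \<in> touching N z r'" unfolding touching_def using uW x by blast
    have "generation CARD('n) k l (sub \<upsilon> \<omega>) = 0"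
      by (rule generation_zero_mono[OF hereditary_subtree[OF uW h] f[OF u] fl[OF u]])
    moreover have dl: "drop N \<tau> \<in> level CARD('n) k l" using t(2) drop_word[OF t(1)] by simp
    ultimately have "\<not> sub \<upsilon> \<omega> (drop N \<tau>)" unfolding generation_zero_iff by blast
    then show False using t(3) dl by (simp add: subtree_def \<upsilon>_def)
  qed
  then show ?thesis unfolding hole_at_def using z(1) centres_antimono[OF le] by blast
qed

lemma hole_indicator_regular:
  assumes h: "hereditary CARD('n) k \<omega>" and w: "\<omega> \<in> space \<A>"
    and c: "\<eta> \<in> codes CARD('n) k" "\<not> eventually_top \<eta>" and a: "0 < \<alpha>"
  shows "hole_indicator k e \<alpha> (\<eta>, \<omega>) = of_bool (hole_at (limit_set k e \<omega>) (\<alpha> / 2))"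
  unfolding hole_indicator_def split_conv set_hole_scale[OF h c a] by (simp add: subtree_Nil[OF w])

text \<open>
  The \<open>k\<close>-adic cube of level \<open>0\<close> is the unit cube, where a hole is an event of the configuration,
  except for points on an upper face of the unit cube.
\<close>

lemma measurable_hole_indicator:
  assumes a: "0 < \<alpha>" "\<alpha> < 1"
  shows "hole_indicator k e \<alpha> \<in> borel_measurable \<S>"
proof -
  have [measurable]: "Measurable.pred \<A> (\<lambda>\<omega>. hole_at (limit_set k e \<omega>) (\<alpha> / 2))"
    using a by (intro measurable_hole_at) simp
  have [measurable]: "(\<lambda>\<eta>. pt \<eta> $ i) \<in> borel_measurable (code_algebra CARD('n) k)" for i
    by (rule measurable_compose[OF measurable_pt borel_component])
  have eq: "hole_indicator k e \<alpha> z =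
      (if (\<forall>i. pt (fst z) $ i < 1) \<and> \<not> hole_at (limit_set k e (snd z)) (\<alpha> / 2) then 0 else 1)"
    if "z \<in> space \<S>" for z
  proof -
    obtain \<eta> \<omega> where z: "z = (\<eta>, \<omega>)" by (cases z)
    have c: "\<eta> \<in> codes CARD('n) k" and w: "\<omega> \<in> space \<A>"
      using that by (simp_all add: z space_pair_algebra)
    have E: "embed [] y = y" for y by (simp add: vec_eq_iff embed_component corner_Nil)
    have p01: "0 \<le> pt \<eta> $ i \<and> pt \<eta> $ i \<le> 1" for i
      using pt_lower[OF c, of 0 i] pt_upper[OF c, of i 0] by (simp add: corner_Nil)
    show ?thesis
    proof (cases "\<forall>i. pt \<eta> $ i < 1")
      case True
      have "kadic_cube k (length ([] :: nat list)) (pt \<eta>) =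
          {y. \<forall>i. corner k e [] $ i \<le> y $ i \<and> y $ i < corner k e [] $ i + 1 / real k ^ length ([] :: nat list)}"
        using p01 True by (intro kadic_cube_floor) (simp add: corner_Nil)
      then have "embed [] y \<in> kadic_cube k (length ([] :: nat list)) (pt \<eta>) \<longleftrightarrow> (\<forall>i. 0 \<le> y $ i \<and> y $ i < 1)" for y
        by (simp add: E corner_Nil)
      from set_hole_embed[OF this a(1), of "limit_set k e \<omega>"]
      have "set_hole k (limit_set k e \<omega>) 0 (pt \<eta>) \<alpha> \<longleftrightarrow> hole_at (limit_set k e \<omega>) (\<alpha> / 2)"
        by (simp add: E)
      then show ?thesis using True by (simp add: z hole_indicator_def code_point_eq[OF c])
    next
      case False
      then obtain i where "\<not> pt \<eta> $ i < 1" by blast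
      then have i: "pt \<eta> $ i = 1" using p01[of i] by linarith
      \<comment> \<open>the unit cube of such a point lies beyond the limit set, so its centre is the centre of a hole\<close>
      define b where "b = (\<chi> j. real_of_int \<lfloor>pt \<eta> $ j\<rfloor> + 1 / 2)"
      have kad: "y \<in> kadic_cube k 0 (pt \<eta>) \<longleftrightarrow>
          (\<forall>j. real_of_int \<lfloor>pt \<eta> $ j\<rfloor> \<le> y $ j \<and> y $ j < real_of_int \<lfloor>pt \<eta> $ j\<rfloor> + 1)" for y
        by (simp add: kadic_cube_def)
      have ball: "\<bar>y $ j - (real_of_int \<lfloor>pt \<eta> $ j\<rfloor> + 1 / 2)\<bar> < 1 / 2" if "y \<in> max_ball b (\<alpha> / 2)" for y j
      proof -
        have "\<bar>y $ j - (real_of_int \<lfloor>pt \<eta> $ j\<rfloor> + 1 / 2)\<bar> < \<alpha> / 2" using that by (simp add: mem_max_ball b_def)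
        then show ?thesis using a(2) by linarith
      qed
      have ball_kad: "y \<in> kadic_cube k 0 (pt \<eta>)" if "y \<in> max_ball b (\<alpha> / 2)" for y
        unfolding kad
      proof
        fix j show "real_of_int \<lfloor>pt \<eta> $ j\<rfloor> \<le> y $ j \<and> y $ j < real_of_int \<lfloor>pt \<eta> $ j\<rfloor> + 1"
          using ball[OF that, of j] by linarith
      qed
      have off: "y \<notin> limit_set k e \<omega>" if "y \<in> max_ball b (\<alpha> / 2)" for y
      proof
        assume "y \<in> limit_set k e \<omega>"
        then obtain \<tau> where "\<tau> \<in> W" "y \<in> cube k e \<tau>" unfolding mem_limit_set by blast
        then have "y $ i \<le> 1" using cube_unit by blast
        moreover have "\<bar>y $ i - (1 + 1 / 2)\<bar> < 1 / 2"
          using ball[OF that, of i] unfolding i floor_one of_int_1 .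
        then have "1 < y $ i" by linarith
        ultimately show False by linarith
      qed
      have bb: "b \<in> max_ball b (\<alpha> / 2)" using a by (simp add: mem_max_ball)
      have "set_hole k (limit_set k e \<omega>) 0 (pt \<eta>) \<alpha>"
        unfolding set_hole_def using ball_kad[OF bb] ball_kad off by (intro bexI[of _ b]) auto
      then show ?thesis using False by (simp add: z hole_indicator_def code_point_eq[OF c])
    qed
  qed
  show ?thesis by (subst measurable_cong[OF eq]) (assumption, measurable)
qed

end

section \<open>Frequencies of holes and mean porosity\<close>

context mandelbrot
begin

interpretation ES: ergodic_system Q shift by (rule ergodic_shift)

abbreviation "boundary_codes \<equiv> {\<eta> \<in> codes CARD('n) k. eventually_top \<eta>}"

text \<open>
  From some position on, such a code avoids the letters whose digit in one coordinate is not the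
  largest one, and for uniform letters this has probability zero.
\<close>

lemma boundary_codes_null:
  shows "boundary_codes \<in> sets (code_algebra CARD('n) k)"
    and "emeasure Q (boundary_codes \<times> space \<A>) = 0"
proof -
  define B where "B i N = {\<eta> \<in> codes CARD('n) k. \<forall>n\<ge>N. \<eta> n \<in> top_letters i}" for i :: 'n and N :: nat
  have eq: "boundary_codes = (\<Union>i. \<Union>N. B i N)" by (auto simp: B_def eventually_top_def)
  have BM: "B i N \<in> sets (code_algebra CARD('n) k)" and BQ: "emeasure Q (B i N \<times> space \<A>) = 0" for i N
    unfolding B_def by (rule emeasure_Q_restricted_letters[OF top_letters_subset card_top_letters])+
  show bs: "boundary_codes \<in> sets (code_algebra CARD('n) k)"
    unfolding eq by (intro sets.countable_UN'' countableI_type BM)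
  have "(\<Union>i. \<Union>N. B i N \<times> space \<A>) \<in> null_sets Q"
  proof (intro null_sets_UN' countableI_type)
    show "B i N \<times> space \<A> \<in> null_sets Q" for i N
      using BM[of i N] by (intro null_setsI BQ) simp
  qed
  moreover have "boundary_codes \<times> space \<A> = (\<Union>i. \<Union>N. B i N \<times> space \<A>)" unfolding eq by blast
  ultimately show "emeasure Q (boundary_codes \<times> space \<A>) = 0" by (simp add: null_sets_def)
qed

lemma AE_boundary_codes_kernel: "AE \<omega> in P. emeasure (\<mu> \<omega>) boundary_codes = 0"
proof -
  have "boundary_codes \<times> space \<A> \<in> sets \<S>" using boundary_codes_null(1) by simp
  from Q_null_AE[OF this] boundary_codes_null(2)
  have "AE \<omega> in P. emeasure (\<mu> \<omega>) (slice (boundary_codes \<times> space \<A>) \<omega>) = 0" by simp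
  then show ?thesis using AE_space
  proof eventually_elim
    case (elim \<omega>)
    have "slice (boundary_codes \<times> space \<A>) \<omega> = boundary_codes" using elim(2) by (auto simp: slice_def)
    then show ?case using elim(1) by simp
  qed
qed

lemma AE_not_boundary: "AE z in Q. \<not> eventually_top (fst z)"
proof (rule AE_I)
  show "{z \<in> space Q. \<not> \<not> eventually_top (fst z)} \<subseteq> boundary_codes \<times> space \<A>"
    by (auto simp: space_pair_algebra)
  show "emeasure Q (boundary_codes \<times> space \<A>) = 0" by (rule boundary_codes_null)
  show "boundary_codes \<times> space \<A> \<in> sets Q" using boundary_codes_null(1) by simp
qed

definition prob_event :: "((nat list \<Rightarrow> bool) \<Rightarrow> bool) \<Rightarrow> real" where
  "prob_event R = measure Q {z \<in> space Q. R (snd z)}"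

lemma event_sets: "Measurable.pred \<A> R \<Longrightarrow> {z \<in> space Q. R (snd z)} \<in> sets Q"
proof -
  assume R: "Measurable.pred \<A> R"
  have "Measurable.pred \<S> (\<lambda>z. R (snd z))" by (rule measurable_compose[OF measurable_snd R])
  then show ?thesis by (simp add: pred_def)
qed

text \<open>
  Birkhoff's theorem for the shift, applied to a property of the configuration.
\<close>

lemma scale_frequency:
  assumes R: "Measurable.pred \<A> R"
  shows "AE z in Q. (\<lambda>n. real (card {j \<in> {1..n}. R (sub (code_prefix (fst z) j) (snd z))}) / real n) \<longlonglongrightarrow> prob_event R"
proof -
  define f where "f z = (of_bool (R (snd z)) :: real)" for z :: "(nat \<Rightarrow> nat) \<times> (nat list \<Rightarrow> bool)"
  have fm: "f \<in> borel_measurable Q"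
  proof -
    have "(\<lambda>z. indicator {z \<in> space Q. R (snd z)} z :: real) \<in> borel_measurable Q"
      using event_sets[OF R] by (rule borel_measurable_indicator)
    then show ?thesis by (rule measurable_cong[THEN iffD1, rotated]) (simp add: f_def indicator_def)
  qed
  \<comment> \<open>scales are counted from \<open>1\<close>, so the orbit starts after one application of the shift\<close>
  define h where "h z = f (shift z)" for z
  have hm: "h \<in> borel_measurable Q" unfolding h_def[abs_def] by (rule measurable_compose[OF shift_measurable_Q fm])
  have "AE z in Q. (\<lambda>n. ES.birkhoff_sum h n z / real n) \<longlonglongrightarrow> (\<integral>z. h z \<partial>Q)"
    by (rule ES.birkhoff_average[OF hm]) (simp_all add: h_def f_def)
  moreover have "(\<integral>z. h z \<partial>Q) = prob_event R"
  proof -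
    have "(\<integral>z. h z \<partial>Q) = (\<integral>z. f z \<partial>Q)"
      using ES.integral_iterate[OF fm, of 1] by (simp add: h_def)
    also have "\<dots> = (\<integral>z. indicator {z \<in> space Q. R (snd z)} z \<partial>Q)"
      by (rule Bochner_Integration.integral_cong) (simp_all add: f_def indicator_def)
    also have "\<dots> = prob_event R" using event_sets[OF R] by (simp add: prob_event_def)
    finally show ?thesis .
  qed
  ultimately have "AE z in Q. (\<lambda>n. ES.birkhoff_sum h n z / real n) \<longlonglongrightarrow> prob_event R" by simp
  then show ?thesis using AE_space
  proof eventually_elim
    case (elim z)
    obtain \<eta> \<omega> where z: "z = (\<eta>, \<omega>)" by (cases z)
    have c: "\<eta> \<in> codes CARD('n) k" "\<omega> \<in> space \<A>" using elim(2) by (simp_all add: z space_pair_algebra)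
    have "ES.birkhoff_sum h n z = real (card {j \<in> {1..n}. R (sub (code_prefix (fst z) j) (snd z))})" for n
    proof -
      have hs: "h ((shift ^^ i) z) = of_bool (R (sub (code_prefix \<eta> (Suc i)) \<omega>))" for i
      proof -
        have "shift ((shift ^^ i) z) = (shift ^^ Suc i) (\<eta>, \<omega>)" by (simp add: z)
        then show ?thesis unfolding h_def f_def shift_funpow[OF c] by (simp only: shift_funpow[OF c] snd_conv)
      qed
      have "ES.birkhoff_sum h n z = (\<Sum>i<n. of_bool (R (sub (code_prefix \<eta> (Suc i)) \<omega>)))"
        unfolding ES.birkhoff_sum_def hs ..
      also have "\<dots> = (\<Sum>j\<in>{1..n}. of_bool (R (sub (code_prefix \<eta> j) \<omega>)))"
        by (rule sum.reindex_bij_witness[of _ "\<lambda>j. j - 1" Suc]) auto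
      also have "\<dots> = real (card {j \<in> {1..n}. R (sub (code_prefix \<eta> j) \<omega>)})"
        by (subst sum_of_bool_eq) (auto intro!: arg_cong[where f = card])
      finally show ?thesis by (simp add: z)
    qed
    then show ?case using elim(1) by simp
  qed
qed

abbreviation mean_hole :: "real \<Rightarrow> real" where
  "mean_hole \<alpha> \<equiv> integral\<^sup>L Q (hole_indicator k e \<alpha>)"

lemma mean_hole_eq:
  assumes a: "0 < \<alpha>" "\<alpha> < 1"
  shows "mean_hole \<alpha> = prob_event (\<lambda>\<omega>. hole_at (limit_set k e \<omega>) (\<alpha> / 2))"
proof -
  let ?R = "\<lambda>\<omega>. hole_at (limit_set k e \<omega>) (\<alpha> / 2)"
  have R: "Measurable.pred \<A> ?R" using a by (intro measurable_hole_at) simp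
  have "mean_hole \<alpha> = (\<integral>z. indicator {z \<in> space Q. ?R (snd z)} z \<partial>Q)"
  proof (rule integral_cong_AE)
    show "hole_indicator k e \<alpha> \<in> borel_measurable Q"
      using measurable_hole_indicator[OF a] by (simp cong: measurable_cong_sets)
    show "(\<lambda>z. indicator {z \<in> space Q. ?R (snd z)} z :: real) \<in> borel_measurable Q"
      using event_sets[OF R] by (rule borel_measurable_indicator)
    show "AE z in Q. hole_indicator k e \<alpha> z = indicator {z \<in> space Q. ?R (snd z)} z"
      using AE_Q_of_AE_P[OF AE_regular] AE_not_boundary AE_space
    proof eventually_elim
      case (elim z)
      obtain \<eta> \<omega> where z: "z = (\<eta>, \<omega>)" by (cases z)
      have c: "\<eta> \<in> codes CARD('n) k" "\<omega> \<in> space \<A>" using elim(3) by (simp_all add: z space_pair_algebra)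
      have h: "hereditary CARD('n) k \<omega>" using elim(1) by (simp add: z regular_def)
      have "hole_indicator k e \<alpha> (\<eta>, \<omega>) = of_bool (?R \<omega>)"
        by (rule hole_indicator_regular[OF h c(2,1) _ a(1)]) (use elim(2) in \<open>simp add: z\<close>)
      then show ?case using elim(3) by (simp add: z indicator_def)
    qed
  qed
  also have "\<dots> = prob_event ?R" using event_sets[OF R] by (simp add: prob_event_def)
  finally show ?thesis .
qed

text \<open>
  For regular \<open>\<omega>\<close> the condition with \<open>i = l\<close> implies the others.  The conjunction makes the events
  decrease in \<open>l\<close> also where the limit defining \<open>X\<close> does not exist and nothing is known about its sign.
\<close>

definition small_holes_upto :: "real \<Rightarrow> real \<Rightarrow> nat \<Rightarrow> nat \<Rightarrow> (nat list \<Rightarrow> bool) \<Rightarrow> bool" where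
  "small_holes_upto r r' N l \<omega> \<longleftrightarrow> (\<forall>i\<le>l. small_hole r r' N (1 / real (Suc i)) \<omega>)"

lemma measurable_small_holes_upto: "Measurable.pred \<A> (small_holes_upto r r' N l)"
proof -
  have "Measurable.pred \<A> (\<lambda>\<omega>. \<forall>i\<in>{..l}. small_hole r r' N (1 / real (Suc i)) \<omega>)"
  proof (rule pred_intros_finite)
    show "Measurable.pred \<A> (\<lambda>\<omega>. small_hole r r' N (1 / real (Suc i)) \<omega>)" for i
      by (rule measurable_small_hole)
  qed (rule finite_atMost)
  moreover have "small_holes_upto r r' N l = (\<lambda>\<omega>. \<forall>i\<in>{..l}. small_hole r r' N (1 / real (Suc i)) \<omega>)"
    by (simp only: small_holes_upto_def[abs_def] Ball_def atMost_iff)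
  ultimately show ?thesis by (simp only:)
qed

text \<open>
  The events decrease in \<open>l\<close>, and up to a null set their intersection is contained in the event of a
  hole of the limit set.
\<close>

lemma prob_small_holes_limit:
  assumes r: "0 < r'" "r' \<le> r" and c: "prob_event (\<lambda>\<omega>. hole_at (limit_set k e \<omega>) r') < c"
  shows "\<exists>l. prob_event (small_holes_upto r r' N l) < c"
proof -
  define S where "S l = {z \<in> space Q. small_holes_upto r r' N l (snd z)}" for l
  have S: "S l \<in> sets Q" for l unfolding S_def by (rule event_sets[OF measurable_small_holes_upto])
  have "S (Suc l) \<subseteq> S l" for l
    unfolding S_def small_holes_upto_def by (intro Collect_mono) simp
  then have "decseq S" by (rule decseq_SucI)
  then have lim: "(\<lambda>l. measure Q (S l)) \<longlonglongrightarrow> measure Q (\<Inter>l. S l)"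
    by (intro ES.finite_Lim_measure_decseq image_subsetI S)
  have le: "measure Q (\<Inter>l. S l) \<le> prob_event (\<lambda>\<omega>. hole_at (limit_set k e \<omega>) r')"
    unfolding prob_event_def
  proof (rule ES.finite_measure_mono_AE)
    show "{z \<in> space Q. hole_at (limit_set k e (snd z)) r'} \<in> sets Q"
      by (rule event_sets[OF measurable_hole_at[OF r(1)]])
    show "AE z in Q. z \<in> (\<Inter>l. S l) \<longrightarrow> z \<in> {z \<in> space Q. hole_at (limit_set k e (snd z)) r'}"
      using AE_Q_of_AE_P[OF AE_regular] AE_space
    proof eventually_elim
      case (elim z)
      show ?case
      proof
        assume "z \<in> (\<Inter>l. S l)"
        then have "small_hole r r' N (1 / real (Suc l)) (snd z)" for l
          unfolding S_def small_holes_upto_def by blast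
        then have "hole_at (limit_set k e (snd z)) r'" by (rule small_holes_imp_hole[OF elim(1) r(2)])
        then show "z \<in> {z \<in> space Q. hole_at (limit_set k e (snd z)) r'}" using elim(2) by simp
      qed
    qed
  qed
  have "eventually (\<lambda>l. measure Q (S l) < c) sequentially"
    by (rule order_tendstoD(2)[OF lim le_less_trans[OF le c]])
  then obtain l where "measure Q (S l) < c" by (auto simp: eventually_sequentially)
  then show ?thesis unfolding prob_event_def S_def by (rule exI)
qed

lemma natural_measure_mono:
  "A \<subseteq> B \<Longrightarrow> B \<in> sets borel \<Longrightarrow> emeasure (natural_measure k e p \<omega>) A \<le> emeasure (natural_measure k e p \<omega>) B"
  by (rule emeasure_mono) (simp_all add: natural_measure_def)

lemma measure_hole_mono:
  assumes h: "measure_hole k (natural_measure k e p \<omega>) n x \<alpha> \<epsilon>" and a: "\<beta> \<le> \<alpha>" and eps: "\<epsilon> \<le> \<epsilon>'"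
  shows "measure_hole k (natural_measure k e p \<omega>) n x \<beta> \<epsilon>'"
proof -
  let ?\<nu> = "natural_measure k e p \<omega>"
  obtain z where z: "z \<in> kadic_cube k n x" "max_ball z (\<alpha> / 2 / real k ^ n) \<subseteq> kadic_cube k n x"
    "emeasure ?\<nu> (max_ball z (\<alpha> / 2 / real k ^ n)) \<le> ennreal \<epsilon> * emeasure ?\<nu> (kadic_cube k n x)"
    using h unfolding measure_hole_def by blast
  have sub: "max_ball z (\<beta> / 2 / real k ^ n) \<subseteq> max_ball z (\<alpha> / 2 / real k ^ n)"
    using a kpow_pos[of n] by (intro max_ball_mono divide_right_mono) simp_all
  have "emeasure ?\<nu> (max_ball z (\<beta> / 2 / real k ^ n)) \<le> emeasure ?\<nu> (max_ball z (\<alpha> / 2 / real k ^ n))"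
    by (rule natural_measure_mono[OF sub max_ball_borel])
  also note z(3)
  also have "ennreal \<epsilon> * emeasure ?\<nu> (kadic_cube k n x) \<le> ennreal \<epsilon>' * emeasure ?\<nu> (kadic_cube k n x)"
    using eps by (intro mult_right_mono ennreal_leI) simp_all
  finally have le: "emeasure ?\<nu> (max_ball z (\<beta> / 2 / real k ^ n)) \<le> ennreal \<epsilon>' * emeasure ?\<nu> (kadic_cube k n x)" .
  show ?thesis
    unfolding measure_hole_def
  proof (rule bexI[of _ z])
    show "max_ball z (\<beta> / 2 / real k ^ n) \<subseteq> kadic_cube k n x \<and>
        emeasure ?\<nu> (max_ball z (\<beta> / 2 / real k ^ n)) \<le> ennreal \<epsilon>' * emeasure ?\<nu> (kadic_cube k n x)"
      by (rule conjI[OF order_trans[OF sub z(2)] le])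
  qed (rule z(1))
qed

text \<open>
  All almost sure statements that enter the theorem.  Frequencies are required for the countably
  many rational parameters only; the remaining parameters follow by monotonicity.
\<close>

definition typical :: "(nat \<Rightarrow> nat) \<Rightarrow> (nat list \<Rightarrow> bool) \<Rightarrow> bool" where
  "typical \<eta> \<omega> \<longleftrightarrow> \<eta> \<in> codes CARD('n) k \<and> \<omega> \<in> space \<A> \<and> \<not> eventually_top \<eta> \<and> regular \<omega> \<and>
     emeasure (\<mu> \<omega>) boundary_codes = 0 \<and>
     (\<forall>a\<in>\<rat> \<inter> {0<..<1}. (\<lambda>n. real (card {j \<in> {1..n}. hole_at (limit_set k e (sub (code_prefix \<eta> j) \<omega>)) (a / 2)}) / real n)
        \<longlonglongrightarrow> mean_hole a) \<and>
     (\<forall>a\<in>\<rat>. \<forall>a'\<in>\<rat>. \<forall>N l. (\<lambda>n. real (card {j \<in> {1..n}. small_holes_upto (a / 2) (a' / 2) N l (sub (code_prefix \<eta> j) \<omega>)}) / real n)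
        \<longlonglongrightarrow> prob_event (small_holes_upto (a / 2) (a' / 2) N l))"

lemma AE_typical: "AE z in Q. typical (fst z) (snd z)"
proof -
  have 1: "AE z in Q. \<forall>a\<in>\<rat> \<inter> {0<..<1}. (\<lambda>n. real (card {j \<in> {1..n}. hole_at (limit_set k e (sub (code_prefix (fst z) j) (snd z))) (a / 2)}) / real n)
        \<longlonglongrightarrow> mean_hole a"
  proof (subst AE_ball_countable)
    show "countable (\<rat> \<inter> {0<..<1} :: real set)" by (intro countable_Int1 countable_rat)
    show "\<forall>a\<in>\<rat> \<inter> {0<..<1}. AE z in Q. (\<lambda>n. real (card {j \<in> {1..n}. hole_at (limit_set k e (sub (code_prefix (fst z) j) (snd z))) (a / 2)}) / real n)
        \<longlonglongrightarrow> mean_hole a"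
    proof
      fix a :: real assume "a \<in> \<rat> \<inter> {0<..<1}"
      then have a: "0 < a" "a < 1" by simp_all
      show "AE z in Q. (\<lambda>n. real (card {j \<in> {1..n}. hole_at (limit_set k e (sub (code_prefix (fst z) j) (snd z))) (a / 2)}) / real n)
        \<longlonglongrightarrow> mean_hole a"
        unfolding mean_hole_eq[OF a] by (rule scale_frequency[OF measurable_hole_at]) (use a in simp)
    qed
  qed
  have 2: "AE z in Q. \<forall>a\<in>\<rat>. \<forall>a'\<in>\<rat>. \<forall>N l. (\<lambda>n. real (card {j \<in> {1..n}. small_holes_upto (a / 2) (a' / 2) N l (sub (code_prefix (fst z) j) (snd z))}) / real n)
        \<longlonglongrightarrow> prob_event (small_holes_upto (a / 2) (a' / 2) N l)"
    unfolding AE_ball_countable[OF countable_rat] AE_all_countable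
    by (intro ballI allI) (rule scale_frequency[OF measurable_small_holes_upto])
  show ?thesis
    using 1 2 AE_space AE_not_boundary AE_Q_of_AE_P[OF AE_regular] AE_Q_of_AE_P[OF AE_boundary_codes_kernel]
  proof eventually_elim
    case (elim z)
    have "fst z \<in> codes CARD('n) k" "snd z \<in> space \<A>" using elim(3) by (cases z; simp add: space_pair_algebra)+
    then show ?case unfolding typical_def by (intro conjI) (rule elim | assumption)+
  qed
qed

lemma count_le:
  assumes "\<And>j. A j \<Longrightarrow> B j"
  shows "real (card {j \<in> {1..n}. A j}) / real n \<le> real (card {j \<in> {1..n}. B j}) / real n"
proof -
  have "card {j \<in> {1..n}. A j} \<le> card {j \<in> {1..n}. B j}"
  proof (rule card_mono)
    show "{j \<in> {1..n}. A j} \<subseteq> {j \<in> {1..n}. B j}" using assms by blast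
  qed simp
  then show ?thesis by (intro divide_right_mono) simp_all
qed

text \<open>
  Rational parameters slightly below and above \<open>\<alpha>\<close> squeeze the frequency of holes of the limit set
  between values close to \<open>E_Q[\<chi>_0^\<alpha>]\<close>, by continuity at \<open>\<alpha>\<close>.  The frequency of measure holes is at
  least this, and at most the frequency of \<open>small_holes_upto\<close> for a radius parameter slightly below
  \<open>\<alpha>\<close>, whose probability is close to \<open>E_Q[\<chi>_0^\<alpha>]\<close> once \<open>\<epsilon>\<close> is small.
\<close>

lemma typical_mean_porosity:
  assumes t: "typical \<eta> \<omega>" and a: "0 < \<alpha>" "\<alpha> < 1" and ne: "\<alpha> \<notin> exceptional_set k e p"
  shows "set_has_mean_porosity k (limit_set k e \<omega>) (code_point k e \<eta>) \<alpha> (mean_hole \<alpha>)"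
    and "measure_has_mean_porosity k (natural_measure k e p \<omega>) (code_point k e \<eta>) \<alpha> (mean_hole \<alpha>)"
proof -
  let ?\<nu> = "natural_measure k e p \<omega>" and ?x = "code_point k e \<eta>" and ?K = "limit_set k e \<omega>"
  have c: "\<eta> \<in> codes CARD('n) k" "\<not> eventually_top \<eta>" and r: "regular \<omega>"
    and bad: "emeasure (\<mu> \<omega>) boundary_codes = 0" using t unfolding typical_def by blast+
  have h: "hereditary CARD('n) k \<omega>" using r by (simp add: regular_def)
  define hf where "hf b n = real (card {j \<in> {1..n}. hole_at (limit_set k e (sub (code_prefix \<eta> j) \<omega>)) (b / 2)}) / real n" for b n
  have hf: "hf b \<longlonglongrightarrow> mean_hole b" if "b \<in> \<rat>" "0 < b" "b < 1" for b
    using t that unfolding typical_def hf_def[abs_def] by simp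
  define sf where "sf b b' N l n = real (card {j \<in> {1..n}. small_holes_upto (b / 2) (b' / 2) N l (sub (code_prefix \<eta> j) \<omega>)}) / real n"
    for b b' N l n
  have sf: "sf b b' N l \<longlonglongrightarrow> prob_event (small_holes_upto (b / 2) (b' / 2) N l)" if "b \<in> \<rat>" "b' \<in> \<rat>" for b b' N l
    using t that unfolding typical_def sf_def[abs_def] by blast
  have "continuous (at \<alpha> within {0..1}) mean_hole"
    using ne a unfolding exceptional_set_def by simp
  then have cont: "(mean_hole \<longlongrightarrow> mean_hole \<alpha>) (at \<alpha> within {0..1})" by (simp add: continuous_within)
  have below: "\<exists>b\<in>\<rat>. 0 < b \<and> b < \<alpha> \<and> mean_hole b < c" if mc: "mean_hole \<alpha> < c" for c
  proof -
    obtain d where d: "d > 0" "\<And>b. b \<in> {0..1} \<Longrightarrow> b \<noteq> \<alpha> \<Longrightarrow> dist b \<alpha> < d \<Longrightarrow> mean_hole b < c"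
      using order_tendstoD(2)[OF cont mc] unfolding eventually_at by blast
    have "max 0 (\<alpha> - d) < \<alpha>" using a d(1) by simp
    then obtain b where b: "b \<in> \<rat>" "max 0 (\<alpha> - d) < b" "b < \<alpha>" using Rats_dense_in_real by blast
    have "mean_hole b < c" by (rule d(2)) (use b a in \<open>simp_all add: dist_real_def\<close>)
    then show ?thesis using b by auto
  qed
  have above: "\<exists>b\<in>\<rat>. \<alpha> < b \<and> b < 1 \<and> c < mean_hole b" if mc: "c < mean_hole \<alpha>" for c
  proof -
    obtain d where d: "d > 0" "\<And>b. b \<in> {0..1} \<Longrightarrow> b \<noteq> \<alpha> \<Longrightarrow> dist b \<alpha> < d \<Longrightarrow> c < mean_hole b"
      using order_tendstoD(1)[OF cont mc] unfolding eventually_at by blast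
    have "\<alpha> < min 1 (\<alpha> + d)" using a d(1) by simp
    then obtain b where b: "b \<in> \<rat>" "\<alpha> < b" "b < min 1 (\<alpha> + d)" using Rats_dense_in_real by blast
    have "c < mean_hole b" by (rule d(2)) (use b a in \<open>simp_all add: dist_real_def\<close>)
    then show ?thesis using b by auto
  qed
  define s where "s n = real (set_hole_count k ?K ?x \<alpha> n) / real n" for n
  have s_eq: "s n = hf \<alpha> n" for n
    unfolding s_def hf_def set_hole_count_def set_hole_scale[OF h c a(1)] ..
  have hf_mono: "hf b n \<le> hf b' n" if "b' \<le> b" for b b' n
    unfolding hf_def by (rule count_le) (rule hole_at_antimono, assumption, use that in simp)
  have s_lim: "s \<longlonglongrightarrow> mean_hole \<alpha>"
  proof (rule order_tendstoI)
    fix y assume "y < mean_hole \<alpha>"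
    then obtain b where b: "b \<in> \<rat>" "\<alpha> < b" "b < 1" "y < mean_hole b" using above by blast
    have "eventually (\<lambda>n. y < hf b n) sequentially"
      using hf[of b] b a by (intro order_tendstoD(1)) simp_all
    then show "eventually (\<lambda>n. y < s n) sequentially"
    proof (rule eventually_mono)
      fix n assume "y < hf b n"
      then show "y < s n" using hf_mono[OF less_imp_le[OF b(2)], of n] unfolding s_eq by linarith
    qed
  next
    fix y assume "mean_hole \<alpha> < y"
    then obtain b where b: "b \<in> \<rat>" "0 < b" "b < \<alpha>" "mean_hole b < y" using below by blast
    have "eventually (\<lambda>n. hf b n < y) sequentially"
      using hf[of b] b a by (intro order_tendstoD(2)) simp_all
    then show "eventually (\<lambda>n. s n < y) sequentially"
    proof (rule eventually_mono)
      fix n assume "hf b n < y"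
      then show "s n < y" using hf_mono[OF less_imp_le[OF b(3)], of n] unfolding s_eq by linarith
    qed
  qed
  then have s_lim': "(\<lambda>n. ereal (s n)) \<longlonglongrightarrow> ereal (mean_hole \<alpha>)" by simp
  have s_liminf: "liminf (\<lambda>n. ereal (s n)) = ereal (mean_hole \<alpha>)"
    using s_lim' by (rule lim_imp_Liminf[rotated]) simp
  have s_limsup: "limsup (\<lambda>n. ereal (s n)) = ereal (mean_hole \<alpha>)"
    using s_lim' by (rule lim_imp_Limsup[rotated]) simp
  show "set_has_mean_porosity k ?K ?x \<alpha> (mean_hole \<alpha>)"
    unfolding set_has_mean_porosity_def set_lower_porosity_def set_upper_porosity_def
    using s_liminf s_limsup unfolding s_def by blast
  define m where "m \<epsilon> n = real (measure_hole_count k ?\<nu> ?x \<alpha> \<epsilon> n) / real n" for \<epsilon> n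
  have s_le_m: "s n \<le> m \<epsilon> n" for \<epsilon> n
    unfolding s_def m_def set_hole_count_def measure_hole_count_def
    by (rule count_le) (rule set_hole_imp_measure_hole[OF r])
  have lower: "ereal (mean_hole \<alpha>) \<le> liminf (\<lambda>n. ereal (m \<epsilon> n))" for \<epsilon>
    unfolding s_liminf[symmetric] by (intro Liminf_mono always_eventually allI) (simp add: s_le_m)
  \<comment> \<open>rationals \<open>b' < b < \<alpha>\<close>: continuity at \<open>\<alpha>\<close> selects \<open>b'\<close>, and the gap to \<open>b\<close> leaves room for cubes of level \<open>N\<close>\<close>
  have upper: "\<exists>\<epsilon>0>0. \<forall>\<epsilon>. 0 < \<epsilon> \<longrightarrow> \<epsilon> < \<epsilon>0 \<longrightarrow> limsup (\<lambda>n. ereal (m \<epsilon> n)) \<le> ereal y" if y: "mean_hole \<alpha> < y" for y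
  proof -
    obtain b' where b': "b' \<in> \<rat>" "0 < b'" "b' < \<alpha>" "mean_hole b' < y" using below[OF y] by blast
    obtain b where b: "b \<in> \<rat>" "b' < b" "b < \<alpha>" using Rats_dense_in_real[OF b'(3)] by blast
    have "eventually (\<lambda>N. 1 / real k ^ N < (b - b') / 2) sequentially"
      using b(2) by (intro order_tendstoD(2)[OF inverse_kpow_tendsto]) simp
    then obtain N where N: "1 / real k ^ N < (b - b') / 2" by (auto simp: eventually_sequentially)
    have "prob_event (\<lambda>\<omega>. hole_at (limit_set k e \<omega>) (b' / 2)) < y"
      using b'(4) mean_hole_eq[of b'] b' a by simp
    then obtain l where l: "prob_event (small_holes_upto (b / 2) (b' / 2) N l) < y"
      using prob_small_holes_limit[of "b' / 2" "b / 2" y N] b b' by auto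
    show ?thesis
    proof (intro exI[of _ "1 / real (Suc l)"] conjI allI impI)
      show "0 < 1 / real (Suc l)" by simp
      fix \<epsilon> :: real assume eps: "0 < \<epsilon>" "\<epsilon> < 1 / real (Suc l)"
      have "m \<epsilon> n \<le> sf b b' N l n" for n
        unfolding m_def sf_def measure_hole_count_def
      proof (rule count_le)
        fix j assume mh: "measure_hole k ?\<nu> j ?x \<alpha> \<epsilon>"
        show "small_holes_upto (b / 2) (b' / 2) N l (sub (code_prefix \<eta> j) \<omega>)"
          unfolding small_holes_upto_def
        proof (intro allI impI)
          fix i assume "i \<le> l"
          then have "1 / real (Suc l) \<le> 1 / real (Suc i)" by (intro divide_left_mono) simp_all
          then have le: "\<epsilon> \<le> 1 / real (Suc i)" using eps(2) by (rule order_trans[OF less_imp_le, rotated])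
          have mh': "measure_hole k ?\<nu> j ?x b (1 / real (Suc i))"
            by (rule measure_hole_mono[OF mh less_imp_le[OF b(3)] le])
          show "small_hole (b / 2) (b' / 2) N (1 / real (Suc i)) (sub (code_prefix \<eta> j) \<omega>)"
          proof (rule measure_hole_imp_small_hole[OF r c bad boundary_codes_null(1) _ _ _ mh'])
            show "0 < b" using b b' by simp
            show "b' / 2 + 1 / real k ^ N \<le> b / 2" using N by (simp add: field_simps)
            show "0 \<le> 1 / real (Suc i)" by simp
          qed
        qed
      qed
      then have "eventually (\<lambda>n. ereal (m \<epsilon> n) \<le> ereal y) sequentially"
      proof -
        have "eventually (\<lambda>n. sf b b' N l n < y) sequentially"
          using sf[OF b(1) b'(1)] l by (rule order_tendstoD(2))
        then show ?thesis
        proof (rule eventually_mono)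
          fix n assume "sf b b' N l n < y"
          then show "ereal (m \<epsilon> n) \<le> ereal y" using \<open>m \<epsilon> n \<le> sf b b' N l n\<close> by simp
        qed
      qed
      then show "limsup (\<lambda>n. ereal (m \<epsilon> n)) \<le> ereal y" by (rule Limsup_bounded)
    qed
  qed
  have squeeze: "(f \<longlongrightarrow> ereal (mean_hole \<alpha>)) (at_right 0)"
    if f: "\<And>\<epsilon>. liminf (\<lambda>n. ereal (m \<epsilon> n)) \<le> f \<epsilon>" "\<And>\<epsilon>. f \<epsilon> \<le> limsup (\<lambda>n. ereal (m \<epsilon> n))" for f :: "real \<Rightarrow> ereal"
  proof (rule order_tendstoI)
    fix y assume y: "y < ereal (mean_hole \<alpha>)"
    have "y < f \<epsilon>" for \<epsilon> by (rule less_le_trans[OF y order_trans[OF lower f(1)]])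
    then show "eventually (\<lambda>\<epsilon>. y < f \<epsilon>) (at_right 0)" by simp
  next
    fix y assume "ereal (mean_hole \<alpha>) < y"
    then obtain y' where y': "ereal (mean_hole \<alpha>) < ereal y'" "ereal y' < y" using ereal_dense2 by blast
    then have "mean_hole \<alpha> < y'" by simp
    from upper[OF this] obtain \<epsilon>0 where e0: "\<epsilon>0 > 0"
      "\<And>\<epsilon>. 0 < \<epsilon> \<Longrightarrow> \<epsilon> < \<epsilon>0 \<Longrightarrow> limsup (\<lambda>n. ereal (m \<epsilon> n)) \<le> ereal y'" by blast
    show "eventually (\<lambda>\<epsilon>. f \<epsilon> < y) (at_right 0)"
      unfolding eventually_at_right_field
    proof (intro exI[of _ \<epsilon>0] conjI allI impI)
      show "0 < \<epsilon>0" by (rule e0)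
      fix \<epsilon> assume "0 < \<epsilon>" "\<epsilon> < \<epsilon>0"
      then show "f \<epsilon> < y" using le_less_trans[OF order_trans[OF f(2) e0(2)] y'(2)] by blast
    qed
  qed
  have le: "liminf (\<lambda>n. ereal (m \<epsilon> n)) \<le> limsup (\<lambda>n. ereal (m \<epsilon> n))" for \<epsilon>
    by (rule Liminf_le_Limsup) simp
  have lim_lower: "((\<lambda>\<epsilon>. liminf (\<lambda>n. ereal (m \<epsilon> n))) \<longlongrightarrow> ereal (mean_hole \<alpha>)) (at_right 0)"
    by (rule squeeze) (rule order_refl le)+
  have lim_upper: "((\<lambda>\<epsilon>. limsup (\<lambda>n. ereal (m \<epsilon> n))) \<longlongrightarrow> ereal (mean_hole \<alpha>)) (at_right 0)"
    by (rule squeeze) (rule order_refl le)+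
  have "Lim (at_right 0) (\<lambda>\<epsilon>. liminf (\<lambda>n. ereal (m \<epsilon> n))) = ereal (mean_hole \<alpha>)"
    by (rule tendsto_Lim[OF trivial_limit_at_right_real lim_lower])
  moreover have "Lim (at_right 0) (\<lambda>\<epsilon>. limsup (\<lambda>n. ereal (m \<epsilon> n))) = ereal (mean_hole \<alpha>)"
    by (rule tendsto_Lim[OF trivial_limit_at_right_real lim_upper])
  ultimately show "measure_has_mean_porosity k ?\<nu> ?x \<alpha> (mean_hole \<alpha>)"
    unfolding measure_has_mean_porosity_def measure_lower_porosity_def measure_upper_porosity_def m_def by blast
qed

end

theorem theorem4p11:
  fixes k :: nat and p :: real and e :: "nat \<Rightarrow> nat ^ 'n::finite"
  assumes "k \<ge> 2"
    and "subcube_enumeration k e"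
    and "1 / real k ^ CARD('n) < p" and "p \<le> 1"
  shows "AE (\<eta>, \<omega>) in Q_measure k e p.
           \<forall>\<alpha> \<in> {0<..<1} - exceptional_set k e p.
             \<exists>c. set_has_mean_porosity k (limit_set k e \<omega>) (code_point k e \<eta>) \<alpha> c \<and>
                 measure_has_mean_porosity k (natural_measure k e p \<omega>) (code_point k e \<eta>) \<alpha> c"
proof -
  interpret mandelbrot k p e
    by unfold_locales (use assms in auto)
  show ?thesis
    using AE_typical
  proof eventually_elim
    case (elim z)
    obtain \<eta> \<omega> where z: "z = (\<eta>, \<omega>)" by (cases z)
    have t: "typical \<eta> \<omega>" using elim by (simp add: z)
    show ?case
      unfolding z split_conv
    proof
      fix \<alpha> :: real assume "\<alpha> \<in> {0<..<1} - exceptional_set k e p"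
      then have a: "0 < \<alpha>" "\<alpha> < 1" "\<alpha> \<notin> exceptional_set k e p" by simp_all
      show "\<exists>c. set_has_mean_porosity k (limit_set k e \<omega>) (code_point k e \<eta>) \<alpha> c \<and>
          measure_has_mean_porosity k (natural_measure k e p \<omega>) (code_point k e \<eta>) \<alpha> c"
        using typical_mean_porosity[OF t a] by blast
    qed
  qed
qed

end
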